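(* Let $1<p\le q<\infty$. If $$0<\alpha,\quad 0<\rho,\quad \alpha p'<2(n+1),\quad q\rho<4n+1,\quad\text{and}\quad -\frac{\alpha}{2(n+1)}+\frac1{p'}+\frac{\rho}{4n+1}-\frac1q=0,$$ then there exists a constant $C$ such that for all $f\in\mathcal{S}(\mathbb{H}^n)$, $$\left(\int_{\Omega\times\mathbb{C}^n}|\tilde f(a,w)|^q\,u_\rho(a,w)^q\,dw\,d\nu_2(a)\right)^{1/q}\le C\left(\int_{\mathbb{H}^n}|f(z,t)|^p\,v_\alpha(z,t)^p\,dz\,dt\right)^{1/p},$$ where $v_\alpha(z,t)=(|z|^4+16t^2)^{\alpha/4}$ on $\mathbb{H}^n$, and, on $\Omega\times\mathbb{C}^n$, $u_\rho(a,w)=(|a|+|w|)^{-\rho}$ for $a=(\lambda,(2k+n)|\lambda|)$ with $\lambda\ne0$, $w\neq0$, where $|a|=(2k+n+1)|\lambda|$, and $u_\rho(a,w)=0$ otherwise.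
   Context: The Heisenberg group $\mathbb{H}^n=\mathbb{C}^n\times\mathbb{R}$ ($n\ge1$) has group law $(z,t)(w,s)=(z+w,\,t+s+\frac12\operatorname{Im}(z\cdot\bar w))$, with Lebesgue (Haar) measure $dz\,dt$; $\mathcal{S}(\mathbb{H}^n)$ is the Schwartz space on $\mathbb{C}^n\times\mathbb{R}$. For $\delta>-1$, $k\in\{0,1,2,\dots\}$, the Laguerre polynomial is $L_k^\delta(t)=\frac{t^{-\delta}e^t}{k!}\left(\frac{d}{dt}\right)^k(e^{-t}t^{k+\delta})$. For $\lambda\in\mathbb{R}^*=\mathbb{R}\setminus\{0\}$ put $\varphi^{n-1}_{k,\lambda}(z)=L^{n-1}_k(\frac12|\lambda||z|^2)e^{-\frac14|\lambda||z|^2}$ and $e^{n-1}_{k,\lambda}(z,t)=e^{i\lambda t}\varphi^{n-1}_{k,\lambda}(z)$. The Heisenberg fan $\Omega$ is the union of the rays $R_k=\{(\lambda,(2k+n)|\lambda|):\lambda\in\mathbb{R}^*\}$, $k=0,1,2,\dots$, and $R_\infty=\{(0,\tau):\tau\ge0\}$. The Strichartz Fourier transform of $f$ is the function on $\Omega\times\mathbb{C}^n$ given by $\widehat f(a,w)=\int_{\mathbb{H}^n}f(z,t)\,e_a((z,t)^{-1}(w,0))\,dz\,dt$ for $a=(\lambda,(2k+n)|\lambda|)\in R_k$, where $e_a=e^{n-1}_{k,\lambda}$, and $\widehat f(0,\tau,w)=(n-1)!\,2^{n-1}\int_{\mathbb{H}^n}f(z,t)\frac{J_{n-1}(\sqrt\tau|w-z|)}{(\sqrt\tau|w-z|)^{n-1}}\,dz\,dt$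 on $R_\infty$ ($J_{n-1}$ the Bessel function). The normalized transform is $\tilde f(a,w)=\frac{k!(n-1)!}{(k+n-1)!}\widehat f(a,w)$ for $a\in R_k$ and $\tilde f(0,\tau,w)=\widehat f(0,\tau,w)$. The measure $\nu_2$ on $\Omega$ is defined by $$\int_\Omega\phi(a)\,d\nu_2(a)=(2\pi)^{-2n-1}\int_{-\infty}^\infty\left(\sum_{k=0}^\infty\left(\frac{(k+n-1)!}{k!(n-1)!}\right)^2\phi(\lambda,(2k+n)|\lambda|)\right)|\lambda|^{2n}\,d\lambda.$$ $p'$ is the Hölder conjugate of $p$. *)

theory Defs
  imports "HOL-Analysis.Analysis" "HOL-Computational_Algebra.Polynomial"
begin

text \<open>
  The carrier is C^n x R with n = CARD('n). The norm on \<^typ>\<open>complex ^ 'n\<close> is the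
  Euclidean one, and \<^const>\<open>lborel\<close> on the product type is Lebesgue measure dz dt.
\<close>

type_synonym 'n heis = "(complex ^ 'n) \<times> real"

definition hmult :: "'n::finite heis \<Rightarrow> 'n heis \<Rightarrow> 'n heis" where
  "hmult x y = (fst x + fst y,
     snd x + snd y + (1/2) * Im (\<Sum>i\<in>UNIV. fst x $ i * cnj (fst y $ i)))"

definition hinv :: "'n::finite heis \<Rightarrow> 'n heis" where
  "hinv x = (- fst x, - snd x)"

lemma hmult_hinv: "hmult (hinv x) x = (0, 0)" "hmult x (hinv x) = (0, 0)"
  by (simp_all add: hmult_def hinv_def flip: of_real_sum)

lemma hmult_zero: "hmult (0, 0) x = x" "hmult x (0, 0) = x"
  by (simp_all add: hmult_def)

lemma hmult_assoc: "hmult (hmult x y) z = hmult x (hmult y z)"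
  by (simp add: hmult_def algebra_simps sum.distrib)

primrec iterated_partial ::
  "'a::euclidean_space list \<Rightarrow> ('a \<Rightarrow> complex) \<Rightarrow> 'a \<Rightarrow> complex" where
  "iterated_partial [] f = f"
| "iterated_partial (b # bs) f = (\<lambda>x. frechet_derivative (iterated_partial bs f) (at x) b)"

definition schwartz :: "('a::euclidean_space \<Rightarrow> complex) set" where
  "schwartz = {f. \<forall>bs. set bs \<subseteq> Basis \<longrightarrow>
     (\<forall>x. iterated_partial bs f differentiable (at x)) \<and>
     (\<forall>N::nat. bounded (range (\<lambda>x. (1 + norm x) ^ N *\<^sub>R iterated_partial bs f x)))}"

text \<open>
  The Rodrigues formula involves \<open>t powr (-\<delta>)\<close> and is read for t > 0; the
  Laguerre polynomial is the polynomial it defines, which also supplies the value at 0.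
  Existence and uniqueness are shown below.
\<close>

definition rodrigues :: "nat \<Rightarrow> real \<Rightarrow> real \<Rightarrow> real" where
  "rodrigues k \<delta> t =
     t powr (- \<delta>) * exp t / fact k * (deriv ^^ k) (\<lambda>s. exp (- s) * s powr (real k + \<delta>)) t"

definition laguerre :: "nat \<Rightarrow> real \<Rightarrow> real poly" where
  "laguerre k \<delta> = (THE p. \<forall>t>0. poly p t = rodrigues k \<delta> t)"

lemma deriv_funpow_exp_powr:
  fixes a :: real
  shows "\<exists>p. \<forall>t>0. (deriv ^^ j) (\<lambda>s. exp (- s) * s powr a) t
           = exp (- t) * t powr (a - real j) * poly p t"
proof (induction j)
  case 0
  show ?case by (intro exI[of _ 1]) simp
next
  case (Suc j)
  define g where "g = (deriv ^^ j) (\<lambda>s::real. exp (- s) * s powr a)"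
  obtain p where p: "\<And>t. t > 0 \<Longrightarrow> g t = exp (- t) * t powr (a - real j) * poly p t"
    using Suc unfolding g_def by auto
  define r where "r = [:0, -1:] * p + smult (a - real j) p + [:0, 1:] * pderiv p"
  have "deriv g t = exp (- t) * t powr (a - real (Suc j)) * poly r t" if t: "t > 0" for t
  proof -
    have ev: "eventually (\<lambda>s. g s = exp (- s) * s powr (a - real j) * poly p s) (nhds t)"
      using eventually_nhds_in_open[of "{0<..}" t] t
      by (auto elim!: eventually_mono simp: p)
    have tp: "t powr (a - real j) = t powr (a - real (Suc j)) * t"
      using t powr_add[of t "a - real (Suc j)" 1] by (simp add: algebra_simps)
    have "((\<lambda>s. exp (- s) * s powr (a - real j) * poly p s) has_field_derivative
        exp (- t) * t powr (a - real (Suc j)) * poly r t) (at t)"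
      using t
      by (auto intro!: derivative_eq_intros simp: r_def tp)
         (simp add: algebra_simps)
    hence "(g has_field_derivative exp (- t) * t powr (a - real (Suc j)) * poly r t) (at t)"
      using DERIV_cong_ev[OF refl ev refl] by simp
    thus ?thesis by (rule DERIV_imp_deriv)
  qed
  thus ?case by (intro exI[of _ r]) (simp add: g_def)
qed

lemma poly_laguerre:
  assumes "t > 0"
  shows "poly (laguerre k \<delta>) t = rodrigues k \<delta> t"
proof -
  obtain p where p: "\<And>t. t > 0 \<Longrightarrow> (deriv ^^ k) (\<lambda>s. exp (- s) * s powr (real k + \<delta>)) t
           = exp (- t) * t powr (real k + \<delta> - real k) * poly p t"
    using deriv_funpow_exp_powr[of k "real k + \<delta>"] by blast
  have ex: "poly (smult (1 / fact k) p) t = rodrigues k \<delta> t" if "t > 0" for t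
  proof -
    have "rodrigues k \<delta> t = t powr (- \<delta>) * exp t / fact k * (exp (- t) * t powr \<delta> * poly p t)"
      by (simp only: rodrigues_def p[OF that] add_diff_cancel_left')
    also have "\<dots> = (t powr (- \<delta>) * t powr \<delta>) * (exp t * exp (- t)) * (1 / fact k * poly p t)"
      by (simp add: mult_ac)
    also have "t powr (- \<delta>) * t powr \<delta> = 1"
      using that by (simp flip: powr_add)
    also have "exp t * exp (- t) = 1"
      by (simp flip: exp_add)
    finally show ?thesis by simp
  qed
  have uniq: "q = q'" if "\<forall>t>0. poly q t = rodrigues k \<delta> t" "\<forall>t>0. poly q' t = rodrigues k \<delta> t"
    for q q' :: "real poly"
  proof -
    have "{0<..} \<subseteq> {t. poly (q - q') t = 0}"
      using that by auto
    moreover have "infinite {0::real<..}"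
      by (simp add: infinite_Ioi)
    ultimately have "infinite {t. poly (q - q') t = 0}"
      by (rule infinite_super)
    thus ?thesis using poly_roots_finite[of "q - q'"] by auto
  qed
  have "\<forall>t>0. poly (laguerre k \<delta>) t = rodrigues k \<delta> t"
    unfolding laguerre_def by (rule theI') (use ex uniq in blast)
  thus ?thesis using assms by blast
qed

definition phi :: "nat \<Rightarrow> real \<Rightarrow> complex ^ 'n::finite \<Rightarrow> real" where
  "phi k l z = poly (laguerre k (real CARD('n) - 1)) (1/2 * \<bar>l\<bar> * (norm z)\<^sup>2)
     * exp (- (1/4) * \<bar>l\<bar> * (norm z)\<^sup>2)"

definition efun :: "nat \<Rightarrow> real \<Rightarrow> 'n::finite heis \<Rightarrow> complex" where
  "efun k l x = exp (\<i> * of_real (l * snd x)) * of_real (phi k l (fst x))"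

definition bessel_J :: "nat \<Rightarrow> real \<Rightarrow> real" where
  "bessel_J m x = (\<Sum>j. (-1) ^ j / (fact j * fact (j + m)) * (x / 2) ^ (2 * j + m))"

lemma summable_bessel_J:
  "summable (\<lambda>j. (-1) ^ j / (fact j * fact (j + m)) * (x / 2) ^ (2 * j + m) :: real)"
proof (rule summable_comparison_test')
  show "summable (\<lambda>j. \<bar>x / 2\<bar> ^ m * (inverse (fact j) * ((x / 2)\<^sup>2) ^ j))"
    by (intro summable_mult summable_exp)
  fix j :: nat
  have "(1::real) \<le> fact (j + m)" by simp
  hence "inverse (fact j * fact (j + m) :: real) \<le> inverse (fact j)"
    by (intro le_imp_inverse_le) (simp_all add: mult_le_cancel_left1)
  hence le: "\<bar>x / 2\<bar> ^ m * ((x / 2)\<^sup>2) ^ j * inverse (fact j * fact (j + m))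
      \<le> \<bar>x / 2\<bar> ^ m * ((x / 2)\<^sup>2) ^ j * inverse (fact j)"
    by (rule mult_left_mono) simp
  have eq: "\<bar>x / 2\<bar> ^ (2 * j + m) = \<bar>x / 2\<bar> ^ m * ((x / 2)\<^sup>2) ^ j"
    unfolding power_add power_mult power2_abs by (rule mult.commute)
  have "norm ((-1) ^ j / (fact j * fact (j + m)) * (x / 2) ^ (2 * j + m) :: real)
      = \<bar>x / 2\<bar> ^ (2 * j + m) * inverse (fact j * fact (j + m))"
    unfolding norm_mult[of "_ / _"] norm_power real_norm_def
    by (subst mult.commute, subst abs_divide) (simp add: abs_mult power_abs inverse_eq_divide)
  also note eq
  also note le
  finally show "norm ((-1) ^ j / (fact j * fact (j + m)) * (x / 2) ^ (2 * j + m) :: real)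
      \<le> \<bar>x / 2\<bar> ^ m * (inverse (fact j) * ((x / 2)\<^sup>2) ^ j)"
    by (simp only: mult.assoc mult.commute mult.left_commute)
qed

text \<open>The removable singularity of J_m(x) / x^m at 0 is filled in; it matters for tau = 0.\<close>

definition bessel_quot :: "nat \<Rightarrow> real \<Rightarrow> real" where
  "bessel_quot m x = (if x = 0 then 1 / (2 ^ m * fact m) else bessel_J m x / x ^ m)"

lemma bessel_quot_eq:
  "bessel_quot m x = (\<Sum>j. (-1) ^ j / (fact j * fact (j + m) * 2 ^ (2 * j + m)) * x ^ (2 * j))"
proof (cases "x = 0")
  case True
  have "(\<Sum>j. (-1) ^ j / (fact j * fact (j + m) * 2 ^ (2 * j + m)) * (0::real) ^ (2 * j))
      = (\<Sum>j\<in>{0}. (-1) ^ j / (fact j * fact (j + m) * 2 ^ (2 * j + m)) * (0::real) ^ (2 * j))"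
    by (rule suminf_finite) auto
  thus ?thesis using True by (simp add: bessel_quot_def)
next
  case False
  have "bessel_quot m x
      = (\<Sum>j. (-1) ^ j / (fact j * fact (j + m)) * (x / 2) ^ (2 * j + m) / x ^ m)"
    using False by (simp only: bessel_quot_def bessel_J_def suminf_divide[OF summable_bessel_J] if_False)
  also have "\<dots> = (\<Sum>j. (-1) ^ j / (fact j * fact (j + m) * 2 ^ (2 * j + m)) * x ^ (2 * j))"
    using False by (intro arg_cong[of _ _ suminf] ext) (simp add: power_divide power_add)
  finally show ?thesis .
qed

definition fan_point :: "nat \<Rightarrow> nat \<Rightarrow> real \<Rightarrow> real \<times> real" where
  "fan_point n k l = (l, (2 * real k + real n) * \<bar>l\<bar>)"

definition ray :: "nat \<Rightarrow> nat \<Rightarrow> (real \<times> real) set" where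
  "ray n k = {fan_point n k l | l. l \<noteq> 0}"

definition ray_infinity :: "(real \<times> real) set" where
  "ray_infinity = {(0, \<tau>) | \<tau>. \<tau> \<ge> 0}"

definition fan :: "nat \<Rightarrow> (real \<times> real) set" where
  "fan n = (\<Union>k. ray n k) \<union> ray_infinity"

definition ray_index :: "nat \<Rightarrow> real \<times> real \<Rightarrow> nat" where
  "ray_index n a = (THE k. a \<in> ray n k)"

lemma ray_index_fan_point: "l \<noteq> 0 \<Longrightarrow> ray_index n (fan_point n k l) = k"
  unfolding ray_index_def by (rule the_equality) (auto simp: ray_def fan_point_def)

lemma fan_point_in_fan: "fan_point n k l \<in> fan n"
  by (cases "l = 0") (auto simp: fan_def ray_def ray_infinity_def fan_point_def)

text \<open>
  The measure is the image of a weighted measure on the parameters (k, lambda); the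
  defining integral formula is \<open>nn_integral_nu2\<close>. The parameter lambda = 0 is a null set.
\<close>

definition nu2 :: "nat \<Rightarrow> (real \<times> real) measure" where
  "nu2 n = distr
     (density (count_space UNIV \<Otimes>\<^sub>M lborel)
        (\<lambda>(k, l). ennreal ((fact (k + n - 1) / (fact k * fact (n - 1)))\<^sup>2
            * \<bar>l\<bar> ^ (2 * n) / (2 * pi) ^ (2 * n + 1))))
     (restrict_space borel (fan n))
     (\<lambda>(k, l). fan_point n k l)"

lemma space_nu2 [simp]: "space (nu2 n) = fan n"
  and sets_nu2: "sets (nu2 n) = sets (restrict_space borel (fan n))"
  by (simp_all add: nu2_def space_restrict_space)

lemma measurable_fan_point:
  "(\<lambda>(k, l). fan_point n k l) \<in> count_space UNIV \<Otimes>\<^sub>M lborel \<rightarrow>\<^sub>M restrict_space borel (fan n)"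
proof (rule measurable_restrict_space2)
  show "(\<lambda>(k, l). fan_point n k l) \<in> space (count_space UNIV \<Otimes>\<^sub>M lborel) \<rightarrow> fan n"
    by (auto simp: fan_point_in_fan)
  show "(\<lambda>(k, l). fan_point n k l) \<in> borel_measurable (count_space UNIV \<Otimes>\<^sub>M lborel)"
    unfolding fan_point_def case_prod_beta by measurable
qed

lemma nn_integral_nu2:
  assumes [measurable]: "\<phi> \<in> borel_measurable (restrict_space borel (fan n))"
  shows "(\<integral>\<^sup>+a. \<phi> a \<partial>nu2 n) = ennreal (1 / (2 * pi) ^ (2 * n + 1)) *
     (\<integral>\<^sup>+l. (\<Sum>k. ennreal ((fact (k + n - 1) / (fact k * fact (n - 1)))\<^sup>2) * \<phi> (fan_point n k l))
         * ennreal (\<bar>l\<bar> ^ (2 * n)) \<partial>lborel)"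
proof -
  note measurable_fan_point[measurable]
  have meas: "(\<lambda>x. \<phi> (fan_point n (fst x) (snd x))) \<in> borel_measurable (count_space UNIV \<Otimes>\<^sub>M lborel)"
    using measurable_compose[OF measurable_fan_point assms] by (simp add: case_prod_beta)
  have meas1 [measurable]: "(\<lambda>l. \<phi> (fan_point n k l)) \<in> borel_measurable lborel" for k
    using measurable_compose[OF measurable_Pair1'[of k "count_space UNIV" lborel] meas] by simp
  interpret C: sigma_finite_measure "count_space (UNIV :: nat set)"
    by (rule sigma_finite_measure_count_space)
  interpret P: pair_sigma_finite "count_space (UNIV :: nat set)" "lborel :: real measure" ..
  let ?c = "\<lambda>k::nat. (fact (k + n - 1) / (fact k * fact (n - 1)))\<^sup>2 :: real"
  let ?d = "1 / (2 * pi) ^ (2 * n + 1)"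
  let ?g = "\<lambda>k l. ennreal (?c k * \<bar>l\<bar> ^ (2 * n) / (2 * pi) ^ (2 * n + 1)) * \<phi> (fan_point n k l)"
  have g: "?g k l = ennreal ?d * (ennreal (?c k) * \<phi> (fan_point n k l) * ennreal (\<bar>l\<bar> ^ (2 * n)))"
    for k l
  proof -
    have "ennreal (?c k * \<bar>l\<bar> ^ (2 * n) / (2 * pi) ^ (2 * n + 1))
        = ennreal (?d * (?c k * \<bar>l\<bar> ^ (2 * n)))" by simp
    also have "\<dots> = ennreal ?d * (ennreal (?c k) * ennreal (\<bar>l\<bar> ^ (2 * n)))"
      by (subst ennreal_mult | simp)+
    finally show ?thesis by (simp add: mult_ac)
  qed
  have "(\<integral>\<^sup>+a. \<phi> a \<partial>nu2 n) = (\<integral>\<^sup>+x. ?g (fst x) (snd x) \<partial>(count_space UNIV \<Otimes>\<^sub>M lborel))"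
    unfolding nu2_def
    by (subst nn_integral_distr)
       (simp_all add: case_prod_beta nn_integral_density meas measurable_fan_point[unfolded case_prod_beta])
  also have "\<dots> = (\<integral>\<^sup>+l. \<integral>\<^sup>+k. ?g k l \<partial>count_space UNIV \<partial>lborel)"
    by (subst P.nn_integral_snd[symmetric])
       (auto simp: case_prod_beta intro!: borel_measurable_times_ennreal meas)
  also have "\<dots> = (\<integral>\<^sup>+l. ennreal ?d * ((\<Sum>k. ennreal (?c k) * \<phi> (fan_point n k l)) * ennreal (\<bar>l\<bar> ^ (2 * n))) \<partial>lborel)"
    by (simp only: nn_integral_count_space_nat g ennreal_suminf_cmult ennreal_suminf_multc)
  also have "\<dots> = ennreal ?d *
     (\<integral>\<^sup>+l. (\<Sum>k. ennreal (?c k) * \<phi> (fan_point n k l)) * ennreal (\<bar>l\<bar> ^ (2 * n)) \<partial>lborel)"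
    by (rule nn_integral_cmult) measurable
  finally show ?thesis .
qed

text \<open>
  Both transforms are functions on \<open>fan n \<times> UNIV\<close>; their values at other first
  arguments are irrelevant. A point of the fan lies on some \<open>ray n k\<close> iff its first
  coordinate is nonzero.
\<close>

definition strichartz ::
  "('n::finite heis \<Rightarrow> complex) \<Rightarrow> real \<times> real \<Rightarrow> complex ^ 'n \<Rightarrow> complex" where
  "strichartz f a w =
     (if fst a \<noteq> 0 then
        (\<integral>x. f x * efun (ray_index CARD('n) a) (fst a) (hmult (hinv x) (w, 0)) \<partial>lborel)
      else
        fact (CARD('n) - 1) * 2 ^ (CARD('n) - 1) *
        (\<integral>x. f x * of_real (bessel_quot (CARD('n) - 1) (sqrt (snd a) * norm (w - fst x))) \<partial>lborel))"

definition normalized_strichartz ::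
  "('n::finite heis \<Rightarrow> complex) \<Rightarrow> real \<times> real \<Rightarrow> complex ^ 'n \<Rightarrow> complex" where
  "normalized_strichartz f a w =
     (if fst a \<noteq> 0 then
        (let k = ray_index CARD('n) a in
         of_real (fact k * fact (CARD('n) - 1) / fact (k + CARD('n) - 1)) * strichartz f a w)
      else strichartz f a w)"

definition v_weight :: "real \<Rightarrow> 'n::finite heis \<Rightarrow> real" where
  "v_weight \<alpha> x = (norm (fst x) ^ 4 + 16 * (snd x)\<^sup>2) powr (\<alpha> / 4)"

definition fan_norm :: "nat \<Rightarrow> real \<times> real \<Rightarrow> real" where
  "fan_norm n a = (2 * real (ray_index n a) + real n + 1) * \<bar>fst a\<bar>"

definition u_weight :: "real \<Rightarrow> real \<times> real \<Rightarrow> complex ^ 'n::finite \<Rightarrow> real" where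
  "u_weight \<rho> a w =
     (if fst a \<noteq> 0 \<and> w \<noteq> 0 then (fan_norm CARD('n) a + norm w) powr (- \<rho>) else 0)"

text \<open>Only used with a positive exponent, whence the value at infinity.\<close>

definition ennreal_rpow :: "ennreal \<Rightarrow> real \<Rightarrow> ennreal" where
  "ennreal_rpow x r = (if x = \<infinity> then \<infinity> else ennreal (enn2real x powr r))"

lemma ennreal_rpow_ennreal: "0 \<le> x \<Longrightarrow> ennreal_rpow (ennreal x) r = ennreal (x powr r)"
  by (simp add: ennreal_rpow_def)

end

theory Submission
  imports Defs "HOL-Probability.Probability"
begin

text \<open>
  The normalized transform is an integral operator whose kernel is bounded by 1, so it maps \<open>L\<^sup>1\<close>
  to \<open>L\<^sup>\<infinity>\<close>. It also maps \<open>L\<^sup>2\<close> to \<open>L\<^sup>2\<close>: for fixed \<open>\<lambda>\<close> the functions \<open>\<phi>\<close> are, up to a factor,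
  reproducing kernels of mutually orthogonal spaces under twisted convolution, because their
  generating function is a family of Gaussians closed under twisted convolution; hence Bessel's
  inequality in \<open>z\<close> and the Plancherel inequality in \<open>t\<close> apply. Marcinkiewicz interpolation gives
  \<open>L\<^sup>r\<close> to \<open>L\<^sup>r'\<close> for \<open>1 < r \<le> 2\<close>.

  A sublevel set of \<open>v_weight\<close> or of the reciprocal of \<open>u_weight\<close> has measure a power of the level.
  Cut both spaces into shells of measure about \<open>2\<^sup>j\<close> and \<open>2\<^sup>i\<close>. With \<open>\<theta> = 1/p' - \<alpha>/(2n+2)
  = 1/q - \<rho>/(4n+1) > 0\<close> the \<open>L\<^sup>1\<close> bound controls the block (i, j) by \<open>2\<close> to the power
  \<open>\<theta> (i + j)\<close>, and interpolation with \<open>1/r' = min (1/p') (1/q) > \<theta>\<close> controls it by \<open>2\<close> to the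
  power \<open>(\<theta> - 1/r') (i + j)\<close>. The resulting decay in \<open>\<bar>i + j\<bar>\<close> is summable since \<open>p \<le> q\<close>.
\<close>


section \<open>Interpolation between L^1 and L^2\<close>

text \<open>The group enters the interpolation argument only through four facts: a kernel bounded by
  1, one \<open>L\<^sup>2\<close> inequality and two volume bounds. That argument is therefore
  carried out for abstract measures \<open>M\<close> and \<open>N\<close>. It is stated for
  integrable functions, on which the transform is an absolutely convergent integral; cutting such a
  function by height or by shell leaves it integrable, so no operator has to be extended by density.
  Only upper bounds are wanted, which is why Bessel's inequality can stand in for completeness of
  the \<open>phi k l\<close> and a Plancherel inequality for the equality.

  The normalization of the transform makes both end points work: its factor is the reciprocal of the
  value of \<open>phi k l\<close> at 0, where the absolute value of \<open>phi k l\<close> is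
  largest, and its square cancels the multiplicity in \<open>nu2\<close>.\<close>

lemma nn_integral_powr_0:
  fixes a c :: real
  assumes "a > -1" "c \<ge> 0"
  shows "(\<integral>\<^sup>+s. ennreal (s powr a) * indicator {0..c} s \<partial>lborel) = ennreal (c powr (a + 1) / (a + 1))"
proof -
  have "(\<integral>\<^sup>+s. ennreal (indicator {0..c} s * s powr a) \<partial>lborel) = ennreal (c powr (a + 1) / (a + 1))"
    by (rule nn_integral_has_integral_lebesgue) (use has_integral_powr_from_0[OF assms] in auto)
  thus ?thesis by (simp add: ennreal_mult' mult.commute ennreal_indicator)
qed

text \<open>The \<open>L\<^sup>2\<close> hypothesis is asked of integrable functions, with a right
  side that may be infinite; so it applies to every truncation of an integrable function without a
  separate check of square integrability.\<close>

locale kernel_op = N: sigma_finite_measure N + M: sigma_finite_measure M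
  for M :: "'a measure" and N :: "'b measure" +
  fixes K :: "'b \<Rightarrow> 'a \<Rightarrow> complex" and c\<^sub>2 :: real
  assumes K_meas [measurable]: "(\<lambda>(y, x). K y x) \<in> borel_measurable (N \<Otimes>\<^sub>M M)"
    and K_bound: "\<And>y x. y \<in> space N \<Longrightarrow> norm (K y x) \<le> 1"
    and c2_nonneg: "0 \<le> c\<^sub>2"
    and L2_bound: "\<And>f. integrable M f \<Longrightarrow>
      (\<integral>\<^sup>+y. ennreal (norm (\<integral>x. f x * K y x \<partial>M) ^ 2) \<partial>N)
        \<le> ennreal c\<^sub>2 * (\<integral>\<^sup>+x. ennreal (norm (f x) ^ 2) \<partial>M)"
begin

sublocale NM: pair_sigma_finite N M ..

definition T :: "('a \<Rightarrow> complex) \<Rightarrow> 'b \<Rightarrow> complex" where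
  "T f y = (\<integral>x. f x * K y x \<partial>M)"

lemma K_meas_snd: "y \<in> space N \<Longrightarrow> K y \<in> borel_measurable M"
  using measurable_compose[OF measurable_Pair1' K_meas] by simp

lemma T_meas [measurable]:
  assumes [measurable]: "f \<in> borel_measurable M"
  shows "T f \<in> borel_measurable N"
  unfolding T_def by measurable

lemma integrable_kernel:
  assumes "integrable M f" "y \<in> space N"
  shows "integrable M (\<lambda>x. f x * K y x)"
proof (rule Bochner_Integration.integrable_bound[OF assms(1)])
  show "(\<lambda>x. f x * K y x) \<in> borel_measurable M"
    using K_meas_snd[OF assms(2)] assms(1) by measurable
  show "AE x in M. norm (f x * K y x) \<le> norm (f x)"
    using K_bound[OF assms(2)] by (auto simp: norm_mult mult_left_le)
qed

lemma T_bound: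
  assumes "integrable M f" "y \<in> space N"
  shows "norm (T f y) \<le> (\<integral>x. norm (f x) \<partial>M)"
proof -
  have "norm (T f y) \<le> (\<integral>x. norm (f x * K y x) \<partial>M)"
    unfolding T_def by (rule integral_norm_bound)
  also have "\<dots> \<le> (\<integral>x. norm (f x) \<partial>M)"
    using integrable_norm[OF integrable_kernel[OF assms]] assms K_bound[OF assms(2)]
    by (intro integral_mono) (auto simp: norm_mult mult_left_le)
  finally show ?thesis .
qed

lemma T_add:
  assumes "integrable M f" "integrable M g" "y \<in> space N"
  shows "T (\<lambda>x. f x + g x) y = T f y + T g y"
  using integrable_kernel[OF assms(1,3)] integrable_kernel[OF assms(2,3)]
  by (simp add: T_def ring_distribs)

text \<open>
  Splitting \<open>f\<close> at height \<open>h\<close> leaves a large part whose image is at most \<open>s / 2\<close>.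
\<close>
lemma weak_type_cut:
  fixes r h s I :: real
  assumes f: "integrable M f" and r: "1 < r" and h: "0 < h" and s: "0 < s"
    and I: "(\<integral>\<^sup>+x. ennreal (norm (f x) powr r) \<partial>M) \<le> ennreal I"
    and cut: "h powr (1 - r) * I \<le> s / 2" and "0 \<le> I"
  shows "emeasure N {y \<in> space N. s \<le> norm (T f y)}
    \<le> ennreal (4 * c\<^sub>2 / s\<^sup>2) * (\<integral>\<^sup>+x. ennreal (norm (f x) ^ 2) * indicator {x. norm (f x) \<le> h} x \<partial>M)"
proof -
  have [measurable]: "f \<in> borel_measurable M" using f by auto
  define A where "A = {x \<in> space M. norm (f x) \<le> h}"
  have [measurable]: "A \<in> sets M" unfolding A_def by measurable
  define g where "g x = indicator A x *\<^sub>R f x" for x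
  define g' where "g' x = indicator (space M - A) x *\<^sub>R f x" for x
  have g: "integrable M g" "integrable M g'"
    unfolding g_def g'_def using f by (auto intro!: integrable_mult_indicator)
  have [measurable]: "g \<in> borel_measurable M" using g by auto
  have split: "T f y = T g y + T g' y" if "y \<in> space N" for y
  proof -
    have "T f y = T (\<lambda>x. g x + g' x) y"
      unfolding T_def g_def g'_def
      by (intro Bochner_Integration.integral_cong) (auto simp: indicator_def)
    thus ?thesis using T_add[OF g that] by simp
  qed
  have "ennreal (\<integral>x. norm (g' x) \<partial>M) = (\<integral>\<^sup>+x. ennreal (norm (g' x)) \<partial>M)"
    using g by (subst nn_integral_eq_integral) auto
  also have "\<dots> \<le> (\<integral>\<^sup>+x. ennreal (h powr (1 - r)) * ennreal (norm (f x) powr r) \<partial>M)"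
  proof (rule nn_integral_mono)
    fix x assume x: "x \<in> space M"
    show "ennreal (norm (g' x)) \<le> ennreal (h powr (1 - r)) * ennreal (norm (f x) powr r)"
    proof (cases "x \<in> A")
      case False
      hence hf: "h < norm (f x)" using x by (auto simp: A_def)
      have "norm (f x) powr (1 - r) \<le> h powr (1 - r)"
        using hf h r by (intro powr_mono2') auto
      hence "norm (f x) powr (1 - r) * norm (f x) powr r \<le> h powr (1 - r) * norm (f x) powr r"
        by (intro mult_right_mono) auto
      also have "norm (f x) powr (1 - r) * norm (f x) powr r = norm (f x)"
        using hf h by (simp flip: powr_add)
      finally show ?thesis using False x
        by (simp add: g'_def flip: ennreal_mult')
    qed (simp add: g'_def)
  qed
  also have "\<dots> = ennreal (h powr (1 - r)) * (\<integral>\<^sup>+x. ennreal (norm (f x) powr r) \<partial>M)"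
    by (rule nn_integral_cmult) measurable
  also have "\<dots> \<le> ennreal (h powr (1 - r)) * ennreal I"
    by (rule mult_left_mono[OF I]) simp
  also have "\<dots> \<le> ennreal (s / 2)"
    by (subst ennreal_mult'[symmetric]) (use cut in \<open>auto intro!: ennreal_leI simp only: powr_ge_zero\<close>)
  finally have g'_le: "(\<integral>x. norm (g' x) \<partial>M) \<le> s / 2" using s by simp
  have "emeasure N {y \<in> space N. s \<le> norm (T f y)}
      = (\<integral>\<^sup>+y. indicator {y \<in> space N. s \<le> norm (T f y)} y \<partial>N)"
    by simp
  \<comment> \<open>Chebyshev's inequality at level s / 2: where T f is at least s, the bounded
    contribution of \<open>g'\<close> leaves at least s / 2 for \<open>g\<close>.\<close>
  also have "\<dots> \<le> (\<integral>\<^sup>+y. ennreal (4 / s\<^sup>2) * ennreal (norm (T g y) ^ 2) \<partial>N)"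
  proof (rule nn_integral_mono)
    fix y assume y: "y \<in> space N"
    show "indicator {y \<in> space N. s \<le> norm (T f y)} y \<le> ennreal (4 / s\<^sup>2) * ennreal (norm (T g y) ^ 2)"
    proof (cases "s \<le> norm (T f y)")
      case True
      have "norm (T f y) \<le> norm (T g y) + norm (T g' y)"
        using split[OF y] norm_triangle_ineq by metis
      with T_bound[OF g(2) y] g'_le True have "s / 2 \<le> norm (T g y)" by linarith
      hence "(s / 2)\<^sup>2 \<le> norm (T g y) ^ 2" using s by (intro power_mono) auto
      hence "1 \<le> 4 / s\<^sup>2 * norm (T g y) ^ 2" using s by (simp add: field_simps)
      hence "ennreal 1 \<le> ennreal (4 / s\<^sup>2 * norm (T g y) ^ 2)" by (rule ennreal_leI)
      thus ?thesis using True y by (simp flip: ennreal_mult')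
    qed simp
  qed
  also have "\<dots> = ennreal (4 / s\<^sup>2) * (\<integral>\<^sup>+y. ennreal (norm (T g y) ^ 2) \<partial>N)"
    by (rule nn_integral_cmult) measurable
  also have "\<dots> \<le> ennreal (4 / s\<^sup>2) * (ennreal c\<^sub>2 * (\<integral>\<^sup>+x. ennreal (norm (g x) ^ 2) \<partial>M))"
    using L2_bound[OF g(1)] unfolding T_def by (intro mult_left_mono) auto
  also have "(\<integral>\<^sup>+x. ennreal (norm (g x) ^ 2) \<partial>M)
      = (\<integral>\<^sup>+x. ennreal (norm (f x) ^ 2) * indicator {x. norm (f x) \<le> h} x \<partial>M)"
    by (intro nn_integral_cong) (auto simp: g_def A_def indicator_def)
  finally show ?thesis
    by (simp add: mult.assoc[symmetric] ennreal_mult'[symmetric])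
qed

text \<open>The three factors are the one of the layer-cake formula, the
  \<open>4 * c\<^sub>2\<close> of \<open>weak_type_cut\<close>, and the integral of the power s - 3
  over [0, 2]. The last is finite only for s > 2, which excludes the end point r = 2.\<close>

definition hy_const :: "real \<Rightarrow> real" where
  "hy_const s = s * (4 * c\<^sub>2) * (2 powr (s - 2) / (s - 2))"

text \<open>Marcinkiewicz interpolation: in the layer-cake formula for the power r' the function is
  cut at a height \<open>h s\<close> that depends on the level s. By Tonelli's theorem the level is
  then integrated first, for a fixed value of f.\<close>

lemma hausdorff_young:
  fixes r r' I :: real
  assumes f: "integrable M f" and r: "1 < r" "r < 2" and r': "1 / r + 1 / r' = 1"
    and I: "(\<integral>\<^sup>+x. ennreal (norm (f x) powr r) \<partial>M) \<le> ennreal I" and I0: "0 < I"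
  shows "(\<integral>\<^sup>+y. ennreal (norm (T f y) powr r') \<partial>N) \<le> ennreal (hy_const r' * I powr (r' / r))"
proof -
  have [measurable]: "f \<in> borel_measurable M" using f by auto
  have r'2: "r' > 2" 
  proof -
    have "1 / r' = 1 - 1 / r" using r' by simp
    also have "\<dots> < 1/2" using r by (simp add: field_simps)
    finally have a: "1 / r' < 1 / 2" .
    have "1 / r' > 0" using r r' by (smt (verit) divide_less_eq_1_pos)
    hence "r' > 0" by simp
    thus ?thesis using a by (simp add: field_simps)
  qed
  have conj: "r + r' = r * r'" using r r' r'2 by (simp add: field_simps)
  \<comment> \<open>The solution of \<open>h powr (1 - r) * I = s / 2\<close>, the equality case of
    the hypothesis \<open>cut\<close> of \<open>weak_type_cut\<close>.\<close>
  define h where "h s = (s / (2 * I)) powr (- 1 / (r - 1))" for s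
  have [measurable]: "h \<in> borel_measurable borel" unfolding h_def by measurable
  have h: "h s > 0" "h s powr (1 - r) * I \<le> s / 2" if "s > 0" for s
  proof -
    show "h s > 0" using that I0 by (simp add: h_def)
    have "h s powr (1 - r) = (s / (2 * I)) powr 1"
      using r unfolding h_def powr_powr by (intro arg_cong2[of _ _ _ _ "(powr)"]) (auto simp: field_simps)
    also have "\<dots> = s / (2 * I)" using that I0 by simp
    finally show "h s powr (1 - r) * I \<le> s / 2" using I0 by simp
  qed
  let ?t = "\<lambda>s x. ennreal (norm (f x) ^ 2) * indicator {x. norm (f x) \<le> h s} x"
  let ?C = "r' * (4 * c\<^sub>2) * ((2 * I) powr (r' - 2) / (r' - 2))"
  let ?E = "\<lambda>s. {y \<in> space N. s \<le> norm (T f y)}"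
  have "(\<integral>\<^sup>+y. ennreal (norm (T f y) powr r') \<partial>N)
     = (\<integral>\<^sup>+y. (\<integral>\<^sup>+s. ennreal (r' * s powr (r' - 1)) * indicator {0..norm (T f y)} s \<partial>lborel) \<partial>N)"
  proof (rule nn_integral_cong)
    fix y
    have "(\<integral>\<^sup>+s. ennreal (r' * s powr (r' - 1)) * indicator {0..norm (T f y)} s \<partial>lborel)
      = (\<integral>\<^sup>+s. ennreal r' * (ennreal (s powr (r' - 1)) * indicator {0..norm (T f y)} s) \<partial>lborel)"
      using r'2 by (intro nn_integral_cong) (simp add: ennreal_mult' mult.assoc)
    also have "\<dots> = ennreal r' * ennreal (norm (T f y) powr r' / r')"
      using r'2 by (subst nn_integral_cmult) (auto simp: nn_integral_powr_0)
    also have "\<dots> = ennreal (norm (T f y) powr r')" using r'2 by (simp flip: ennreal_mult')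
    finally show "ennreal (norm (T f y) powr r')
      = (\<integral>\<^sup>+s. ennreal (r' * s powr (r' - 1)) * indicator {0..norm (T f y)} s \<partial>lborel)" ..
  qed
  also have "\<dots> = (\<integral>\<^sup>+s. (\<integral>\<^sup>+y. ennreal (r' * s powr (r' - 1)) * indicator {0..norm (T f y)} s \<partial>N) \<partial>lborel)"
  proof -
    interpret L: pair_sigma_finite N "lborel :: real measure" ..
    show ?thesis by (rule L.Fubini'[symmetric]) (measurable, simp add: indicator_def, measurable)
  qed
  also have "\<dots> = (\<integral>\<^sup>+s. ennreal (r' * s powr (r' - 1)) * indicator {0..} s * emeasure N (?E s) \<partial>lborel)"
  proof (rule nn_integral_cong)
    fix s :: real
    have "(\<integral>\<^sup>+y. ennreal (r' * s powr (r' - 1)) * indicator {0..norm (T f y)} s \<partial>N)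
      = (\<integral>\<^sup>+y. ennreal (r' * s powr (r' - 1)) * indicator {0..} s * indicator (?E s) y \<partial>N)"
      by (intro nn_integral_cong) (auto simp: indicator_def)
    also have "\<dots> = ennreal (r' * s powr (r' - 1)) * indicator {0..} s * emeasure N (?E s)"
      by (subst nn_integral_cmult) auto
    finally show "(\<integral>\<^sup>+y. ennreal (r' * s powr (r' - 1)) * indicator {0..norm (T f y)} s \<partial>N)
      = ennreal (r' * s powr (r' - 1)) * indicator {0..} s * emeasure N (?E s)" .
  qed
  also have "\<dots> \<le> (\<integral>\<^sup>+s. (\<integral>\<^sup>+x. ennreal (r' * (4 * c\<^sub>2)) * (ennreal (s powr (r' - 3)) * indicator {0<..} s *
       (?t s x)) \<partial>M) \<partial>lborel)"
  proof (rule nn_integral_mono)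
    fix s :: real
    show "ennreal (r' * s powr (r' - 1)) * indicator {0..} s * emeasure N (?E s)
      \<le> (\<integral>\<^sup>+x. ennreal (r' * (4 * c\<^sub>2)) * (ennreal (s powr (r' - 3)) * indicator {0<..} s *
       (?t s x)) \<partial>M)"
    proof (cases "s > 0")
      case True
      have "ennreal (r' * s powr (r' - 1)) * indicator {0..} s * emeasure N (?E s)
        \<le> ennreal (r' * s powr (r' - 1)) * (ennreal (4 * c\<^sub>2 / s\<^sup>2) * (\<integral>\<^sup>+x. ?t s x \<partial>M))"
        using weak_type_cut[OF f r(1) h(1)[OF True] True I h(2)[OF True]] I0 True
        by (auto intro!: mult_left_mono)
      also have "\<dots> = ennreal (r' * s powr (r' - 1) * (4 * c\<^sub>2 / s\<^sup>2)) * (\<integral>\<^sup>+x. ?t s x \<partial>M)"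
        using r'2 c2_nonneg
        by (subst ennreal_mult[of "r' * s powr (r' - 1)" "4 * c\<^sub>2 / s\<^sup>2"]) (simp_all only: mult.assoc, simp_all)
      also have "r' * s powr (r' - 1) * (4 * c\<^sub>2 / s\<^sup>2) = r' * (4 * c\<^sub>2) * s powr (r' - 3)"
      proof -
        have "s powr (r' - 1) = s powr (r' - 3) * s powr 2"
          by (simp flip: powr_add)
        thus ?thesis using True by (simp add: powr_numeral)
      qed
      also have "ennreal (r' * (4 * c\<^sub>2) * s powr (r' - 3)) * (\<integral>\<^sup>+x. ?t s x \<partial>M)
        = (\<integral>\<^sup>+x. ennreal (r' * (4 * c\<^sub>2) * s powr (r' - 3)) * (?t s x) \<partial>M)"
        by (rule nn_integral_cmult[symmetric]) measurable
      also have "\<dots> = (\<integral>\<^sup>+x. ennreal (r' * (4 * c\<^sub>2)) * (ennreal (s powr (r' - 3)) * indicator {0<..} s *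
       (?t s x)) \<partial>M)"
        using True r'2 c2_nonneg by (intro nn_integral_cong) (simp add: ennreal_mult' mult.assoc)
      finally show ?thesis .
    next
      case False
      \<comment> \<open>At s = 0 the left side vanishes because \<open>0 powr (r' - 1)\<close> is 0,
        so the half-line may be taken open from here on.\<close>
      hence "s < 0 \<or> s = 0" by auto
      thus ?thesis using r'2 by auto
    qed
  qed
  also have "\<dots> = (\<integral>\<^sup>+x. (\<integral>\<^sup>+s. ennreal (r' * (4 * c\<^sub>2)) * (ennreal (s powr (r' - 3)) * indicator {0<..} s *
       (?t s x)) \<partial>lborel) \<partial>M)"
  proof -
    interpret L: pair_sigma_finite M "lborel :: real measure" ..
    show ?thesis unfolding indicator_def mem_Collect_eq greaterThan_iff by (rule L.Fubini') measurable
  qed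
  also have "\<dots> \<le> (\<integral>\<^sup>+x. ennreal ?C * ennreal (norm (f x) powr r) \<partial>M)"
  proof (rule nn_integral_mono)
    fix x
    define b where "b = norm (f x)"
    show "(\<integral>\<^sup>+s. ennreal (r' * (4 * c\<^sub>2)) * (ennreal (s powr (r' - 3)) * indicator {0<..} s *
       (?t s x)) \<partial>lborel)
       \<le> ennreal ?C * ennreal (norm (f x) powr r)"
    proof (cases "b = 0")
      case True
      thus ?thesis by (simp add: b_def)
    next
      case False
      hence b: "b > 0" by (simp add: b_def)
      \<comment> \<open>The inverse function of \<open>h\<close> at b: since \<open>h\<close>
        decreases, the levels that keep the value b are at most X.\<close>
      define X where "X = 2 * I * b powr (1 - r)"
      have X: "s \<le> X" if "b \<le> h s" "s > 0" for s
      proof -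
        have "h s powr (1 - r) \<le> b powr (1 - r)"
          using that b r by (intro powr_mono2') auto
        moreover have "h s powr (1 - r) = (s / (2 * I)) powr 1"
          using r unfolding h_def powr_powr by (intro arg_cong2[of _ _ _ _ "(powr)"]) (auto simp: field_simps)
        ultimately show ?thesis using that I0 by (simp add: X_def field_simps)
      qed
      have "(\<integral>\<^sup>+s. ennreal (r' * (4 * c\<^sub>2)) * (ennreal (s powr (r' - 3)) * indicator {0<..} s *
       (?t s x)) \<partial>lborel)
       \<le> (\<integral>\<^sup>+s. ennreal (r' * (4 * c\<^sub>2) * b\<^sup>2) * (ennreal (s powr (r' - 3)) * indicator {0..X} s) \<partial>lborel)"
        using X r'2 c2_nonneg
        by (intro nn_integral_mono) (auto simp: indicator_def b_def ennreal_mult' mult_ac)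
      also have "\<dots> = ennreal (r' * (4 * c\<^sub>2) * b\<^sup>2) * ennreal (X powr (r' - 2) / (r' - 2))"
        using r'2 nn_integral_powr_0[of "r' - 3" X] I0 by (subst nn_integral_cmult) (auto simp: X_def)
      also have "\<dots> = ennreal (r' * (4 * c\<^sub>2) * b\<^sup>2 * (X powr (r' - 2) / (r' - 2)))"
        using r'2 c2_nonneg by (intro ennreal_mult[symmetric]) auto
      also have "X powr (r' - 2) = (2 * I) powr (r' - 2) * b powr (r - 2)"
      proof -
        have "(1 - r) * (r' - 2) = r - 2" using conj by (simp add: algebra_simps)
        thus ?thesis using I0 by (simp add: X_def powr_mult powr_powr)
      qed
      also have "r' * (4 * c\<^sub>2) * b\<^sup>2 * ((2 * I) powr (r' - 2) * b powr (r - 2) / (r' - 2))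
        = (r' * (4 * c\<^sub>2) * ((2 * I) powr (r' - 2) / (r' - 2))) * (b powr 2 * b powr (r - 2))"
        using b by (simp add: powr_numeral)
      also have "b powr 2 * b powr (r - 2) = b powr r"
        by (simp flip: powr_add)
      also have "ennreal (?C * b powr r)
        = ennreal ?C * ennreal (norm (f x) powr r)"
        using r'2 c2_nonneg unfolding b_def by (intro ennreal_mult) auto
      finally show ?thesis .
    qed
  qed
  also have "\<dots> = ennreal ?C * (\<integral>\<^sup>+x. ennreal (norm (f x) powr r) \<partial>M)"
    by (rule nn_integral_cmult) measurable
  also have "\<dots> \<le> ennreal ?C * ennreal I"
    by (rule mult_left_mono[OF I]) simp
  also have "\<dots> = ennreal (?C * I)"
    using r'2 c2_nonneg I0 by (intro ennreal_mult[symmetric]) auto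
  also have "r' * (4 * c\<^sub>2) * ((2 * I) powr (r' - 2) / (r' - 2)) * I = hy_const r' * I powr (r' / r)"
  proof -
    have "I powr (r' - 2) * I = I powr (r' - 2 + 1)"
      unfolding powr_add using I0 by simp
    also have "r' - 2 + 1 = r' / r" using conj r by (simp add: field_simps)
    finally show ?thesis using I0 by (simp add: hy_const_def powr_mult)
  qed
  finally show ?thesis .
qed

end

section \<open>Substitutes for Hoelder's inequality and geometric sums over the integers\<close>

text \<open>Hoelder's inequality on a set of finite measure, up to the factor 2. Below a height h
  the power s of g is at most that of h; above it, h to the power s - t times the power t of g. The
  height (J / m) to the power 1 / t makes the two contributions equal. It degenerates for J = 0,
  where g vanishes almost everywhere on E.\<close>

lemma nn_integral_powr_le_of_finite_measure:
  fixes g :: "'a \<Rightarrow> real" and m J s t :: real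
  assumes [measurable]: "g \<in> borel_measurable M" "E \<in> sets M"
    and g: "\<And>x. 0 \<le> g x" and E: "emeasure M E \<le> ennreal m" and m: "0 < m"
    and st: "0 < s" "s \<le> t" and J0: "0 \<le> J"
    and J: "(\<integral>\<^sup>+x. ennreal (g x powr t) * indicator E x \<partial>M) \<le> ennreal J"
  shows "(\<integral>\<^sup>+x. ennreal (g x powr s) * indicator E x \<partial>M)
    \<le> ennreal (2 * m powr (1 - s / t) * J powr (s / t))"
proof (cases "J = 0")
  case True
  hence "(\<integral>\<^sup>+x. ennreal (g x powr t) * indicator E x \<partial>M) = 0" using J by simp
  hence "AE x in M. ennreal (g x powr t) * indicator E x = 0"
    by (subst (asm) nn_integral_0_iff_AE) measurable
  hence "AE x in M. ennreal (g x powr s) * indicator E x = 0"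
    by eventually_elim auto
  hence "(\<integral>\<^sup>+x. ennreal (g x powr s) * indicator E x \<partial>M) = 0"
    by (subst nn_integral_0_iff_AE) measurable
  thus ?thesis by simp
next
  case False
  hence J1: "J > 0" using J0 by simp
  define h where "h = (J / m) powr (1 / t)"
  have h: "h > 0" using J1 m by (simp add: h_def)
  have pw: "g x powr s \<le> h powr s + h powr (s - t) * g x powr t" for x
  proof (cases "g x \<le> h")
    case True
    have "g x powr s \<le> h powr s" using True g st by (intro powr_mono2) auto
    thus ?thesis by (simp add: add_increasing2)
  next
    case False
    have "g x powr (s - t) \<le> h powr (s - t)" using False h st by (intro powr_mono2') auto
    hence "g x powr (s - t) * g x powr t \<le> h powr (s - t) * g x powr t"
      by (intro mult_right_mono) auto
    thus ?thesis by (simp add: add_increasing flip: powr_add)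
  qed
  have "(\<integral>\<^sup>+x. ennreal (g x powr s) * indicator E x \<partial>M)
    \<le> (\<integral>\<^sup>+x. ennreal (h powr s) * indicator E x + ennreal (h powr (s - t)) * (ennreal (g x powr t) * indicator E x) \<partial>M)"
  proof (rule nn_integral_mono)
    fix x
    have "ennreal (g x powr s) \<le> ennreal (h powr s) + ennreal (h powr (s - t)) * ennreal (g x powr t)"
      using ennreal_leI[OF pw[of x]] by (simp add: ennreal_mult)
    thus "ennreal (g x powr s) * indicator E x \<le> ennreal (h powr s) * indicator E x + ennreal (h powr (s - t)) * (ennreal (g x powr t) * indicator E x)"
      by (auto simp: indicator_def)
  qed
  also have "\<dots> = ennreal (h powr s) * emeasure M E + ennreal (h powr (s - t)) * (\<integral>\<^sup>+x. ennreal (g x powr t) * indicator E x \<partial>M)"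
    by (subst nn_integral_add) (auto simp: nn_integral_cmult nn_integral_cmult_indicator)
  also have "\<dots> \<le> ennreal (h powr s) * ennreal m + ennreal (h powr (s - t)) * ennreal J"
    using E J by (intro add_mono mult_left_mono) auto
  also have "\<dots> = ennreal (h powr s * m + h powr (s - t) * J)"
    using J1 m by (simp add: ennreal_mult ennreal_plus)
  also have "h powr s * m = m powr (1 - s / t) * J powr (s / t)"
  proof -
    have "m powr (1 - s / t) = m / m powr (s / t)" using m by (simp add: powr_diff)
    thus ?thesis using m J1 by (simp add: h_def powr_powr powr_divide)
  qed
  also have "h powr (s - t) * J = m powr (1 - s / t) * J powr (s / t)"
  proof -
    have e: "1 / t * (s - t) = s / t - 1" using st by (simp add: field_simps)
    have "h powr (s - t) = (J / m) powr (s / t - 1)" unfolding h_def powr_powr e ..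
    also have "\<dots> = J powr (s / t) / J * m powr (1 - s / t)"
      using m J1 by (simp add: powr_divide powr_diff)
    finally show ?thesis using J1 by simp
  qed
  finally show ?thesis by (simp add: mult_ac)
qed

text \<open>Translation by i is a bijection of the integers, so one W serves all i. It is twice a
  geometric series, with the index 0 counted in both halves.\<close>

lemma nn_integral_geometric_int:
  fixes c :: real
  assumes "0 < c"
  obtains W where "0 < W" "\<And>i::int. (\<integral>\<^sup>+j. ennreal (2 powr (- c * \<bar>real_of_int (i + j)\<bar>)) \<partial>count_space UNIV) \<le> ennreal W"
proof
  define x where "x = 2 powr (- c)"
  have x: "0 < x" "x < 1" using assms by (auto simp: x_def powr_less_one)
  define S where "S = (\<Sum>n. x ^ n)"
  have S: "(\<integral>\<^sup>+n. ennreal (x ^ n) \<partial>count_space (UNIV::nat set)) = ennreal S" 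
    unfolding nn_integral_count_space_nat S_def
    using x by (intro suminf_ennreal2) (auto intro: summable_geometric)
  have S0: "0 < S" unfolding S_def using x by (intro suminf_pos) (auto intro: summable_geometric)
  show "0 < 2 * S" using S0 by simp
  fix i :: int
  let ?g = "\<lambda>j::int. ennreal (2 powr (- c * \<bar>real_of_int j\<bar>))"
  have xn: "2 powr (- (c * real n)) = x ^ n" for n
    unfolding x_def by (simp add: powr_powr flip: powr_realpow)
  have "(\<integral>\<^sup>+j. ?g (i + j) \<partial>count_space UNIV) = (\<integral>\<^sup>+j. ?g j \<partial>count_space UNIV)"
    by (rule nn_integral_bij_count_space) (rule bij_betw_byWitness[where f' = "\<lambda>j. j - i"], auto)
  also have "\<dots> \<le> (\<integral>\<^sup>+j. ?g j * indicator (range int) j + ?g j * indicator (range (\<lambda>n. - int n)) j \<partial>count_space UNIV)"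
  proof (rule nn_integral_mono)
    fix j :: int
    have "j = int (nat j) \<or> j = - int (nat (- j))" by auto
    hence "j \<in> range int \<or> j \<in> range (\<lambda>n. - int n)" by blast
    thus "?g j \<le> ?g j * indicator (range int) j + ?g j * indicator (range (\<lambda>n. - int n)) j"
      by (auto simp: indicator_def)
  qed
  also have "\<dots> = (\<integral>\<^sup>+j. ?g j \<partial>count_space (range int)) + (\<integral>\<^sup>+j. ?g j \<partial>count_space (range (\<lambda>n. - int n)))"
    by (subst nn_integral_add) (auto simp: nn_integral_count_space_indicator[of "range _"])
  also have "\<dots> = ennreal S + ennreal S"
  proof -
    have "(\<integral>\<^sup>+j. ?g j \<partial>count_space (range int)) = (\<integral>\<^sup>+n. ?g (int n) \<partial>count_space UNIV)"
      by (rule nn_integral_bij_count_space[symmetric]) (simp add: bij_betw_def inj_on_def)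
    moreover have "(\<integral>\<^sup>+j. ?g j \<partial>count_space (range (\<lambda>n. - int n))) = (\<integral>\<^sup>+n. ?g (- int n) \<partial>count_space UNIV)"
      by (rule nn_integral_bij_count_space[symmetric]) (simp add: bij_betw_def inj_on_def)
    ultimately show ?thesis by (simp add: xn S)
  qed
  also have "\<dots> = ennreal (2 * S)" using S0 by (simp flip: ennreal_plus)
  finally show "(\<integral>\<^sup>+j. ?g (i + j) \<partial>count_space UNIV) \<le> ennreal (2 * S)" .
qed

text \<open>
  A substitute for Hoelder's inequality: the sum is at most \<open>W\<close> times the supremum of
  the \<open>b j / k j\<close>, and the supremum is at most the \<open>\<ell>\<^sup>q\<close> sum.
\<close>
lemma sum_powr_le_weighted:
  fixes b k :: "'i \<Rightarrow> real" and q W B :: real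
  assumes q: "1 < q" and b: "\<And>j. 0 \<le> b j" and k: "\<And>j. 0 < k j" and W: "0 < W"
    and sumk: "(\<integral>\<^sup>+j. ennreal (k j) \<partial>count_space UNIV) \<le> ennreal W"
    and B: "0 \<le> B" "ennreal B \<le> (\<integral>\<^sup>+j. ennreal (b j) \<partial>count_space UNIV)"
  shows "ennreal (B powr q) \<le> ennreal (W powr q) * (\<integral>\<^sup>+j. ennreal (k j powr (-q) * b j powr q) \<partial>count_space UNIV)"
    (is "_ \<le> _ * ?S")
proof (cases "?S = \<infinity>")
  case True
  thus ?thesis using W by (simp add: ennreal_mult_top)
next
  case False
  then obtain S where S: "?S = ennreal S" "0 \<le> S" by (cases ?S rule: ennreal_cases) auto
  have bj: "b j \<le> k j * S powr (1 / q)" for j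
  proof -
    have "ennreal (k j powr (-q) * b j powr q) \<le> ?S"
      by (rule nn_integral_ge_point) simp
    hence "k j powr (-q) * b j powr q \<le> S" using S by simp
    hence "(b j / k j) powr q \<le> S" using b[of j] k[of j] by (simp add: powr_divide powr_minus_divide)
    hence "((b j / k j) powr q) powr (1 / q) \<le> S powr (1 / q)" using q by (intro powr_mono2) auto
    hence "b j / k j \<le> S powr (1 / q)" using q b[of j] k[of j] by (simp add: powr_powr)
    thus ?thesis using k[of j] by (simp add: field_simps)
  qed
  have "ennreal B \<le> (\<integral>\<^sup>+j. ennreal (b j) \<partial>count_space UNIV)" by (rule B)
  also have "\<dots> \<le> (\<integral>\<^sup>+j. ennreal (S powr (1 / q)) * ennreal (k j) \<partial>count_space UNIV)"
    using bj k by (intro nn_integral_mono) (simp add: less_imp_le mult.commute flip: ennreal_mult)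
  also have "\<dots> \<le> ennreal (S powr (1 / q)) * ennreal W"
    using sumk by (subst nn_integral_cmult) (auto intro!: mult_left_mono)
  also have "\<dots> = ennreal (S powr (1 / q) * W)" using W by (simp add: ennreal_mult)
  finally have "B \<le> S powr (1 / q) * W" using W by simp
  hence "B powr q \<le> (S powr (1 / q) * W) powr q" using B q by (intro powr_mono2) auto
  also have "\<dots> = W powr q * S" using q S W by (simp add: powr_mult powr_powr)
  finally show ?thesis using S W by (simp flip: ennreal_mult)
qed

section \<open>Strong type bounds and their local forms\<close>

context kernel_op begin

text \<open>A real bound I takes the place of the integral itself, so that its power s / r is a
  power of real numbers.\<close>

definition strong_type :: "real \<Rightarrow> real \<Rightarrow> real \<Rightarrow> bool" where
  "strong_type r s D \<longleftrightarrow> (\<forall>f I. integrable M f \<longrightarrow> 0 \<le> I \<longrightarrow>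
    (\<integral>\<^sup>+x. ennreal (norm (f x) powr r) \<partial>M) \<le> ennreal I \<longrightarrow>
    (\<integral>\<^sup>+y. ennreal (norm (T f y) powr s) \<partial>N) \<le> ennreal (D * I powr (s / r)))"

text \<open>Completes \<open>hausdorff_young\<close> by its two excluded cases: r = 2 is the
  hypothesis \<open>L2_bound\<close>, and for I = 0 the function vanishes almost everywhere, so its
  transform is 0.\<close>

lemma strong_type_conjugate:
  fixes r r' :: real
  assumes r: "1 < r" "r \<le> 2" and r': "1 / r + 1 / r' = 1"
  shows "\<exists>D>0. strong_type r r' D"
  unfolding strong_type_def
proof (intro exI conjI allI impI)
  define D where "D = \<bar>hy_const r'\<bar> + c\<^sub>2 + 1"
  have D: "hy_const r' \<le> D" "c\<^sub>2 \<le> D" "0 < D" using c2_nonneg by (auto simp: D_def)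
  show "0 < D" by fact
  fix f :: "'a \<Rightarrow> complex" and I :: real
  assume f: "integrable M f" and I0: "0 \<le> I" and I: "(\<integral>\<^sup>+x. ennreal (norm (f x) powr r) \<partial>M) \<le> ennreal I"
  have [measurable]: "f \<in> borel_measurable M" using f by auto
  show "(\<integral>\<^sup>+y. ennreal (norm (T f y) powr r') \<partial>N) \<le> ennreal (D * I powr (r' / r))"
  proof (cases "I = 0")
    case True
    hence "(\<integral>\<^sup>+x. ennreal (norm (f x) powr r) \<partial>M) = 0" using I by simp
    hence "AE x in M. ennreal (norm (f x) powr r) = 0"
      by (subst (asm) nn_integral_0_iff_AE) measurable
    hence z: "AE x in M. f x = 0" by eventually_elim auto
    have "T f y = 0" for y
      unfolding T_def by (rule integral_eq_zero_AE) (use z in eventually_elim, simp)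
    thus ?thesis by simp
  next
    case False
    hence I1: "0 < I" using I0 by simp
    show ?thesis
    proof (cases "r = 2")
      case True
      hence r2: "r' = 2" using r' by (simp add: field_simps)
      have sq: "norm z powr 2 = norm z ^ 2" for z :: complex
        by (cases "z = 0") (simp_all add: powr_numeral)
      have "(\<integral>\<^sup>+y. ennreal (norm (T f y) powr r') \<partial>N) \<le> ennreal c\<^sub>2 * (\<integral>\<^sup>+x. ennreal (norm (f x) powr r) \<partial>M)"
        using L2_bound[OF f] by (simp add: r2 True sq T_def)
      also have "\<dots> \<le> ennreal D * ennreal I"
        using D I by (intro mult_mono ennreal_leI) auto
      finally show ?thesis using D I0 I1 by (simp add: r2 True ennreal_mult)
    next
      case False
      hence "r < 2" using r by simp
      from hausdorff_young[OF f r(1) this r' I I1]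
      show ?thesis
        by (rule order_trans) (use D in \<open>auto intro!: ennreal_leI mult_right_mono\<close>)
    qed
  qed
qed

text \<open>Hoelder's inequality on E turns the bound on the power p into a bound on the integral of
  |f|. This bounds T f pointwise, and the constant is integrated over F.\<close>

lemma local_L1_estimate:
  fixes p q :: real
  assumes f: "integrable M f" and p: "1 < p" and q: "0 < q"
    and E[measurable]: "E \<in> sets M" "emeasure M E \<le> ennreal m" "0 < m" and supp: "\<And>x. x \<notin> E \<Longrightarrow> f x = 0"
    and F[measurable]: "F \<in> sets N" "emeasure N F \<le> ennreal m'" "0 < m'"
    and I: "0 \<le> I" "(\<integral>\<^sup>+x. ennreal (norm (f x) powr p) \<partial>M) \<le> ennreal I"
  shows "(\<integral>\<^sup>+y. ennreal (norm (T f y) powr q) * indicator F y \<partial>N)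
    \<le> ennreal (2 powr q * m' * m powr (q * (1 - 1 / p)) * I powr (q / p))"
proof -
  have [measurable]: "f \<in> borel_measurable M" using f by auto
  have "(\<integral>\<^sup>+x. ennreal (norm (f x)) \<partial>M) = (\<integral>\<^sup>+x. ennreal (norm (f x) powr 1) * indicator E x \<partial>M)"
    using supp by (intro nn_integral_cong) (auto simp: indicator_def)
  also have "\<dots> \<le> ennreal (2 * m powr (1 - 1 / p) * I powr (1 / p))"
  proof (rule nn_integral_powr_le_of_finite_measure)
    have "(\<integral>\<^sup>+x. ennreal (norm (f x) powr p) * indicator E x \<partial>M) \<le> (\<integral>\<^sup>+x. ennreal (norm (f x) powr p) \<partial>M)"
      by (intro nn_integral_mono) (auto simp: indicator_def)
    thus "(\<integral>\<^sup>+x. ennreal (norm (f x) powr p) * indicator E x \<partial>M) \<le> ennreal I" using I by order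
  qed (use E p I in auto)
  finally have "ennreal (\<integral>x. norm (f x) \<partial>M) \<le> ennreal (2 * m powr (1 - 1 / p) * I powr (1 / p))"
    using f by (subst (asm) nn_integral_eq_integral) auto
  hence L1: "(\<integral>x. norm (f x) \<partial>M) \<le> 2 * m powr (1 - 1 / p) * I powr (1 / p)"
    by simp
  define L where "L = 2 * m powr (1 - 1 / p) * I powr (1 / p)"
  have "(\<integral>\<^sup>+y. ennreal (norm (T f y) powr q) * indicator F y \<partial>N) \<le> (\<integral>\<^sup>+y. ennreal (L powr q) * indicator F y \<partial>N)"
  proof (rule nn_integral_mono)
    fix y assume "y \<in> space N"
    hence "norm (T f y) \<le> L" using T_bound[OF f] L1 unfolding L_def by fastforce
    hence "norm (T f y) powr q \<le> L powr q" using q by (intro powr_mono2) auto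
    thus "ennreal (norm (T f y) powr q) * indicator F y \<le> ennreal (L powr q) * indicator F y"
      by (intro mult_right_mono ennreal_leI) auto
  qed
  also have "\<dots> = ennreal (L powr q) * emeasure N F" by (rule nn_integral_cmult_indicator) fact
  also have "\<dots> \<le> ennreal (L powr q) * ennreal m'" using F by (intro mult_left_mono) auto
  also have "\<dots> = ennreal (L powr q * m')" using F by (simp add: ennreal_mult)
  also have "L powr q = 2 powr q * m powr (q * (1 - 1 / p)) * I powr (q / p)"
    using E I by (simp add: L_def powr_mult powr_powr mult.commute)
  finally show ?thesis by (simp add: mult_ac)
qed

text \<open>Hoelder's inequality is used on both sides of the strong type bound: on E to pass from
  the exponent p down to r, on F to pass from r' down to q. This is why r is at most p and q at most
  r'.\<close>

lemma local_HY_estimate: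
  fixes p q r r' D :: real
  assumes D: "0 < D" "strong_type r r' D"
    and f: "integrable M f" and rp: "1 < r" "r \<le> p" and q: "0 < q" "q \<le> r'"
    and E[measurable]: "E \<in> sets M" "emeasure M E \<le> ennreal m" "0 < m" and supp: "\<And>x. x \<notin> E \<Longrightarrow> f x = 0"
    and F[measurable]: "F \<in> sets N" "emeasure N F \<le> ennreal m'" "0 < m'"
    and I: "0 \<le> I" "(\<integral>\<^sup>+x. ennreal (norm (f x) powr p) \<partial>M) \<le> ennreal I"
  shows "(\<integral>\<^sup>+y. ennreal (norm (T f y) powr q) * indicator F y \<partial>N)
    \<le> ennreal (2 * D powr (q / r') * 2 powr (q / r) * m' powr (1 - q / r') * m powr (q / r - q / p) * I powr (q / p))"
proof -
  have [measurable]: "f \<in> borel_measurable M" using f by auto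
  define L where "L = 2 * m powr (1 - r / p) * I powr (r / p)"
  have L0: "0 \<le> L" by (simp add: L_def)
  have "(\<integral>\<^sup>+x. ennreal (norm (f x) powr r) \<partial>M) = (\<integral>\<^sup>+x. ennreal (norm (f x) powr r) * indicator E x \<partial>M)"
    using supp by (intro nn_integral_cong) (auto simp: indicator_def)
  also have "\<dots> \<le> ennreal L"
    unfolding L_def
  proof (rule nn_integral_powr_le_of_finite_measure)
    have "(\<integral>\<^sup>+x. ennreal (norm (f x) powr p) * indicator E x \<partial>M) \<le> (\<integral>\<^sup>+x. ennreal (norm (f x) powr p) \<partial>M)"
      by (intro nn_integral_mono) (auto simp: indicator_def)
    thus "(\<integral>\<^sup>+x. ennreal (norm (f x) powr p) * indicator E x \<partial>M) \<le> ennreal I" using I by order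
  qed (use E rp I in auto)
  finally have 1: "(\<integral>\<^sup>+y. ennreal (norm (T f y) powr r') \<partial>N) \<le> ennreal (D * L powr (r' / r))"
    using D(2) f L0 unfolding strong_type_def by blast
  have "(\<integral>\<^sup>+y. ennreal (norm (T f y) powr q) * indicator F y \<partial>N)
    \<le> ennreal (2 * m' powr (1 - q / r') * (D * L powr (r' / r)) powr (q / r'))"
  proof (rule nn_integral_powr_le_of_finite_measure)
    have "(\<integral>\<^sup>+y. ennreal (norm (T f y) powr r') * indicator F y \<partial>N) \<le> (\<integral>\<^sup>+y. ennreal (norm (T f y) powr r') \<partial>N)"
      by (intro nn_integral_mono) (auto simp: indicator_def)
    thus "(\<integral>\<^sup>+y. ennreal (norm (T f y) powr r') * indicator F y \<partial>N) \<le> ennreal (D * L powr (r' / r))" using 1 by order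
  qed (use F q D in auto)
  also have "(D * L powr (r' / r)) powr (q / r') = D powr (q / r') * L powr (q / r)"
    using D q by (simp add: powr_mult powr_powr)
  also have "L powr (q / r) = 2 powr (q / r) * m powr (q / r - q / p) * I powr (q / p)"
  proof -
    have "(1 - r / p) * (q / r) = q / r - q / p" "r / p * (q / r) = q / p"
      using rp by (auto simp: field_simps)
    thus ?thesis unfolding L_def powr_mult powr_powr by simp
  qed
  finally show ?thesis by (simp add: mult_ac)
qed

end

section \<open>Weighted inequalities from dyadic shells\<close>

lemma floor_log2_bounds:
  fixes s :: real
  assumes "0 < s"
  shows "2 powr \<lfloor>log 2 s\<rfloor> \<le> s" "s < 2 powr (real_of_int \<lfloor>log 2 s\<rfloor> + 1)"
proof -
  have e: "2 powr log 2 s = s" using assms by simp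
  have "2 powr \<lfloor>log 2 s\<rfloor> \<le> 2 powr log 2 s"
    by (rule powr_mono[OF of_int_floor_le]) simp
  thus "2 powr \<lfloor>log 2 s\<rfloor> \<le> s" unfolding e .
  have "2 powr log 2 s < 2 powr (real_of_int \<lfloor>log 2 s\<rfloor> + 1)"
    by (rule powr_less_mono[OF real_of_int_floor_add_one_gt]) simp
  thus "s < 2 powr (real_of_int \<lfloor>log 2 s\<rfloor> + 1)" unfolding e .
qed

text \<open>The functions \<sigma> and \<tau> are normalized so that their sublevel sets have
  measure at most linear in the level; the strength of the weights is left to the exponents a and b.
  In the application a is \<alpha> / (2n+2) and b is \<rho> / (4n+1).\<close>

locale weighted_kernel_op = kernel_op M N K c\<^sub>2
  for M :: "'a measure" and N :: "'b measure" and K c\<^sub>2 +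
  fixes \<sigma> :: "'a \<Rightarrow> real" and \<tau> :: "'b \<Rightarrow> real" and A B p q p' a b :: real
  assumes \<sigma>_meas [measurable]: "\<sigma> \<in> borel_measurable M"
    and \<tau>_meas [measurable]: "\<tau> \<in> borel_measurable N"
    and \<sigma>_nonneg: "\<And>x. 0 \<le> \<sigma> x" and \<tau>_nonneg: "\<And>y. 0 \<le> \<tau> y"
    and AB: "0 < A" "0 < B"
    and \<sigma>_distr: "\<And>R. 0 < R \<Longrightarrow> emeasure M {x \<in> space M. \<sigma> x < R} \<le> ennreal (A * R)"
    and \<tau>_distr: "\<And>R. 0 < R \<Longrightarrow> emeasure N {y \<in> space N. \<tau> y < R} \<le> ennreal (B * R)"
    and p: "1 < p" and pq: "p \<le> q" and p': "1 / p + 1 / p' = 1"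
    and ab: "0 < a" "0 < b"
    and balance: "1 / p' - a = 1 / q - b" and sub: "0 < 1 / p' - a"
begin

definition \<theta> :: real where "\<theta> = 1 / p' - a"

text \<open>The zeros of \<sigma> lie in no shell and form a null set by
  \<open>AE_\<sigma>_pos\<close>. The zeros of \<tau> are left out of the sets
  \<open>shell' i\<close> too; there the weight is 0, since a power of 0 under \<open>powr\<close>
  is 0.\<close>

definition shell :: "int \<Rightarrow> 'a set" where
  "shell j = {x \<in> space M. 0 < \<sigma> x \<and> \<lfloor>log 2 (\<sigma> x)\<rfloor> = j}"

definition shell' :: "int \<Rightarrow> 'b set" where
  "shell' i = {y \<in> space N. 0 < \<tau> y \<and> \<lfloor>log 2 (\<tau> y)\<rfloor> = i}"

lemma shell_meas [measurable]: "shell j \<in> sets M" "shell' i \<in> sets N"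
  unfolding shell_def shell'_def by measurable

lemma emeasure_shell: "emeasure M (shell j) \<le> ennreal (2 * A * 2 powr j)"
proof -
  have "emeasure M (shell j) \<le> emeasure M {x \<in> space M. \<sigma> x < 2 powr (real_of_int j + 1)}"
    proof (rule emeasure_mono, rule subsetI)
    fix x assume "x \<in> shell j"
    hence "x \<in> space M" "0 < \<sigma> x" "\<lfloor>log 2 (\<sigma> x)\<rfloor> = j" by (simp_all only: shell_def mem_Collect_eq)
    thus "x \<in> {x \<in> space M. \<sigma> x < 2 powr (real_of_int j + 1)}"
      using floor_log2_bounds(2)[of "\<sigma> x"] by (simp only: mem_Collect_eq)
  qed simp
  also have "\<dots> \<le> ennreal (A * 2 powr (real_of_int j + 1))" by (rule \<sigma>_distr) simp
  finally show ?thesis by (simp add: powr_add mult_ac)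
qed

lemma emeasure_shell': "emeasure N (shell' i) \<le> ennreal (2 * B * 2 powr i)"
proof -
  have "emeasure N (shell' i) \<le> emeasure N {y \<in> space N. \<tau> y < 2 powr (real_of_int i + 1)}"
    proof (rule emeasure_mono, rule subsetI)
    fix y assume "y \<in> shell' i"
    hence "y \<in> space N" "0 < \<tau> y" "\<lfloor>log 2 (\<tau> y)\<rfloor> = i" by (simp_all only: shell'_def mem_Collect_eq)
    thus "y \<in> {y \<in> space N. \<tau> y < 2 powr (real_of_int i + 1)}"
      using floor_log2_bounds(2)[of "\<tau> y"] by (simp only: mem_Collect_eq)
  qed simp
  also have "\<dots> \<le> ennreal (B * 2 powr (real_of_int i + 1))" by (rule \<tau>_distr) simp
  finally show ?thesis by (simp add: powr_add mult_ac)
qed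

text \<open>The zero set lies in every sublevel set, whose measure A * R can be made arbitrarily
  small.\<close>

lemma AE_\<sigma>_pos: "AE x in M. 0 < \<sigma> x"
proof -
  have le: "emeasure M {x \<in> space M. \<sigma> x = 0} \<le> ennreal (A * R)" if "0 < R" for R
  proof -
    have "emeasure M {x \<in> space M. \<sigma> x = 0} \<le> emeasure M {x \<in> space M. \<sigma> x < R}"
      by (rule emeasure_mono) (use that in auto)
    thus ?thesis using \<sigma>_distr[OF that] by order
  qed
  have "emeasure M {x \<in> space M. \<sigma> x = 0} \<le> 0"
  proof (rule ennreal_le_epsilon)
    fix e :: real assume "0 < e"
    hence "0 < e / A" "A * (e / A) = e" using AB by auto
    with le[of "e / A"] show "emeasure M {x \<in> space M. \<sigma> x = 0} \<le> 0 + ennreal e" by simp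
  qed
  hence "AE x in M. \<sigma> x \<noteq> 0"
    by (subst AE_iff_measurable[OF _ refl]) auto
  thus ?thesis by eventually_elim (use \<sigma>_nonneg in \<open>simp add: less_le\<close>)
qed

section \<open>Decomposition into shells and summation of the blocks\<close>

definition piece :: "('a \<Rightarrow> complex) \<Rightarrow> int \<Rightarrow> 'a \<Rightarrow> complex" where
  "piece f j x = indicator (shell j) x *\<^sub>R f x"

lemma integrable_piece: "integrable M f \<Longrightarrow> integrable M (piece f j)"
  unfolding piece_def by (intro integrable_mult_indicator) auto

lemma piece_meas [measurable]: "f \<in> borel_measurable M \<Longrightarrow> piece f j \<in> borel_measurable M"
  unfolding piece_def by measurable

lemma sum_piece:
  assumes "x \<in> space M" "0 < \<sigma> x" "finite S"
  shows "(\<Sum>j\<in>S. piece f j x) = (if \<lfloor>log 2 (\<sigma> x)\<rfloor> \<in> S then f x else 0)"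
proof -
  have "piece f j x = (if \<lfloor>log 2 (\<sigma> x)\<rfloor> = j then f x else 0)" for j
    using assms by (auto simp: piece_def shell_def)
  thus ?thesis using assms by simp
qed

text \<open>The sums of the pieces with index from -m to m converge to f almost everywhere and are
  dominated by |f|, so their transforms converge at y. The triangle inequality for each finite sum
  then passes to the limit.\<close>

lemma norm_T_le_sum_pieces:
  assumes f: "integrable M f" and y: "y \<in> space N"
  shows "ennreal (norm (T f y)) \<le> (\<integral>\<^sup>+j. ennreal (norm (T (piece f j) y)) \<partial>count_space UNIV)"
proof -
  have [measurable]: "f \<in> borel_measurable M" using f by auto
  note [measurable] = K_meas_snd[OF y]
  define S where "S m = {- int m..int m}" for m
  define g where "g m x = (\<Sum>j\<in>S m. piece f j x)" for m x
  have [simp]: "finite (S m)" for m by (simp add: S_def)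
  have "(\<lambda>m. \<integral>x. g m x * K y x \<partial>M) \<longlonglongrightarrow> (\<integral>x. f x * K y x \<partial>M)"
  proof (rule integral_dominated_convergence[where w = "\<lambda>x. norm (f x)"])
    show "AE x in M. (\<lambda>m. g m x * K y x) \<longlonglongrightarrow> f x * K y x"
      using AE_\<sigma>_pos AE_space
    proof eventually_elim
      case (elim x)
      define j where "j = \<lfloor>log 2 (\<sigma> x)\<rfloor>"
      have "\<forall>\<^sub>F m in sequentially. g m x * K y x = f x * K y x"
        using eventually_ge_at_top[of "nat \<bar>j\<bar>"]
      proof eventually_elim
        case (elim m)
        hence "j \<in> S m" by (auto simp: S_def)
        thus ?case using \<open>0 < \<sigma> x\<close> \<open>x \<in> space M\<close> by (simp add: g_def sum_piece j_def)
      qed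
      thus ?case by (rule tendsto_eventually)
    qed
    show "AE x in M. norm (g m x * K y x) \<le> norm (f x)" for m
      using AE_\<sigma>_pos AE_space
      by eventually_elim (auto simp: g_def sum_piece norm_mult mult_left_le K_bound[OF y])
    show "(\<lambda>x. g m x * K y x) \<in> borel_measurable M" for m
      unfolding g_def by measurable
  qed (use f in auto)
  hence lim: "(\<lambda>m. ennreal (norm (\<integral>x. g m x * K y x \<partial>M))) \<longlonglongrightarrow> ennreal (norm (T f y))"
    unfolding T_def by (intro tendsto_ennrealI tendsto_norm)
  have "ennreal (norm (\<integral>x. g m x * K y x \<partial>M)) \<le> (\<integral>\<^sup>+j. ennreal (norm (T (piece f j) y)) \<partial>count_space UNIV)" for m
  proof -
    have "(\<integral>x. g m x * K y x \<partial>M) = (\<Sum>j\<in>S m. T (piece f j) y)"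
      unfolding g_def sum_distrib_right T_def
      by (rule Bochner_Integration.integral_sum) (auto intro!: integrable_kernel integrable_piece f y)
    hence "ennreal (norm (\<integral>x. g m x * K y x \<partial>M)) \<le> ennreal (\<Sum>j\<in>S m. norm (T (piece f j) y))"
      by (auto intro!: ennreal_leI norm_sum)
    also have "\<dots> = (\<Sum>j\<in>S m. ennreal (norm (T (piece f j) y)))" by simp
    also have "\<dots> = (\<integral>\<^sup>+j. ennreal (norm (T (piece f j) y)) * indicator (S m) j \<partial>count_space UNIV)"
      by (subst nn_integral_count_space'[of "S m"]) auto
    also have "\<dots> \<le> (\<integral>\<^sup>+j. ennreal (norm (T (piece f j) y)) \<partial>count_space UNIV)"
      by (rule nn_integral_mono) (auto simp: indicator_def)
    finally show ?thesis .
  qed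
  thus ?thesis by (intro LIMSEQ_le_const2[OF lim]) auto
qed

text \<open>The bound J sees f on \<open>shell j\<close> only; summing over j can therefore recover
  the whole weighted integral of f.\<close>

definition block_bound :: "real \<Rightarrow> real \<Rightarrow> bool" where
  "block_bound C \<epsilon> \<longleftrightarrow> (\<forall>f i j J. integrable M f \<longrightarrow> 0 \<le> J \<longrightarrow>
      (\<integral>\<^sup>+x. ennreal (norm (f x) powr p * \<sigma> x powr (a * p)) * indicator (shell j) x \<partial>M) \<le> ennreal J \<longrightarrow>
      (\<integral>\<^sup>+y. ennreal (norm (T (piece f j) y) powr q * \<tau> y powr (- b * q)) * indicator (shell' i) y \<partial>N)
        \<le> ennreal (C * 2 powr (- (q * \<epsilon>) * \<bar>real_of_int (i + j)\<bar>) * J powr (q / p)))"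

lemma block_bound_ex: "\<exists>C>0. \<exists>\<epsilon>>0. block_bound C \<epsilon>"
proof -
  have q: "1 < q" "0 < 1 / q" "1 / q < 1" using p pq by auto
  have p'1: "1 / p' = 1 - 1 / p" using p' by simp
  \<comment> \<open>The largest admissible value of 1 / r': the condition r \<le> p amounts to t
    \<le> 1 / p', and q \<le> r' to t \<le> 1 / q. From p \<le> q follows t \<le> 1 / 2, that is r
    \<le> 2.\<close>
  define t where "t = min (1 / p') (1 / q)"
  have p'0: "0 < 1 / p'" "1 / p' < 1" unfolding p'1 using p by auto
  have t: "0 < t" "t < 1" "t \<le> 1 / 2"
  proof -
    show "0 < t" "t < 1" using p'0 q unfolding t_def by linarith+
    have "1 / q \<le> 1 / p" using p pq by (simp add: frac_le)
    thus "t \<le> 1 / 2" using p'1 unfolding t_def by linarith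
  qed
  define r where "r = 1 / (1 - t)"
  define r' where "r' = 1 / t"
  have ir: "1 / r = 1 - t" "1 / r' = t" by (auto simp: r_def r'_def)
  have r: "1 < r" "r \<le> 2" using t by (auto simp: r_def field_simps)
  have rr: "1 / r + 1 / r' = 1" by (simp add: ir)
  have rp: "r \<le> p"
  proof -
    have "1 / p \<le> 1 / r" using p'1 unfolding ir t_def by linarith
    thus ?thesis using r p by (simp add: field_simps)
  qed
  have qr': "q \<le> r'"
  proof -
    have "1 / r' \<le> 1 / q" unfolding ir t_def by simp
    thus ?thesis using t q by (simp add: r'_def field_simps)
  qed
  obtain D where D: "0 < D" "strong_type r r' D"
    using strong_type_conjugate[OF r rr] by blast
  \<comment> \<open>By \<open>balance\<close>, 1 / p' - \<theta> = a and 1 / q - \<theta> = b; hence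
    t - \<theta> is the smaller of a and b, and \<epsilon> is positive.\<close>
  define \<epsilon> where "\<epsilon> = min \<theta> (t - \<theta>)"
  have \<epsilon>: "0 < \<epsilon>" "\<epsilon> \<le> \<theta>" "\<epsilon> \<le> t - \<theta>"
    using sub ab balance unfolding \<epsilon>_def \<theta>_def t_def by linarith+
  \<comment> \<open>C1 and C2 are what the two local estimates leave when the powers of 2 with
    exponents i and j and the power of J are split off; 2 * A and 2 * B come from the measures of
    the shells.\<close>
  define C1 where "C1 = 2 powr q * (2 * B) * (2 * A) powr (q * (1 - 1 / p))"
  define C2 where "C2 = 2 * D powr (q / r') * 2 powr (q / r) * (2 * B) powr (1 - q / r') * (2 * A) powr (q / r - q / p)"
  define C where "C = C1 + C2"
  have C: "0 < C1" "0 < C2" using AB D by (auto simp: C1_def C2_def)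
  have C0: "0 < C" using C by (simp add: C_def)
  have main: "(\<integral>\<^sup>+y. ennreal (norm (T (piece f j) y) powr q * \<tau> y powr (- b * q)) * indicator (shell' i) y \<partial>N)
        \<le> ennreal (C * 2 powr (- (q * \<epsilon>) * \<bar>real_of_int (i + j)\<bar>) * J powr (q / p))"
    if f: "integrable M f" and J0: "0 \<le> J" and
      J: "(\<integral>\<^sup>+x. ennreal (norm (f x) powr p * \<sigma> x powr (a * p)) * indicator (shell j) x \<partial>M) \<le> ennreal J"
    for f i j J
  proof -
    have [measurable]: "f \<in> borel_measurable M" using f by auto
    define x where "x = real_of_int i"
    define z where "z = real_of_int j"
    \<comment> \<open>On \<open>shell j\<close> the weight is at least
      \<open>2 powr (z * (a * p))\<close>, so I bounds the unweighted integral of the piece.\<close>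
    define I where "I = 2 powr (- z * (a * p)) * J"
    let ?W = "(\<integral>\<^sup>+y. ennreal (norm (T (piece f j) y) powr q * \<tau> y powr (- b * q)) * indicator (shell' i) y \<partial>N)"
    let ?V = "(\<integral>\<^sup>+y. ennreal (norm (T (piece f j) y) powr q) * indicator (shell' i) y \<partial>N)"
    let ?L\<^sub>1 = "2 powr q * (2 * B * 2 powr x) * (2 * A * 2 powr z) powr (q * (1 - 1 / p)) * I powr (q / p)"
    let ?L\<^sub>2 = "2 * D powr (q / r') * 2 powr (q / r) * (2 * B * 2 powr x) powr (1 - q / r') * (2 * A * 2 powr z) powr (q / r - q / p) * I powr (q / p)"
    have I0: "0 \<le> I" using J0 by (simp add: I_def)
    have I: "(\<integral>\<^sup>+x. ennreal (norm (piece f j x) powr p) \<partial>M) \<le> ennreal I"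
    proof -
      have "(\<integral>\<^sup>+x. ennreal (norm (piece f j x) powr p) \<partial>M)
        \<le> (\<integral>\<^sup>+x. ennreal (2 powr (- z * (a * p))) * (ennreal (norm (f x) powr p * \<sigma> x powr (a * p)) * indicator (shell j) x) \<partial>M)"
      proof (rule nn_integral_mono)
        fix x
        show "ennreal (norm (piece f j x) powr p) \<le> ennreal (2 powr (- z * (a * p))) * (ennreal (norm (f x) powr p * \<sigma> x powr (a * p)) * indicator (shell j) x)"
        proof (cases "x \<in> shell j")
          case True
          hence "2 powr z \<le> \<sigma> x" using floor_log2_bounds(1)[of "\<sigma> x"] by (simp only: shell_def mem_Collect_eq z_def)
          hence "(2 powr z) powr (a * p) \<le> \<sigma> x powr (a * p)"
            using ab p by (intro powr_mono2) auto
          hence "1 \<le> 2 powr (- z * (a * p)) * \<sigma> x powr (a * p)"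
            by (simp add: powr_powr powr_minus field_simps)
          hence "norm (f x) powr p * 1 \<le> norm (f x) powr p * (2 powr (- z * (a * p)) * \<sigma> x powr (a * p))"
            by (intro mult_left_mono) auto
          thus ?thesis using True
            by (simp add: piece_def mult_ac flip: ennreal_mult)
        qed (use p in \<open>simp add: piece_def\<close>)
      qed
      also have "\<dots> = ennreal (2 powr (- z * (a * p))) * (\<integral>\<^sup>+x. (ennreal (norm (f x) powr p * \<sigma> x powr (a * p)) * indicator (shell j) x) \<partial>M)"
        by (rule nn_integral_cmult) measurable
      also have "\<dots> \<le> ennreal (2 powr (- z * (a * p))) * ennreal J"
        by (rule mult_left_mono[OF J]) simp
      finally show ?thesis using J0 by (simp add: I_def ennreal_mult)
    qed
    have Ipow: "I powr (q / p) = 2 powr (- z * a * q) * J powr (q / p)"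
      using p J0 by (simp add: I_def powr_mult powr_powr mult.assoc)
    have supp: "piece f j x = 0" if "x \<notin> shell j" for x using that by (simp add: piece_def)
    have weight: "?W
        \<le> ennreal (2 powr (- x * b * q) * L)"
      if L: "?V \<le> ennreal L" for L
    proof -
      have "?W
        \<le> (\<integral>\<^sup>+y. ennreal (2 powr (- x * b * q)) * (ennreal (norm (T (piece f j) y) powr q) * indicator (shell' i) y) \<partial>N)"
      proof (rule nn_integral_mono)
        fix y
        show "ennreal (norm (T (piece f j) y) powr q * \<tau> y powr (- b * q)) * indicator (shell' i) y
          \<le> ennreal (2 powr (- x * b * q)) * (ennreal (norm (T (piece f j) y) powr q) * indicator (shell' i) y)"
        proof (cases "y \<in> shell' i")
          case True
          hence "2 powr x \<le> \<tau> y" using floor_log2_bounds(1)[of "\<tau> y"] by (simp only: shell'_def mem_Collect_eq x_def)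
          hence "\<tau> y powr (- b * q) \<le> (2 powr x) powr (- b * q)"
            using ab q by (intro powr_mono2') auto
          also have "\<dots> = 2 powr (- x * b * q)" by (simp add: powr_powr mult_ac)
          finally show ?thesis using True
            by (simp add: mult.commute flip: ennreal_mult) (intro ennreal_leI mult_right_mono; simp)
        qed simp
      qed
      also have "\<dots> = ennreal (2 powr (- x * b * q)) * (\<integral>\<^sup>+y. (ennreal (norm (T (piece f j) y) powr q) * indicator (shell' i) y) \<partial>N)"
        by (rule nn_integral_cmult) measurable
      also have "\<dots> \<le> ennreal (2 powr (- x * b * q)) * ennreal L"
        by (rule mult_left_mono[OF L]) simp
      finally show ?thesis by (simp add: ennreal_mult')
    qed
    have em: "emeasure M (shell j) \<le> ennreal (2 * A * 2 powr z)" "emeasure N (shell' i) \<le> ennreal (2 * B * 2 powr x)"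
      using emeasure_shell emeasure_shell' by (simp_all add: x_def z_def)
    have m: "0 < 2 * A * 2 powr z" "0 < 2 * B * 2 powr x" using AB by auto
    have b1: "?W
        \<le> ennreal (C1 * 2 powr (q * \<theta> * (x + z)) * J powr (q / p))"
    proof -
      have "2 powr (- x * b * q) * ?L\<^sub>1
        = C1 * (2 powr (- x * b * q) * 2 powr x * 2 powr (z * (q * (1 - 1 / p))) * 2 powr (- z * a * q)) * J powr (q / p)"
        using AB by (simp add: C1_def Ipow powr_mult powr_powr mult_ac)
      also have "2 powr (- x * b * q) * 2 powr x * 2 powr (z * (q * (1 - 1 / p))) * 2 powr (- z * a * q) = 2 powr (q * \<theta> * (x + z))"
      proof -
        \<comment> \<open>Both coefficients equal q * \<theta>, the first because of
          \<open>balance\<close>. This is what merges the two shell indices into their sum.\<close>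
        have "- x * b * q + x + z * (q * (1 - 1 / p)) + - z * a * q = x * (1 - b * q) + z * (q * (1 / p' - a))"
          unfolding p'1 by (simp add: algebra_simps)
        also have "1 - b * q = q * \<theta>" using balance q unfolding \<theta>_def balance by (simp add: field_simps)
        also have "1 / p' - a = \<theta>" by (simp add: \<theta>_def)
        finally show ?thesis by (simp flip: powr_add) (simp add: algebra_simps)
      qed
      finally have eq: "2 powr (- x * b * q) * ?L\<^sub>1 = C1 * 2 powr (q * \<theta> * (x + z)) * J powr (q / p)" .
      have "?V \<le> ennreal ?L\<^sub>1"
        by (rule local_L1_estimate[OF integrable_piece[OF f] p _ shell_meas(1) em(1) m(1) supp shell_meas(2) em(2) m(2) I0 I]) (use q in simp)
      from weight[OF this] show ?thesis unfolding eq .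
    qed
    have b2: "?W
        \<le> ennreal (C2 * 2 powr (- q * (t - \<theta>) * (x + z)) * J powr (q / p))"
    proof -
      have "2 powr (- x * b * q) * ?L\<^sub>2
        = C2 * (2 powr (- x * b * q) * 2 powr (x * (1 - q / r')) * 2 powr (z * (q / r - q / p)) * 2 powr (- z * a * q)) * J powr (q / p)"
        using AB D by (simp add: C2_def Ipow powr_mult powr_powr mult_ac)
      also have "2 powr (- x * b * q) * 2 powr (x * (1 - q / r')) * 2 powr (z * (q / r - q / p)) * 2 powr (- z * a * q) = 2 powr (- q * (t - \<theta>) * (x + z))"
      proof -
        have "- x * b * q + x * (1 - q / r') + z * (q / r - q / p) + - z * a * q
          = x * (1 - b * q - q * (1 / r')) + z * (q * (1 / r - 1 / p - a))"
          by (simp add: algebra_simps)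
        also have "1 - b * q = q * \<theta>" using balance q unfolding \<theta>_def balance by (simp add: field_simps)
        also have "1 / r - 1 / p - a = \<theta> - t" using p'1 by (simp add: \<theta>_def ir)
        finally show ?thesis by (simp add: ir flip: powr_add) (simp add: algebra_simps)
      qed
      finally have eq: "2 powr (- x * b * q) * ?L\<^sub>2 = C2 * 2 powr (- q * (t - \<theta>) * (x + z)) * J powr (q / p)" .
      have "?V \<le> ennreal ?L\<^sub>2"
        by (rule local_HY_estimate[OF D integrable_piece[OF f] r(1) rp _ qr' shell_meas(1) em(1) m(1) supp shell_meas(2) em(2) m(2) I0 I]) (use q in simp_all)
      from weight[OF this] show ?thesis unfolding eq .
    qed
    \<comment> \<open>For x + z \<ge> 0 the interpolated bound decays, for x + z < 0 the one from
      \<open>L\<^sup>1\<close>.\<close>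
    have "min (C1 * 2 powr (q * \<theta> * (x + z))) (C2 * 2 powr (- q * (t - \<theta>) * (x + z))) \<le> C * 2 powr (- (q * \<epsilon>) * \<bar>x + z\<bar>)"
    proof (cases "0 \<le> x + z")
      case True
      have "- q * (t - \<theta>) * (x + z) \<le> - (q * \<epsilon>) * \<bar>x + z\<bar>"
        using True \<epsilon> q by (auto intro!: mult_mono mult_right_mono)
      hence "2 powr (- q * (t - \<theta>) * (x + z)) \<le> 2 powr (- (q * \<epsilon>) * \<bar>x + z\<bar>)" by simp
      hence "C2 * 2 powr (- q * (t - \<theta>) * (x + z)) \<le> C * 2 powr (- (q * \<epsilon>) * \<bar>x + z\<bar>)"
        using C by (intro mult_mono) (auto simp: C_def)
      thus ?thesis by linarith
    next
      case False
      have "q * \<epsilon> * \<bar>x + z\<bar> \<le> q * \<theta> * \<bar>x + z\<bar>"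
        using \<epsilon> q by (intro mult_right_mono) auto
      hence "q * \<theta> * (x + z) \<le> - (q * \<epsilon>) * \<bar>x + z\<bar>"
        using False by (simp add: algebra_simps)
      hence "2 powr (q * \<theta> * (x + z)) \<le> 2 powr (- (q * \<epsilon>) * \<bar>x + z\<bar>)" by simp
      hence "C1 * 2 powr (q * \<theta> * (x + z)) \<le> C * 2 powr (- (q * \<epsilon>) * \<bar>x + z\<bar>)"
        using C by (intro mult_mono) (auto simp: C_def)
      thus ?thesis by linarith
    qed
    then consider
        "C1 * 2 powr (q * \<theta> * (x + z)) \<le> C * 2 powr (- (q * \<epsilon>) * \<bar>x + z\<bar>)"
      | "C2 * 2 powr (- q * (t - \<theta>) * (x + z)) \<le> C * 2 powr (- (q * \<epsilon>) * \<bar>x + z\<bar>)"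
      by linarith
    hence "?W
        \<le> ennreal (C * 2 powr (- (q * \<epsilon>) * \<bar>x + z\<bar>) * J powr (q / p))"
    proof cases
      case 1
      show ?thesis by (rule order_trans[OF b1]) (intro ennreal_leI mult_right_mono 1 powr_ge_zero)
    next
      case 2
      show ?thesis by (rule order_trans[OF b2]) (intro ennreal_leI mult_right_mono 2 powr_ge_zero)
    qed
    thus ?thesis by (simp add: x_def z_def)
  qed
  have "block_bound C \<epsilon>"
    unfolding block_bound_def by (intro allI impI main)
  thus ?thesis using C0 \<epsilon>(1) by blast
qed

text \<open>For y in \<open>shell' i\<close> the pieces are summed with weights 2 to the power
  -\<epsilon>|i + j| / 2. Dividing by the power q of these weights costs half of the decay of the
  blocks; the other half makes the sum over i converge for each j. The constants W and V bound these
  two geometric sums.\<close>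

theorem weighted_inequality:
  "\<exists>C>0. \<forall>f J. integrable M f \<longrightarrow> 0 \<le> J \<longrightarrow>
      (\<integral>\<^sup>+x. ennreal (norm (f x) powr p * \<sigma> x powr (a * p)) \<partial>M) \<le> ennreal J \<longrightarrow>
      (\<integral>\<^sup>+y. ennreal (norm (T f y) powr q * \<tau> y powr (- b * q)) \<partial>N) \<le> ennreal (C * J powr (q / p))"
proof -
  have q: "1 < q" using p pq by simp
  obtain C \<epsilon> where C: "0 < C" and \<epsilon>: "0 < \<epsilon>" and block: "block_bound C \<epsilon>"
    using block_bound_ex by blast
  obtain W where W: "0 < W" "\<And>i::int. (\<integral>\<^sup>+j. ennreal (2 powr (- (\<epsilon> / 2) * \<bar>real_of_int (i + j)\<bar>)) \<partial>count_space UNIV) \<le> ennreal W"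
    using nn_integral_geometric_int[of "\<epsilon> / 2"] \<epsilon> by auto
  obtain V where V: "0 < V" "\<And>i::int. (\<integral>\<^sup>+j. ennreal (2 powr (- (q * \<epsilon> / 2) * \<bar>real_of_int (i + j)\<bar>)) \<partial>count_space UNIV) \<le> ennreal V"
    using nn_integral_geometric_int[of "q * \<epsilon> / 2"] \<epsilon> q by auto
  have C0: "0 < W powr q * C * V" using W(1) C V(1) by simp
  have main: "(\<integral>\<^sup>+y. ennreal (norm (T f y) powr q * \<tau> y powr (- b * q)) \<partial>N) \<le> ennreal (W powr q * C * V * J powr (q / p))"
    if f: "integrable M f" and J0: "0 \<le> J" and
      J: "(\<integral>\<^sup>+x. ennreal (norm (f x) powr p * \<sigma> x powr (a * p)) \<partial>M) \<le> ennreal J" for f J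
  proof -
    have [measurable]: "f \<in> borel_measurable M" using f by auto
    define G where "G x = norm (f x) powr p * \<sigma> x powr (a * p)" for x
    have [measurable]: "G \<in> borel_measurable M" unfolding G_def by measurable
    define c where "c j = (\<integral>\<^sup>+x. ennreal (G x) * indicator (shell j) x \<partial>M)" for j
    define cr where "cr j = enn2real (c j)" for j
    interpret CM: pair_sigma_finite "count_space (UNIV :: int set)" M
      by (intro pair_sigma_finite.intro sigma_finite_measure_count_space M.sigma_finite_measure_axioms)
    interpret CN: pair_sigma_finite "count_space (UNIV :: int set)" N
      by (intro pair_sigma_finite.intro sigma_finite_measure_count_space N.sigma_finite_measure_axioms)
    have sumc: "(\<integral>\<^sup>+j. c j \<partial>count_space UNIV) \<le> ennreal J"
    proof -
      have "(\<integral>\<^sup>+j. c j \<partial>count_space UNIV) = (\<integral>\<^sup>+x. (\<integral>\<^sup>+j. ennreal (G x) * indicator (shell j) x \<partial>count_space UNIV) \<partial>M)"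
        unfolding c_def
        by (rule CM.Fubini'[symmetric]) (rule measurable_pair_measure_countable1; simp)
      also have "\<dots> \<le> (\<integral>\<^sup>+x. ennreal (G x) \<partial>M)"
      proof (rule nn_integral_mono)
        fix x
        have "(\<integral>\<^sup>+j. ennreal (G x) * indicator (shell j) x \<partial>count_space UNIV)
          = (\<Sum>j\<in>{\<lfloor>log 2 (\<sigma> x)\<rfloor>}. ennreal (G x) * indicator (shell j) x)"
          by (rule nn_integral_count_space') (auto simp: shell_def indicator_def)
        also have "\<dots> \<le> ennreal (G x)" by (simp only: sum.insert_if finite.emptyI empty_iff if_False sum.empty add_0_right) (auto simp: indicator_def)
        finally show "(\<integral>\<^sup>+j. ennreal (G x) * indicator (shell j) x \<partial>count_space UNIV) \<le> ennreal (G x)" .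
      qed
      also have "\<dots> \<le> ennreal J" using J by (simp add: G_def)
      finally show ?thesis .
    qed
    have cj_le: "c j \<le> ennreal J" for j
      using nn_integral_ge_point[of j UNIV c] sumc by simp
    have cr: "c j = ennreal (cr j)" "0 \<le> cr j" "cr j \<le> J" for j
    proof -
      show e: "c j = ennreal (cr j)"
        using le_less_trans[OF cj_le ennreal_less_top, of j] by (simp add: cr_def)
      show "0 \<le> cr j" by (simp add: cr_def)
      show "cr j \<le> J" using cj_le[of j] J0 unfolding e by simp
    qed
    \<comment> \<open>The place where p \<le> q enters the summation: every \<open>cr j\<close> is
      at most J, so all but one power of it is replaced by J, and the terms that remain sum to at
      most J.\<close>
    have sumcq: "(\<integral>\<^sup>+j. ennreal (cr j powr (q / p)) \<partial>count_space UNIV) \<le> ennreal (J powr (q / p))"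
    proof -
      have "cr j powr (q / p) \<le> J powr (q / p - 1) * cr j" for j
      proof -
        have e: "cr j powr (q / p - 1) * cr j powr 1 = cr j powr (q / p)"
          unfolding powr_add[symmetric] by simp
        have "cr j powr (q / p - 1) * cr j powr 1 \<le> J powr (q / p - 1) * cr j powr 1"
          using cr p pq by (intro mult_right_mono powr_mono2) (auto simp: field_simps)
        thus ?thesis unfolding e using cr(2)[of j] by simp
      qed
      hence "(\<integral>\<^sup>+j. ennreal (cr j powr (q / p)) \<partial>count_space UNIV) \<le> (\<integral>\<^sup>+j. ennreal (J powr (q / p - 1)) * c j \<partial>count_space UNIV)"
        by (intro nn_integral_mono) (simp add: cr flip: ennreal_mult)
      also have "\<dots> = ennreal (J powr (q / p - 1)) * (\<integral>\<^sup>+j. c j \<partial>count_space UNIV)"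
        by (rule nn_integral_cmult) simp
      also have "\<dots> \<le> ennreal (J powr (q / p - 1)) * ennreal J"
        by (rule mult_left_mono[OF sumc]) simp
      also have "\<dots> = ennreal (J powr (q / p - 1) * J powr 1)" using J0 by (simp add: ennreal_mult)
      also have "\<dots> = ennreal (J powr (q / p))" unfolding powr_add[symmetric] by simp
      finally show ?thesis .
    qed
    define g where "g j y = norm (T (piece f j) y) powr q * \<tau> y powr (- b * q)" for j y
    have g_meas [measurable]: "g j \<in> borel_measurable N" for j unfolding g_def by measurable
    define e where "e i j = 2 powr (q * \<epsilon> / 2 * \<bar>real_of_int (i + j)\<bar>)" for i j :: int
    let ?H = "\<lambda>i j y. ennreal (W powr q * e i j) * (ennreal (g j y) * indicator (shell' i) y)"
    let ?k = "\<lambda>i j. ennreal (2 powr (- (q * \<epsilon> / 2) * \<bar>real_of_int (i + j)\<bar>))"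
    let ?c = "\<lambda>j. ennreal (W powr q * C * cr j powr (q / p))"
    \<comment> \<open>Only the index i of the shell of y contributes. Summing over all i removes the
      dependence of i on y, so that Tonelli's theorem applies afterwards.\<close>
    have pointwise: "ennreal (norm (T f y) powr q * \<tau> y powr (- b * q))
        \<le> (\<integral>\<^sup>+i. (\<integral>\<^sup>+j. ?H i j y \<partial>count_space UNIV) \<partial>count_space UNIV)"
      if y: "y \<in> space N" for y
    proof (cases "0 < \<tau> y")
      case False
      hence "\<tau> y = 0" using \<tau>_nonneg[of y] by simp
      thus ?thesis by simp
    next
      case True
      define i where "i = \<lfloor>log 2 (\<tau> y)\<rfloor>"
      have yi: "y \<in> shell' i" using True y by (simp add: shell'_def i_def)
      have ek: "(2 powr (- (\<epsilon> / 2) * \<bar>real_of_int (i + j)\<bar>)) powr (- q) = e i j" for j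
        by (simp add: e_def powr_powr mult_ac)
      have "ennreal (norm (T f y) powr q) \<le> ennreal (W powr q) * (\<integral>\<^sup>+j. ennreal (e i j * norm (T (piece f j) y) powr q) \<partial>count_space UNIV)"
        using sum_powr_le_weighted[OF q _ _ W(1) W(2)[of i] _ norm_T_le_sum_pieces[OF f y]]
        unfolding ek by simp
      hence "ennreal (\<tau> y powr (- b * q)) * ennreal (norm (T f y) powr q)
        \<le> ennreal (\<tau> y powr (- b * q)) * (ennreal (W powr q) * (\<integral>\<^sup>+j. ennreal (e i j * norm (T (piece f j) y) powr q) \<partial>count_space UNIV))"
        by (intro mult_left_mono) auto
      also have "\<dots> = (\<integral>\<^sup>+j. ennreal (\<tau> y powr (- b * q)) * (ennreal (W powr q) * ennreal (e i j * norm (T (piece f j) y) powr q)) \<partial>count_space UNIV)"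
        by (simp add: nn_integral_cmult)
      also have "\<dots> = (\<integral>\<^sup>+j. ?H i j y \<partial>count_space UNIV)"
        using yi by (intro nn_integral_cong) (simp add: g_def e_def mult_ac flip: ennreal_mult')
      also have "\<dots> \<le> (\<integral>\<^sup>+i. (\<integral>\<^sup>+j. ?H i j y \<partial>count_space UNIV) \<partial>count_space UNIV)"
        by (rule nn_integral_ge_point) simp
      finally show ?thesis by (simp add: mult.commute flip: ennreal_mult')
    qed
    have "(\<integral>\<^sup>+y. ennreal (norm (T f y) powr q * \<tau> y powr (- b * q)) \<partial>N)
      \<le> (\<integral>\<^sup>+y. (\<integral>\<^sup>+i. (\<integral>\<^sup>+j. ?H i j y \<partial>count_space UNIV) \<partial>count_space UNIV) \<partial>N)"
      by (rule nn_integral_mono) (rule pointwise)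
    also have "\<dots> = (\<integral>\<^sup>+i. (\<integral>\<^sup>+y. (\<integral>\<^sup>+j. ?H i j y \<partial>count_space UNIV) \<partial>N) \<partial>count_space UNIV)"
    proof (rule CN.Fubini', rule measurable_pair_measure_countable1)
      fix i :: int
      have "(\<lambda>(j, y). ?H i j y) \<in> borel_measurable (count_space (UNIV::int set) \<Otimes>\<^sub>M N)"
        by (rule measurable_pair_measure_countable1) simp_all
      from CM.M1.borel_measurable_nn_integral_fst[OF measurable_compose[OF measurable_pair_swap' this]]
      show "(\<lambda>y. case (i, y) of (i, y) \<Rightarrow> \<integral>\<^sup>+j. ?H i j y \<partial>count_space UNIV) \<in> borel_measurable N"
        by simp
    qed simp
    also have "\<dots> = (\<integral>\<^sup>+i. (\<integral>\<^sup>+j. (\<integral>\<^sup>+y. ?H i j y \<partial>N) \<partial>count_space UNIV) \<partial>count_space UNIV)"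
    proof (intro nn_integral_cong)
      fix i :: int
      show "(\<integral>\<^sup>+y. (\<integral>\<^sup>+j. ?H i j y \<partial>count_space UNIV) \<partial>N)
        = (\<integral>\<^sup>+j. (\<integral>\<^sup>+y. ?H i j y \<partial>N) \<partial>count_space UNIV)"
        by (rule CN.Fubini') (rule measurable_pair_measure_countable1; simp)
    qed
    also have "\<dots> \<le> (\<integral>\<^sup>+i. (\<integral>\<^sup>+j. ?c j * ?k i j \<partial>count_space UNIV) \<partial>count_space UNIV)"
    proof (intro nn_integral_mono)
      fix i j :: int
      have "(\<integral>\<^sup>+y. ?H i j y \<partial>N)
        = ennreal (W powr q * e i j) * (\<integral>\<^sup>+y. ennreal (g j y) * indicator (shell' i) y \<partial>N)"
        by (rule nn_integral_cmult) measurable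
      also have "\<dots> \<le> ennreal (W powr q * e i j) * ennreal (C * 2 powr (- (q * \<epsilon>) * \<bar>real_of_int (i + j)\<bar>) * cr j powr (q / p))"
        using block[unfolded block_bound_def, rule_format, OF f cr(2)[of j], of j i] cr(1)[of j] unfolding c_def G_def g_def
        by (intro mult_left_mono) auto
      also have "\<dots> = ennreal (W powr q * e i j * (C * 2 powr (- (q * \<epsilon>) * \<bar>real_of_int (i + j)\<bar>) * cr j powr (q / p)))"
        using C by (intro ennreal_mult[symmetric]) (auto simp: e_def)
      also have "W powr q * e i j * (C * 2 powr (- (q * \<epsilon>) * \<bar>real_of_int (i + j)\<bar>) * cr j powr (q / p))
        = W powr q * C * cr j powr (q / p) * (e i j * 2 powr (- (q * \<epsilon>) * \<bar>real_of_int (i + j)\<bar>))"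
        by (simp only: mult_ac)
      also have "e i j * 2 powr (- (q * \<epsilon>) * \<bar>real_of_int (i + j)\<bar>) = 2 powr (- (q * \<epsilon> / 2) * \<bar>real_of_int (i + j)\<bar>)"
      proof -
        have "q * \<epsilon> / 2 * t + - (q * \<epsilon>) * t = - (q * \<epsilon> / 2) * t" for t :: real
          by (simp add: field_simps)
        thus ?thesis unfolding e_def powr_add[symmetric] by (simp only:)
      qed
      finally show "(\<integral>\<^sup>+y. ?H i j y \<partial>N)
        \<le> ?c j * ?k i j"
        using C by (simp add: ennreal_mult')
    qed
    also have "\<dots> = (\<integral>\<^sup>+j. (\<integral>\<^sup>+i. ?c j * ?k i j \<partial>count_space UNIV) \<partial>count_space UNIV)"
    proof -
      interpret CC: pair_sigma_finite "count_space (UNIV :: int set)" "count_space (UNIV :: int set)"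
        by (intro pair_sigma_finite.intro sigma_finite_measure_count_space)
      show ?thesis by (rule CC.Fubini') (rule measurable_pair_measure_countable1; simp)
    qed
    also have "\<dots> \<le> (\<integral>\<^sup>+j. ennreal (W powr q * C * V) * ennreal (cr j powr (q / p)) \<partial>count_space UNIV)"
    proof (rule nn_integral_mono)
      fix j :: int
      have "(\<integral>\<^sup>+i. ?c j * ?k i j \<partial>count_space UNIV)
        = ?c j * (\<integral>\<^sup>+i. ?k j i \<partial>count_space UNIV)"
        by (subst nn_integral_cmult) (auto simp: add.commute)
      also have "\<dots> \<le> ?c j * ennreal V"
        by (rule mult_left_mono[OF V(2)]) simp
      also have "\<dots> = ennreal (W powr q * C * V) * ennreal (cr j powr (q / p))"
        using C V(1) W(1) by (simp add: mult_ac flip: ennreal_mult)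
      finally show "(\<integral>\<^sup>+i. ?c j * ?k i j \<partial>count_space UNIV)
        \<le> ennreal (W powr q * C * V) * ennreal (cr j powr (q / p))" .
    qed
    also have "\<dots> = ennreal (W powr q * C * V) * (\<integral>\<^sup>+j. ennreal (cr j powr (q / p)) \<partial>count_space UNIV)"
      by (rule nn_integral_cmult) simp
    also have "\<dots> \<le> ennreal (W powr q * C * V) * ennreal (J powr (q / p))"
      by (rule mult_left_mono[OF sumcq]) simp
    finally show ?thesis using C V(1) W(1) by (simp add: ennreal_mult)
  qed
  show ?thesis
    by (rule exI[of _ "W powr q * C * V"]) (intro conjI allI impI C0 main)
qed

end

section \<open>Laguerre polynomials\<close>

text \<open>With the factor exp (- t) taken out, differentiation acts on polynomials as p' - p. The
  restriction to t > 0 is needed to identify \<open>powr\<close> with a power.\<close>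

lemma funpow_deriv_exp_poly:
  fixes t :: real
  assumes "0 < t"
  shows "(deriv ^^ j) (\<lambda>s. exp (- s) * s powr real N) t
    = exp (- t) * poly (((\<lambda>p. pderiv p - p) ^^ j) (monom 1 N)) t"
  using assms
proof (induction j arbitrary: t)
  case 0
  thus ?case by (simp add: poly_monom powr_realpow)
next
  case (Suc j)
  define g where "g = (deriv ^^ j) (\<lambda>s::real. exp (- s) * s powr real N)"
  define P :: "real poly" where "P = ((\<lambda>p. pderiv p - p) ^^ j) (monom 1 N)"
  have ev: "eventually (\<lambda>s. g s = exp (- s) * poly P s) (nhds t)"
    using eventually_nhds_in_open[of "{0<..}" t] Suc.prems
    by (auto elim!: eventually_mono simp: Suc.IH g_def P_def)
  have "((\<lambda>s. exp (- s) * poly P s) has_field_derivative exp (- t) * poly (pderiv P - P) t) (at t)"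
    by (auto intro!: derivative_eq_intros simp: algebra_simps)
  hence "(g has_field_derivative exp (- t) * poly (pderiv P - P) t) (at t)"
    using DERIV_cong_ev[OF refl ev refl] by simp
  thus ?case by (simp add: g_def P_def DERIV_imp_deriv)
qed

text \<open>The binomial expansion of (D - 1)^j applied to the monomial of degree N: the coefficient
  of degree i comes from N - i derivatives. The sign is written with a sum in the exponent to avoid
  the truncated difference of j and N - i. The induction step is Pascal's rule.\<close>

lemma coeff_funpow_pderiv_minus:
  "coeff (((\<lambda>p. pderiv p - p) ^^ j) (monom (1::real) N)) i =
    (if i \<le> N then (-1) ^ (j + (N - i)) * real (j choose (N - i)) * fact N / fact i else 0)"
proof (induction j arbitrary: i)
  case 0
  show ?case by (cases "i = N") (auto simp: coeff_monom)
next
  case (Suc j)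
  define P :: "real poly" where "P = ((\<lambda>p. pderiv p - p) ^^ j) (monom 1 N)"
  have "coeff (pderiv P - P) i = real (Suc i) * coeff P (Suc i) - coeff P i"
    by (simp add: coeff_pderiv)
  also have "\<dots> = (if i \<le> N then (-1) ^ (Suc j + (N - i)) * real (Suc j choose (N - i)) * fact N / fact i else 0)"
  proof (cases "i < N")
    case True
    then obtain d where N: "N = i + Suc d" using less_imp_Suc_add by auto
    have e: "N - i = Suc d" "N - Suc i = d" "i \<le> N" "Suc i \<le> N" using N by auto
    have "real (Suc i) * coeff P (Suc i) = (-1) ^ (j + d) * real (j choose d) * fact N / fact i"
    proof -
      have "real (Suc i) * (y / fact (Suc i)) = y / fact i" for y :: real
        unfolding fact_Suc of_nat_mult by (simp del: of_nat_Suc)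
      thus ?thesis unfolding P_def Suc.IH using e by (simp del: of_nat_Suc fact_Suc)
    qed
    moreover have "coeff P i = (-1) ^ (j + Suc d) * real (j choose Suc d) * fact N / fact i"
      unfolding P_def Suc.IH using e by simp
    ultimately show ?thesis using e by (simp add: field_simps)
  next
    case False
    thus ?thesis unfolding P_def Suc.IH by (cases "i = N") auto
  qed
  finally show ?case by (simp add: P_def)
qed

text \<open>For integer order the polynomial in the Rodrigues formula is k! times the monomial of
  degree m times the claimed sum. The definition fixes \<open>laguerre\<close> only through its
  values at t > 0; a polynomial with that many zeros vanishes.\<close>

lemma laguerre_nat:
  "laguerre k (real m) = (\<Sum>i\<le>k. monom ((-1) ^ i * real ((k + m) choose (k - i)) / fact i) i)" (is "_ = ?q")
proof -
  define P :: "real poly" where "P = ((\<lambda>p. pderiv p - p) ^^ k) (monom 1 (k + m))"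
  have P: "P = monom (fact k) m * ?q"
  proof (rule poly_eqI)
    fix i
    show "coeff P i = coeff (monom (fact k) m * ?q) i"
    proof (cases "m \<le> i \<and> i \<le> k + m")
      case True
      define d where "d = i - m"
      have d: "d \<le> k" "i = d + m" using True by (auto simp: d_def)
      have "coeff P i = (-1) ^ (k + (k - d)) * real (k choose (k - d)) * fact (k + m) / fact (d + m)"
        unfolding P_def coeff_funpow_pderiv_minus using d by simp
      also have "(-1) ^ (k + (k - d)) = ((-1) ^ d :: real)"
        using d by (simp add: minus_one_power_iff)
      also have "real (k choose (k - d)) = fact k / (fact d * fact (k - d))"
        using d by (simp add: binomial_fact mult.commute)
      also have "(-1) ^ d * (fact k / (fact d * fact (k - d))) * fact (k + m) / fact (d + m)
         = fact k * ((-1) ^ d * real ((k + m) choose (k - d)) / fact d)"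
      proof -
        have "real ((k + m) choose (k - d)) = fact (k + m) / (fact (k - d) * fact (d + m))"
          using d binomial_fact[of "k - d" "k + m", where 'a = real] by (simp add: add.commute)
        thus ?thesis by (simp add: field_simps)
      qed
      also have "\<dots> = coeff (monom (fact k) m * ?q) i"
        using d by (simp add: coeff_monom_mult coeff_sum coeff_monom)
      finally show ?thesis .
    next
      case False
      have "coeff ?q (i - m) = 0" if "m \<le> i"
        using that False by (auto simp: coeff_sum coeff_monom)
      moreover have "coeff P i = 0"
        unfolding P_def coeff_funpow_pderiv_minus using False by auto
      ultimately show ?thesis by (auto simp: coeff_monom_mult)
    qed
  qed
  have "poly (laguerre k (real m)) t = poly ?q t" if t: "0 < t" for t
  proof -
    have "poly (laguerre k (real m)) t = t powr (- real m) * exp t / fact k * (exp (- t) * poly P t)"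
      unfolding poly_laguerre[OF t] rodrigues_def P_def
      using funpow_deriv_exp_poly[OF t, of k "k + m"] by simp
    also have "poly P t = fact k * t ^ m * poly ?q t" unfolding P by (simp add: poly_monom)
    also have "t powr (- real m) = 1 / t ^ m" using t by (simp add: powr_minus powr_realpow divide_inverse)
    finally show ?thesis using t by (simp add: exp_minus field_simps)
  qed
  hence "{0<..} \<subseteq> {t. poly (laguerre k (real m) - ?q) t = 0}" by auto
  hence "infinite {t. poly (laguerre k (real m) - ?q) t = 0}"
    using infinite_Ioi[of "0::real"] infinite_super by blast
  thus ?thesis using poly_roots_finite[of "laguerre k (real m) - ?q"] by auto
qed

text \<open>The usual power expansion of the Laguerre polynomial of integer order m, kept as a plain
  function for the series manipulations below.\<close>

definition lag :: "nat \<Rightarrow> nat \<Rightarrow> real \<Rightarrow> real" where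
  "lag m k x = (\<Sum>i\<le>k. (-1) ^ i * real ((k + m) choose (k - i)) * x ^ i / fact i)"

lemma poly_laguerre_lag: "poly (laguerre k (real m)) x = lag m k x"
  by (simp add: laguerre_nat lag_def poly_sum poly_monom)

lemma lag_0: "lag m k 0 = real ((k + m) choose k)"
proof -
  have "lag m k 0 = (\<Sum>i\<in>{0}. (-1) ^ i * real ((k + m) choose (k - i)) * 0 ^ i / fact i)"
    unfolding lag_def by (rule sum.mono_neutral_right) auto
  thus ?thesis by simp
qed

text \<open>A crude bound, but geometric in k, so that power series in a small r may be integrated
  term by term. In \<open>phi\<close> the argument x comes with exp (- x / 2); against exp (x / 4)
  this leaves an integrable Gaussian. The 8 is 2 from the binomial coefficient times 4 from
  rescaling the powers of x.\<close>

lemma abs_lag_le: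
  assumes "0 \<le> x"
  shows "\<bar>lag m k x\<bar> \<le> 2 ^ m * 8 ^ k * exp (x / 4)"
proof -
  have "\<bar>lag m k x\<bar> \<le> (\<Sum>i\<le>k. \<bar>(-1) ^ i * real ((k + m) choose (k - i)) * x ^ i / fact i\<bar>)"
    unfolding lag_def by (rule sum_abs)
  also have "\<dots> \<le> (\<Sum>i\<le>k. 2 ^ (k + m) * 4 ^ k * ((x / 4) ^ i / fact i))"
  proof (rule sum_mono)
    fix i assume i: "i \<in> {..k}"
    have "real ((k + m) choose (k - i)) \<le> real (2 ^ (k + m))"
      by (intro of_nat_mono binomial_le_pow2)
    hence b: "real ((k + m) choose (k - i)) \<le> 2 ^ (k + m)" by simp
    have p4: "x ^ i \<le> 4 ^ k * (x / 4) ^ i"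
    proof -
      have "x ^ i = 4 ^ i * (x / 4) ^ i" by (simp add: power_divide)
      also have "\<dots> \<le> 4 ^ k * (x / 4) ^ i" using i assms by (intro mult_right_mono power_increasing) auto
      finally show ?thesis .
    qed
    have "real ((k + m) choose (k - i)) * x ^ i / fact i \<le> 2 ^ (k + m) * (4 ^ k * (x / 4) ^ i) / fact i"
      using b p4 assms by (intro divide_right_mono mult_mono) auto
    thus "\<bar>(-1) ^ i * real ((k + m) choose (k - i)) * x ^ i / fact i\<bar> \<le> 2 ^ (k + m) * 4 ^ k * ((x / 4) ^ i / fact i)"
      using assms by (simp add: abs_mult mult.assoc)
  qed
  also have "\<dots> = 2 ^ (k + m) * 4 ^ k * (\<Sum>i\<le>k. (x / 4) ^ i / fact i)"
    by (simp add: sum_distrib_left)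
  also have "(\<Sum>i\<le>k. (x / 4) ^ i / fact i) \<le> exp (x / 4)"
  proof -
    have "(\<Sum>i\<in>{..k}. (x / 4) ^ i /\<^sub>R fact i) \<le> (\<Sum>i. (x / 4) ^ i /\<^sub>R fact i)"
      using assms by (intro sum_le_suminf summable_exp_generic) auto
    thus ?thesis unfolding exp_def real_scaleR_def divide_inverse_commute .
  qed
  also have "(2::real) ^ (k + m) * 4 ^ k = 2 ^ m * 8 ^ k"
  proof -
    have "(8::real) ^ k = 2 ^ k * 4 ^ k" unfolding power_mult_distrib[symmetric] by simp
    thus ?thesis unfolding power_add by simp
  qed
  finally show ?thesis by simp
qed

lemma negative_binomial_sums:
  fixes r :: real
  assumes "\<bar>r\<bar> < 1"
  shows "(\<lambda>j. real ((j + N) choose j) * r ^ j) sums (1 / (1 - r) ^ (N + 1))"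
proof -
  have "(\<lambda>n. ((- (real N + 1)) gchoose n) * (- r) ^ n) sums (1 + (- r)) powr (- (real N + 1))"
    by (rule gen_binomial_real) (use assms in simp)
  moreover have "((- (real N + 1)) gchoose n) * (- r) ^ n = real ((n + N) choose n) * r ^ n" for n
  proof -
    have "((- (real N + 1)) gchoose n) = (-1) ^ n * (real (n + N) gchoose n)"
      using gbinomial_minus[of "real N + 1" n] by (simp add: add_ac)
    also have "real (n + N) gchoose n = real ((n + N) choose n)"
      by (rule binomial_gbinomial[symmetric])
    finally have "((- (real N + 1)) gchoose n) * (- r) ^ n = ((-1) ^ n * (- r) ^ n) * real ((n + N) choose n)" by simp
    also have "(-1) ^ n * (- r) ^ n = r ^ n" by (simp flip: power_mult_distrib)
    finally show ?thesis by simp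
  qed
  moreover have "(1 + (- r)) powr (- (real N + 1)) = 1 / (1 - r) ^ (N + 1)"
  proof -
    have "- (real N + 1) = - real (N + 1)" by simp
    hence "(1 + (- r)) powr (- (real N + 1)) = inverse ((1 - r) powr real (N + 1))"
      by (simp only: powr_minus add_uminus_conv_diff)
    also have "(1 - r) powr real (N + 1) = (1 - r) ^ (N + 1)" by (rule powr_realpow) (use assms in simp)
    finally show ?thesis by (simp only: inverse_eq_divide)
  qed
  ultimately show ?thesis by simp
qed

text \<open>With k = i + j the series becomes a double sum whose inner sum over j is a negative
  binomial series of order i + m and whose outer sum over i is exponential. The same computation
  with |x| and |r|, in \<open>Fa\<close>, gives the absolute convergence needed for the
  rearrangement.\<close>

lemma laguerre_generating_function:
  fixes r x :: real
  assumes r: "\<bar>r\<bar> < 1"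
  shows "(\<lambda>k. r ^ k * lag m k x) sums (1 / (1 - r) ^ (m + 1) * exp (- x * r / (1 - r)))"
proof -
  define F where "F = (\<lambda>(i, j). (- x) ^ i / fact i * r ^ i * (real ((j + (i + m)) choose j) * r ^ j))"
  define Fa where "Fa = (\<lambda>(i, j). \<bar>x\<bar> ^ i / fact i * \<bar>r\<bar> ^ i * (real ((j + (i + m)) choose j) * \<bar>r\<bar> ^ j))"
  have inner: "((\<lambda>j. real ((j + (i + m)) choose j) * \<rho> ^ j) has_sum (1 / (1 - \<rho>) ^ (i + m + 1))) UNIV"
    if \<rho>: "\<bar>\<rho>\<bar> < 1" for \<rho> :: real and i
  proof (rule norm_summable_imp_has_sum)
    show "(\<lambda>j. real ((j + (i + m)) choose j) * \<rho> ^ j) sums (1 / (1 - \<rho>) ^ (i + m + 1))"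
      using negative_binomial_sums[OF \<rho>, of "i + m"] by simp
    have "summable (\<lambda>j. real ((j + (i + m)) choose j) * \<bar>\<rho>\<bar> ^ j)"
      by (rule sums_summable[OF negative_binomial_sums]) (use \<rho> in simp)
    thus "summable (\<lambda>j. norm (real ((j + (i + m)) choose j) * \<rho> ^ j))"
      by (simp add: abs_mult power_abs)
  qed
  have outer: "((\<lambda>i. y ^ i / fact i * \<rho> ^ i * (1 / (1 - \<rho>) ^ (i + m + 1))) has_sum
      (1 / (1 - \<rho>) ^ (m + 1) * exp (y * \<rho> / (1 - \<rho>)))) UNIV"
    if \<rho>: "\<bar>\<rho>\<bar> < 1" for \<rho> y :: real
  proof -
    have eq: "y ^ i / fact i * \<rho> ^ i * (1 / (1 - \<rho>) ^ (i + m + 1)) = 1 / (1 - \<rho>) ^ (m + 1) * ((y * \<rho> / (1 - \<rho>)) ^ i /\<^sub>R fact i)" for i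
    proof -
      have e: "(1 - \<rho>) ^ (i + m + 1) = (1 - \<rho>) ^ (m + 1) * (1 - \<rho>) ^ i"
        unfolding power_add[symmetric] by (simp add: add_ac)
      show ?thesis unfolding e power_divide power_mult_distrib
        by (simp only: divide_inverse inverse_mult_distrib real_scaleR_def mult_ac mult_1_left)
    qed
    show ?thesis unfolding eq
    proof (rule norm_summable_imp_has_sum)
      show "(\<lambda>i. 1 / (1 - \<rho>) ^ (m + 1) * ((y * \<rho> / (1 - \<rho>)) ^ i /\<^sub>R fact i)) sums (1 / (1 - \<rho>) ^ (m + 1) * exp (y * \<rho> / (1 - \<rho>)))"
        by (intro sums_mult exp_converges)
      show "summable (\<lambda>i. norm (1 / (1 - \<rho>) ^ (m + 1) * ((y * \<rho> / (1 - \<rho>)) ^ i /\<^sub>R fact i)))"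
        unfolding norm_mult by (intro summable_mult summable_norm_exp)
    qed
  qed
  have "Fa summable_on (SIGMA i:UNIV. UNIV)"
  proof (rule summable_on_SigmaI)
    show "((\<lambda>j. Fa (i, j)) has_sum \<bar>x\<bar> ^ i / fact i * \<bar>r\<bar> ^ i * (1 / (1 - \<bar>r\<bar>) ^ (i + m + 1))) UNIV" for i
      unfolding Fa_def case_prod_conv by (intro has_sum_cmult_right inner) (use r in simp)
    show "(\<lambda>i. \<bar>x\<bar> ^ i / fact i * \<bar>r\<bar> ^ i * (1 / (1 - \<bar>r\<bar>) ^ (i + m + 1))) summable_on UNIV"
      by (rule has_sum_imp_summable[OF outer]) (use r in simp)
  qed (auto simp: Fa_def)
  moreover have "norm (F z) = Fa z" for z
    by (cases z) (simp add: F_def Fa_def abs_mult power_abs)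
  ultimately have "(\<lambda>z. norm (F z)) summable_on (SIGMA i:UNIV. UNIV)" by simp
  hence "F summable_on (SIGMA i:UNIV. UNIV)" by (rule abs_summable_summable)
  hence "(F has_sum (1 / (1 - r) ^ (m + 1) * exp ((- x) * r / (1 - r)))) (SIGMA i:UNIV. UNIV)"
  proof (rule has_sum_SigmaI[rotated 2])
    show "((\<lambda>j. F (i, j)) has_sum (- x) ^ i / fact i * r ^ i * (1 / (1 - r) ^ (i + m + 1))) UNIV" for i
      unfolding F_def case_prod_conv by (intro has_sum_cmult_right inner r)
  qed (rule outer[OF r])
  hence "((\<lambda>(k, i). F (i, k - i)) has_sum (1 / (1 - r) ^ (m + 1) * exp ((- x) * r / (1 - r)))) (SIGMA k:UNIV. {..k})"
    by (subst has_sum_reindex_bij_witness[where i = "\<lambda>(i, j). (i + j, i)" and j = "\<lambda>(k, i). (i, k - i)" and T = "SIGMA i:UNIV. UNIV" and h = F and s' = "1 / (1 - r) ^ (m + 1) * exp ((- x) * r / (1 - r))"]) auto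
  hence "((\<lambda>k. r ^ k * lag m k x) has_sum (1 / (1 - r) ^ (m + 1) * exp ((- x) * r / (1 - r)))) UNIV"
  proof (rule has_sum_SigmaD)
    fix k :: nat
    have "(\<Sum>i\<le>k. case (k, i) of (k, i) \<Rightarrow> F (i, k - i)) = r ^ k * lag m k x"
      unfolding lag_def sum_distrib_left
    proof (rule sum.cong)
      fix i assume "i \<in> {..k}"
      hence i: "i \<le> k" by simp
      have "(- x) ^ i = (-1) ^ i * x ^ i" by (rule power_minus)
      moreover have "r ^ i * r ^ (k - i) = r ^ k" using i by (simp flip: power_add)
      moreover have "k - i + (i + m) = k + m" using i by simp
      ultimately show "(case (k, i) of (k, i) \<Rightarrow> F (i, k - i)) = r ^ k * ((-1) ^ i * real ((k + m) choose (k - i)) * x ^ i / fact i)"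
        by (simp add: F_def mult_ac)
    qed simp
    thus "((\<lambda>i. case (k, i) of (k, i) \<Rightarrow> F (i, k - i)) has_sum r ^ k * lag m k x) {..k}"
      by (intro has_sum_finiteI) auto
  qed
  thus ?thesis by (intro has_sum_imp_sums) simp
qed

section \<open>Gaussian integrals and power series\<close>

lemma borel_measurable_cis [measurable (raw)]:
  "f \<in> borel_measurable M \<Longrightarrow> (\<lambda>x. cis (f x)) \<in> borel_measurable M"
  unfolding cis_conv_exp by measurable

text \<open>A rescaled form of the characteristic function of the standard normal law; s is the
  square root of 2a because the normal density carries the exponent - x^2 / 2.\<close>

lemma gaussian_fourier_real:
  fixes a b :: real
  assumes a: "0 < a"
  shows "integrable lborel (\<lambda>t. of_real (exp (- a * t\<^sup>2)) * cis (b * t))"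
    and "(\<integral>t. of_real (exp (- a * t\<^sup>2)) * cis (b * t) \<partial>lborel) = of_real (sqrt (pi / a) * exp (- b\<^sup>2 / (4 * a)))"
proof -
  define s where "s = sqrt (2 * a)"
  have s: "0 < s" "s\<^sup>2 = 2 * a" using a by (auto simp: s_def)
  let ?g = "\<lambda>x. of_real (std_normal_density x) * cis (b / s * x)"
  have g_int: "integrable lborel ?g"
  proof (rule Bochner_Integration.integrable_bound)
    show "integrable lborel std_normal_density" by (rule integrable_normal_density) simp
  qed (auto simp: norm_mult)
  have g_val: "(\<integral>x. ?g x \<partial>lborel) = of_real (exp (- (b / s)\<^sup>2 / 2))"
  proof -
    have "of_real (exp (- (b / s)\<^sup>2 / 2)) = char std_normal_distribution (b / s)"
      by (simp add: char_std_normal_distribution)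
    also have "\<dots> = (\<integral>x. std_normal_density x *\<^sub>R cis (b / s * x) \<partial>lborel)"
      unfolding char_def by (subst integral_density) (auto simp: cis_conv_exp)
    finally show ?thesis by (simp add: scaleR_conv_of_real)
  qed
  have eq: "?g (0 + s * t) = of_real (1 / sqrt (2 * pi)) * (of_real (exp (- a * t\<^sup>2)) * cis (b * t))" for t
  proof -
    have "std_normal_density (s * t) = 1 / sqrt (2 * pi) * exp (- a * t\<^sup>2)"
      by (simp add: normal_density_def power_mult_distrib s)
    moreover have "b / s * (s * t) = b * t" using s by simp
    ultimately show ?thesis by (simp only: of_real_mult add_0_left mult.assoc)
  qed
  have "integrable lborel (\<lambda>t. ?g (0 + s * t))"
    using g_int s by (subst lborel_integrable_real_affine_iff) auto
  hence i: "integrable lborel (\<lambda>t. of_real (1 / sqrt (2 * pi)) * (of_real (exp (- a * t\<^sup>2)) * cis (b * t)))"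
    by (simp only: eq)
  have "complex_of_real (sqrt (2 * pi)) * of_real (1 / sqrt (2 * pi)) = 1"
    unfolding of_real_mult[symmetric] by simp
  hence "complex_of_real (sqrt (2 * pi)) * (of_real (1 / sqrt (2 * pi)) * z) = z" for z
    by (metis mult.assoc mult_1_left)
  with integrable_mult_right[OF i, of "of_real (sqrt (2 * pi))"]
  show "integrable lborel (\<lambda>t. of_real (exp (- a * t\<^sup>2)) * cis (b * t))"
    by (simp only:)
  have "of_real (exp (- (b / s)\<^sup>2 / 2)) = \<bar>s\<bar> *\<^sub>R (\<integral>t. ?g (0 + s * t) \<partial>lborel)"
    using lborel_integral_real_affine[of s ?g 0] s g_val by simp
  also have "\<dots> = of_real s * (of_real (1 / sqrt (2 * pi)) * (\<integral>t. of_real (exp (- a * t\<^sup>2)) * cis (b * t) \<partial>lborel))"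
    unfolding eq using s by (subst integral_mult_right_zero) (simp add: scaleR_conv_of_real)
  also have "\<dots> = of_real (s / sqrt (2 * pi)) * (\<integral>t. of_real (exp (- a * t\<^sup>2)) * cis (b * t) \<partial>lborel)"
    by simp
  finally have "of_real (exp (- (b / s)\<^sup>2 / 2)) = complex_of_real (s / sqrt (2 * pi)) * (\<integral>t. of_real (exp (- a * t\<^sup>2)) * cis (b * t) \<partial>lborel)" .
  hence "complex_of_real (sqrt (pi / a)) * of_real (exp (- (b / s)\<^sup>2 / 2))
    = (complex_of_real (sqrt (pi / a)) * of_real (s / sqrt (2 * pi))) * (\<integral>t. of_real (exp (- a * t\<^sup>2)) * cis (b * t) \<partial>lborel)"
    by (simp only: mult.assoc)
  also have "complex_of_real (sqrt (pi / a)) * of_real (s / sqrt (2 * pi)) = 1"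
  proof -
    have "sqrt (pi / a) * (s / sqrt (2 * pi)) = 1"
      using a by (simp add: s_def real_sqrt_divide real_sqrt_mult)
    thus ?thesis unfolding of_real_mult[symmetric] using a s by simp
  qed
  also have "(b / s)\<^sup>2 = b\<^sup>2 / (2 * a)" using s by (simp add: power_divide)
  finally show "(\<integral>t. of_real (exp (- a * t\<^sup>2)) * cis (b * t) \<partial>lborel) = of_real (sqrt (pi / a) * exp (- b\<^sup>2 / (4 * a)))"
    by simp
qed

text \<open>Serves two purposes: Gaussians factor over the coordinates, and so does the majorant of
  Schwartz functions in \<open>integrable_schwartz\<close>.\<close>

lemma lborel_prod_Basis:
  fixes f :: "'a::euclidean_space \<Rightarrow> real \<Rightarrow> complex"
  assumes f: "\<And>b. b \<in> Basis \<Longrightarrow> integrable lborel (f b)"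
  shows "integrable lborel (\<lambda>x::'a. \<Prod>b\<in>Basis. f b (x \<bullet> b))"
    and "(\<integral>x. (\<Prod>b\<in>Basis. f b (x \<bullet> b)) \<partial>(lborel :: 'a measure)) = (\<Prod>b\<in>Basis. \<integral>t. f b t \<partial>lborel)"
proof -
  interpret product_sigma_finite "\<lambda>_::'a. lborel :: real measure" ..
  let ?P = "\<Pi>\<^sub>M b\<in>(Basis::'a set). (lborel :: real measure)"
  let ?T = "\<lambda>g::'a\<Rightarrow>real. \<Sum>b\<in>Basis. g b *\<^sub>R b"
  have [measurable]: "f b \<in> borel_measurable borel" if "b \<in> Basis" for b
    using f[OF that] by auto
  have T: "?T \<in> measurable ?P borel" by measurable
  have F: "(\<lambda>x::'a. \<Prod>b\<in>Basis. f b (x \<bullet> b)) \<in> borel_measurable borel"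
    by (intro borel_measurable_prod) measurable
  have comp: "(\<Prod>b\<in>Basis. f b (?T g \<bullet> b)) = (\<Prod>b\<in>Basis. f b (g b))" for g
    by (intro prod.cong refl) simp
  show "integrable lborel (\<lambda>x::'a. \<Prod>b\<in>Basis. f b (x \<bullet> b))"
    by (subst lborel_eq, subst integrable_distr_eq[OF T F], unfold comp)
       (intro product_integrable_prod f finite_Basis)
  show "(\<integral>x. (\<Prod>b\<in>Basis. f b (x \<bullet> b)) \<partial>(lborel :: 'a measure)) = (\<Prod>b\<in>Basis. \<integral>t. f b t \<partial>lborel)"
    by (subst lborel_eq, subst integral_distr[OF T F], unfold comp)
       (intro product_integral_prod f finite_Basis)
qed

lemma gaussian_fourier:
  fixes a :: real and v :: "'a::euclidean_space"
  assumes a: "0 < a"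
  shows "integrable lborel (\<lambda>x::'a. of_real (exp (- a * (norm x)\<^sup>2)) * cis (x \<bullet> v))"
    and "(\<integral>x. of_real (exp (- a * (norm x)\<^sup>2)) * cis (x \<bullet> v) \<partial>(lborel :: 'a measure))
      = of_real (sqrt (pi / a) ^ DIM('a) * exp (- (norm v)\<^sup>2 / (4 * a)))"
proof -
  let ?f = "\<lambda>b t. of_real (exp (- a * t\<^sup>2)) * cis ((v \<bullet> b) * t) :: complex"
  have n2: "(norm y)\<^sup>2 = (\<Sum>b\<in>Basis. (y \<bullet> b)\<^sup>2)" for y :: 'a
    by (simp add: norm_eq_sqrt_inner euclidean_inner[of y y] power2_eq_square sum_nonneg)
  have eq: "of_real (exp (- a * (norm x)\<^sup>2)) * cis (x \<bullet> v) = (\<Prod>b\<in>Basis. ?f b (x \<bullet> b))" for x :: 'a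
  proof -
    have "exp (- a * (norm x)\<^sup>2) = (\<Prod>b\<in>Basis. exp (- a * (x \<bullet> b)\<^sup>2))"
      unfolding n2 by (simp add: sum_distrib_left exp_sum)
    moreover have "cis (x \<bullet> v) = (\<Prod>b\<in>Basis. cis ((v \<bullet> b) * (x \<bullet> b)))"
    proof -
      have "x \<bullet> v = (\<Sum>b\<in>Basis. (v \<bullet> b) * (x \<bullet> b))"
        by (subst euclidean_inner) (simp add: mult.commute)
      thus ?thesis by (simp add: cis_conv_exp sum_distrib_left exp_sum)
    qed
    ultimately show ?thesis by (simp add: prod.distrib)
  qed
  show "integrable lborel (\<lambda>x::'a. of_real (exp (- a * (norm x)\<^sup>2)) * cis (x \<bullet> v))"
    unfolding eq by (intro lborel_prod_Basis gaussian_fourier_real a)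
  have "(\<integral>x. of_real (exp (- a * (norm x)\<^sup>2)) * cis (x \<bullet> v) \<partial>(lborel :: 'a measure))
    = (\<Prod>b\<in>(Basis::'a set). of_real (sqrt (pi / a) * exp (- (v \<bullet> b)\<^sup>2 / (4 * a))))"
    unfolding eq by (subst lborel_prod_Basis) (simp_all only: gaussian_fourier_real[OF a])
  also have "\<dots> = of_real (sqrt (pi / a) ^ DIM('a) * (\<Prod>b\<in>(Basis::'a set). exp (- (v \<bullet> b)\<^sup>2 / (4 * a))))"
    by (simp add: prod.distrib)
  also have "(\<Prod>b\<in>(Basis::'a set). exp (- (v \<bullet> b)\<^sup>2 / (4 * a))) = exp (- (norm v)\<^sup>2 / (4 * a))"
    unfolding n2 by (simp add: exp_sum[symmetric] sum_negf sum_divide_distrib)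
  finally show "(\<integral>x. of_real (exp (- a * (norm x)\<^sup>2)) * cis (x \<bullet> v) \<partial>(lborel :: 'a measure))
      = of_real (sqrt (pi / a) ^ DIM('a) * exp (- (norm v)\<^sup>2 / (4 * a)))" .
qed

lemma integrable_gaussian:
  fixes z :: "'a::euclidean_space"
  assumes "0 < a"
  shows "integrable lborel (\<lambda>x. exp (- a * (norm (x - z))\<^sup>2))"
proof -
  have "integrable lborel (\<lambda>x::'a. of_real (exp (- a * (norm x)\<^sup>2)) * cis (x \<bullet> 0))"
    by (rule gaussian_fourier[OF assms])
  hence "integrable lborel (\<lambda>x::'a. norm (of_real (exp (- a * (norm x)\<^sup>2)) * cis (x \<bullet> 0)))"
    by (rule integrable_norm)
  hence "integrable lborel (\<lambda>x::'a. exp (- a * (norm x)\<^sup>2))" by (simp add: norm_mult)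
  hence "integrable (distr lborel borel ((+) (- z))) (\<lambda>x::'a. exp (- a * (norm x)\<^sup>2))"
    by (simp add: lborel_distr_plus)
  thus ?thesis by (subst (asm) integrable_distr_eq) auto
qed

lemma lborel_integral_translate:
  fixes f :: "'a::euclidean_space \<Rightarrow> 'b::{banach, second_countable_topology}"
  assumes [measurable]: "f \<in> borel_measurable borel"
  shows "(\<integral>x. f (z + x) \<partial>lborel) = (\<integral>x. f x \<partial>lborel)"
proof -
  have "(\<integral>x. f x \<partial>lborel) = (\<integral>x. f x \<partial>distr lborel borel ((+) z))"
    by (simp add: lborel_distr_plus)
  also have "\<dots> = (\<integral>x. f (z + x) \<partial>lborel)" by (rule integral_distr) auto
  finally show ?thesis ..
qed

lemma lborel_nn_integral_reflect:
  fixes f :: "'a::euclidean_space \<Rightarrow> ennreal"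
  assumes [measurable]: "f \<in> borel_measurable borel"
  shows "(\<integral>\<^sup>+x. f (z - x) \<partial>lborel) = (\<integral>\<^sup>+x. f x \<partial>lborel)"
proof -
  have "(\<integral>\<^sup>+x. f x \<partial>lborel) = (\<integral>\<^sup>+x. f x \<partial>density (distr lborel borel (\<lambda>x. z + (-1) *\<^sub>R x)) (\<lambda>_. ennreal (\<bar>-1\<bar> ^ DIM('a))))"
    by (subst lborel_affine[of "-1" z]) simp_all
  also have "\<dots> = (\<integral>\<^sup>+x. f (z - x) \<partial>lborel)"
    by (simp add: nn_integral_density nn_integral_distr)
  finally show ?thesis ..
qed

text \<open>Once the coefficients below n vanish, the series may be divided by r^n for r \<noteq> 0;
  the limit r to 0 then isolates the coefficient n.\<close>

lemma power_series_zero_coeffs: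
  fixes d :: "nat \<Rightarrow> real"
  assumes \<rho>: "0 < \<rho>" and s: "\<And>r. \<bar>r\<bar> < \<rho> \<Longrightarrow> (\<lambda>k. d k * r ^ k) sums 0"
  shows "d n = 0"
proof (induction n rule: less_induct)
  case (less n)
  have "(\<lambda>k. d (k + n) * r ^ k) sums 0" if r: "r \<noteq> 0" "norm r < \<rho>" for r
  proof -
    have "(\<lambda>k. d (k + n) * r ^ (k + n)) sums (0 - (\<Sum>k<n. d k * r ^ k))"
      using s[of r] r by (subst sums_iff_shift) simp
    also have "(\<Sum>k<n. d k * r ^ k) = 0" using less.IH by simp
    finally have "(\<lambda>k. inverse (r ^ n) * (d (k + n) * r ^ (k + n))) sums (inverse (r ^ n) * 0)"
      by (intro sums_mult) simp
    moreover have "inverse (r ^ n) * (d (k + n) * r ^ (k + n)) = d (k + n) * r ^ k" for k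
      using r by (simp add: power_add)
    ultimately show ?thesis by simp
  qed
  hence "((\<lambda>_. 0) \<longlongrightarrow> d (0 + n)) (at (0::real))"
    using powser_limit_0_strong[OF \<rho>, of "\<lambda>k. d (k + n)" "\<lambda>_. 0"] by blast
  from tendsto_unique[OF _ this tendsto_const] show ?case by simp
qed

text \<open>The device by which identities between generating functions yield identities between
  their coefficients. Only real r occur, so real and imaginary parts are treated as two real
  series.\<close>

lemma power_series_unique:
  fixes a b :: "nat \<Rightarrow> complex"
  assumes \<rho>: "0 < \<rho>" and a: "\<And>r. \<bar>r\<bar> < \<rho> \<Longrightarrow> (\<lambda>k. of_real (r ^ k) * a k) sums X r"
    and b: "\<And>r. \<bar>r\<bar> < \<rho> \<Longrightarrow> (\<lambda>k. of_real (r ^ k) * b k) sums X r"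
  shows "a n = b n"
proof -
  have d: "(\<lambda>k. of_real (r ^ k) * a k - of_real (r ^ k) * b k) sums 0" if "\<bar>r\<bar> < \<rho>" for r
    using sums_diff[OF a[OF that] b[OF that]] by simp
  have "Re (a n - b n) = 0"
  proof (rule power_series_zero_coeffs[OF \<rho>, of "\<lambda>n. Re (a n - b n)"])
    fix r :: real assume "\<bar>r\<bar> < \<rho>"
    from sums_Re[OF d[OF this]] show "(\<lambda>k. Re (a k - b k) * r ^ k) sums 0"
      by (simp add: algebra_simps del: of_real_power)
  qed
  moreover have "Im (a n - b n) = 0"
  proof (rule power_series_zero_coeffs[OF \<rho>, of "\<lambda>n. Im (a n - b n)"])
    fix r :: real assume "\<bar>r\<bar> < \<rho>"
    from sums_Im[OF d[OF this]] show "(\<lambda>k. Im (a k - b k) * r ^ k) sums 0"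
      by (simp add: algebra_simps del: of_real_power)
  qed
  ultimately show ?thesis by (simp add: complex_eq_iff)
qed

text \<open>The radius 1/16 is chosen against the growth 8^k: the terms are dominated by a geometric
  series of ratio 1/2 times E, so sum and integral may be exchanged.\<close>

lemma power_series_integral:
  fixes \<psi> :: "nat \<Rightarrow> 'a \<Rightarrow> complex"
  assumes [measurable]: "\<And>k. \<psi> k \<in> borel_measurable M" and E: "integrable M E"
    and bound: "\<And>k w. norm (\<psi> k w) \<le> 8 ^ k * E w"
    and r: "\<bar>r\<bar> < 1 / 16" and sums: "\<And>w. (\<lambda>k. of_real (r ^ k) * \<psi> k w) sums \<Psi> w"
  shows "(\<lambda>k. of_real (r ^ k) * (\<integral>w. \<psi> k w \<partial>M)) sums (\<integral>w. \<Psi> w \<partial>M)"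
proof -
  have E0: "0 \<le> E w" for w using bound[of 0 w] norm_ge_zero[of "\<psi> 0 w"] by (simp del: norm_ge_zero)
  have \<psi>: "integrable M (\<psi> k)" for k
    by (rule Bochner_Integration.integrable_bound[of M "\<lambda>w. 8 ^ k * E w"])
       (use E E0 bound in \<open>auto simp: abs_mult\<close>)
  have b2: "norm (of_real (r ^ k) * \<psi> k w) \<le> (1/2) ^ k * E w" for k w
  proof -
    have "norm (of_real (r ^ k) * \<psi> k w) \<le> \<bar>r\<bar> ^ k * (8 ^ k * E w)"
      using bound[of k w] by (auto simp: norm_mult norm_power intro!: mult_left_mono)
    also have "\<dots> = (8 * \<bar>r\<bar>) ^ k * E w" by (simp add: power_mult_distrib mult_ac)
    also have "\<dots> \<le> (1/2) ^ k * E w" using r E0 by (intro mult_right_mono power_mono) auto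
    finally show ?thesis .
  qed
  have "(\<lambda>k. \<integral>w. of_real (r ^ k) * \<psi> k w \<partial>M) sums (\<integral>w. (\<Sum>k. of_real (r ^ k) * \<psi> k w) \<partial>M)"
  proof (rule sums_integral)
    show "integrable M (\<lambda>w. of_real (r ^ k) * \<psi> k w)" for k using \<psi> by simp
    show "AE w in M. summable (\<lambda>k. norm (of_real (r ^ k) * \<psi> k w))"
    proof (rule AE_I2)
      fix w
      show "summable (\<lambda>k. norm (of_real (r ^ k) * \<psi> k w))"
        by (rule summable_comparison_test'[of "\<lambda>k. (1/2) ^ k * E w" 0])
           (use b2 in \<open>auto intro!: summable_mult2 summable_geometric simp del: of_real_power\<close>)
    qed
    show "summable (\<lambda>k. \<integral>w. norm (of_real (r ^ k) * \<psi> k w) \<partial>M)"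
    proof (rule summable_comparison_test'[of "\<lambda>k. (1/2) ^ k * (\<integral>w. E w \<partial>M)" 0])
      fix k
      have "(\<integral>w. norm (of_real (r ^ k) * \<psi> k w) \<partial>M) \<le> (\<integral>w. (1/2) ^ k * E w \<partial>M)"
        using \<psi> E b2 by (intro integral_mono) auto
      thus "norm (\<integral>w. norm (of_real (r ^ k) * \<psi> k w) \<partial>M) \<le> (1/2) ^ k * (\<integral>w. E w \<partial>M)"
        by simp
    qed (auto intro!: summable_mult2 summable_geometric)
  qed
  moreover have "(\<Sum>k. of_real (r ^ k) * \<psi> k w) = \<Psi> w" for w
    using sums[of w] by (simp add: sums_iff)
  ultimately show ?thesis by simp
qed

section \<open>Twisted convolution\<close>

text \<open>The symplectic form whose half is the central term of \<open>hmult\<close>. As a real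
  inner product, by \<open>symp_conv_inner\<close>, it becomes the phase of a Fourier
  integral.\<close>

definition symp :: "complex ^ 'n::finite \<Rightarrow> complex ^ 'n \<Rightarrow> real" where
  "symp z w = Im (\<Sum>i\<in>UNIV. z $ i * cnj (w $ i))"

lemma symp_conv_inner: "symp z w = z \<bullet> (\<chi> i. \<i> * w $ i)"
  by (simp add: symp_def inner_vec_def inner_complex_def algebra_simps)

lemma norm_i_times: "norm (\<chi> i. \<i> * w $ i) = norm (w :: complex ^ 'n::finite)"
  by (simp add: norm_vec_def norm_mult)

lemma symp_add_left: "symp (z + z') w = symp z w + symp z' w"
  and symp_scaleR_left: "symp (r *\<^sub>R z) w = r * symp z w"
  and symp_diff_left: "symp (z - z') w = symp z w - symp z' w"
  by (simp_all add: symp_conv_inner inner_add_left inner_diff_left)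

lemma symp_swap: "symp z w = - symp w z"
  by (simp add: symp_def sum_negf[symmetric] algebra_simps)

lemma symp_self: "symp z z = 0"
  using symp_swap[of z z] by simp

lemma symp_add_right: "symp w (z + z') = symp w z + symp w z'"
  using symp_add_left[of z z' w] symp_swap[of w] by simp

lemma symp_diff_right: "symp w (z - z') = symp w z - symp w z'"
  using symp_diff_left[of z z' w] symp_swap[of w] by simp

lemma symp_zero [simp]: "symp 0 w = 0" "symp w 0 = 0"
  by (simp_all add: symp_def)

lemma symp_meas [measurable (raw)]:
  fixes f g :: "'a \<Rightarrow> complex ^ 'n::finite"
  assumes [measurable]: "f \<in> borel_measurable M" "g \<in> borel_measurable M"
  shows "(\<lambda>x. symp (f x) (g x)) \<in> borel_measurable M"
proof -
  have "continuous_on UNIV (\<lambda>(z :: complex ^ 'n, w). symp z w)"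
    unfolding symp_def case_prod_unfold by (intro continuous_intros)
  hence "(\<lambda>(z :: complex ^ 'n, w). symp z w) \<in> borel_measurable (borel \<Otimes>\<^sub>M borel)"
    unfolding borel_prod by (rule borel_measurable_continuous_onI)
  from measurable_compose[OF measurable_Pair[OF assms] this] show ?thesis by simp
qed

text \<open>Written as a kernel in two points, so that twisted convolution becomes the composition
  of integral operators, hermitian for even g.\<close>

definition twist :: "real \<Rightarrow> (complex ^ 'n::finite \<Rightarrow> real) \<Rightarrow> complex ^ 'n \<Rightarrow> complex ^ 'n \<Rightarrow> complex" where
  "twist c g u w = of_real (g (u - w)) * cis (c * symp w u)"

lemma norm_twist: "norm (twist c g u w) = \<bar>g (u - w)\<bar>"
  by (simp add: twist_def norm_mult)

lemma cnj_twist: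
  assumes "\<And>z. g (- z) = g z"
  shows "cnj (twist c g u w) = twist c g w u"
  using assms[of "u - w"] symp_swap[of w u] by (simp add: twist_def cis_cnj)

lemma twist_meas [measurable (raw)]:
  assumes [measurable]: "g \<in> borel_measurable borel" "f \<in> borel_measurable M" "h \<in> borel_measurable M"
  shows "(\<lambda>x. twist c g (f x) (h x)) \<in> borel_measurable M"
  unfolding twist_def by measurable

lemma DIM_complex_vec: "DIM(complex ^ 'n::finite) = 2 * CARD('n)"
  by simp

text \<open>
  Completing the square reduces this to the Fourier transform of a Gaussian; the phase is
  unaffected by the translation since \<open>symp d d = 0\<close>.
\<close>
lemma twisted_convolution_gaussian:
  fixes u z :: "complex ^ 'n::finite"
  assumes \<alpha>: "0 < \<alpha>" and \<beta>: "0 < \<beta>"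
  shows "(\<integral>w. twist c (\<lambda>z. exp (- \<alpha> * (norm z)\<^sup>2)) u w * twist c (\<lambda>z. exp (- \<beta> * (norm z)\<^sup>2)) w z \<partial>lborel)
    = of_real ((pi / (\<alpha> + \<beta>)) ^ CARD('n)) * twist c (\<lambda>z. exp (- ((\<alpha> * \<beta> + c\<^sup>2 / 4) / (\<alpha> + \<beta>)) * (norm z)\<^sup>2)) u z"
proof -
  define s where "s = \<alpha> + \<beta>"
  have s: "0 < s" using \<alpha> \<beta> by (simp add: s_def)
  define d where "d = u - z"
  \<comment> \<open>The product of the two Gaussians in w is centred at z + t, the mean of u and z
    with weights \<alpha> and \<beta>.\<close>
  define t where "t = (\<alpha> / s) *\<^sub>R d"
  \<comment> \<open>The frequency: v \<bullet> J is c * symp v d, the part of the phase that depends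
    on v.\<close>
  define J where "J = c *\<^sub>R (\<chi> i. \<i> * d $ i)"
  have nJ: "(norm J)\<^sup>2 = c\<^sup>2 * (norm d)\<^sup>2"
    by (simp add: J_def norm_i_times power_mult_distrib)
  define A where "A = complex_of_real (exp (- (\<alpha> * \<beta> / s) * (norm d)\<^sup>2)) * cis (c * symp z u)"
  let ?F = "\<lambda>w. twist c (\<lambda>z. exp (- \<alpha> * (norm z)\<^sup>2)) u w * twist c (\<lambda>z. exp (- \<beta> * (norm z)\<^sup>2)) w z"
  have [measurable]: "?F \<in> borel_measurable borel" by measurable
  have eq: "?F ((z + t) + v) = A * (of_real (exp (- s * (norm v)\<^sup>2)) * cis (v \<bullet> J))" for v
  proof -
    have "- \<alpha> * (norm (u - ((z + t) + v)))\<^sup>2 + - \<beta> * (norm (((z + t) + v) - z))\<^sup>2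
      = - (\<alpha> * \<beta> / s) * (norm d)\<^sup>2 + - s * (norm v)\<^sup>2"
    proof -
      have e1: "u - ((z + t) + v) = (\<beta> / s) *\<^sub>R d - v"
      proof -
        have "d = (\<alpha> / s) *\<^sub>R d + (\<beta> / s) *\<^sub>R d"
          using s by (simp add: s_def add_divide_distrib[symmetric] flip: scaleR_left_distrib)
        thus ?thesis unfolding t_def d_def by (simp add: algebra_simps)
      qed
      have e2: "((z + t) + v) - z = (\<alpha> / s) *\<^sub>R d + v" by (simp add: t_def)
      have n1: "(norm ((\<beta> / s) *\<^sub>R d - v))\<^sup>2 = (\<beta> / s)\<^sup>2 * (norm d)\<^sup>2 - 2 * (\<beta> / s) * (d \<bullet> v) + (norm v)\<^sup>2"
        unfolding power2_norm_eq_inner by (simp add: inner_diff_left inner_diff_right inner_commute[of v d] power2_eq_square algebra_simps)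
      have n2: "(norm ((\<alpha> / s) *\<^sub>R d + v))\<^sup>2 = (\<alpha> / s)\<^sup>2 * (norm d)\<^sup>2 + 2 * (\<alpha> / s) * (d \<bullet> v) + (norm v)\<^sup>2"
        unfolding power2_norm_eq_inner by (simp add: inner_add_left inner_add_right inner_commute[of v d] power2_eq_square algebra_simps)
      have "\<alpha> * (\<beta> / s)\<^sup>2 + \<beta> * (\<alpha> / s)\<^sup>2 = \<alpha> * \<beta> * (\<alpha> + \<beta>) / s\<^sup>2"
        by (simp add: power2_eq_square add_divide_distrib algebra_simps)
      also have "\<dots> = \<alpha> * \<beta> / s" using s by (simp add: s_def[symmetric] power2_eq_square)
      finally have k: "\<alpha> * (\<beta> / s)\<^sup>2 + \<beta> * (\<alpha> / s)\<^sup>2 = \<alpha> * \<beta> / s" .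
      have "- \<alpha> * ((\<beta> / s)\<^sup>2 * (norm d)\<^sup>2 - 2 * (\<beta> / s) * (d \<bullet> v) + (norm v)\<^sup>2) + - \<beta> * ((\<alpha> / s)\<^sup>2 * (norm d)\<^sup>2 + 2 * (\<alpha> / s) * (d \<bullet> v) + (norm v)\<^sup>2)
        = - (\<alpha> * (\<beta> / s)\<^sup>2 + \<beta> * (\<alpha> / s)\<^sup>2) * (norm d)\<^sup>2 + - s * (norm v)\<^sup>2"
        by (simp add: s_def algebra_simps)
      thus ?thesis unfolding e1 e2 n1 n2 k .
    qed
    hence ex: "exp (- \<alpha> * (norm (u - ((z + t) + v)))\<^sup>2) * exp (- \<beta> * (norm (((z + t) + v) - z))\<^sup>2)
      = exp (- (\<alpha> * \<beta> / s) * (norm d)\<^sup>2) * exp (- s * (norm v)\<^sup>2)"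
      unfolding exp_add[symmetric] by simp
    have "symp ((z + t) + v) u + symp z ((z + t) + v) = symp z u + symp v d"
    proof -
      have "symp t u = symp t z"
      proof -
        have "symp t d = 0" by (simp add: t_def symp_scaleR_left symp_self)
        thus ?thesis by (simp add: d_def symp_diff_right)
      qed
      moreover have "symp z t = - symp t z" "symp z v = - symp v z" by (rule symp_swap)+
      ultimately show ?thesis
        by (simp add: symp_add_left symp_add_right symp_self d_def symp_diff_right)
    qed
    hence "c * symp ((z + t) + v) u + c * symp z ((z + t) + v) = c * symp z u + v \<bullet> J"
      unfolding J_def by (simp add: symp_conv_inner[of v d] distrib_left[symmetric])
    hence ci: "cis (c * symp ((z + t) + v) u) * cis (c * symp z ((z + t) + v)) = cis (c * symp z u) * cis (v \<bullet> J)"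
      unfolding cis_mult by simp
    have "?F ((z + t) + v) = complex_of_real (exp (- \<alpha> * (norm (u - ((z + t) + v)))\<^sup>2) * exp (- \<beta> * (norm (((z + t) + v) - z))\<^sup>2))
       * (cis (c * symp ((z + t) + v) u) * cis (c * symp z ((z + t) + v)))"
      unfolding twist_def of_real_mult by (simp only: mult_ac)
    also have "\<dots> = A * (of_real (exp (- s * (norm v)\<^sup>2)) * cis (v \<bullet> J))"
      unfolding ex ci A_def of_real_mult by (simp only: mult_ac)
    finally show ?thesis .
  qed
  have "(\<integral>w. ?F w \<partial>lborel) = (\<integral>v. ?F ((z + t) + v) \<partial>lborel)"
    by (rule lborel_integral_translate[symmetric]) measurable
  also have "\<dots> = A * (\<integral>v. of_real (exp (- s * (norm v)\<^sup>2)) * cis (v \<bullet> J) \<partial>lborel)"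
    unfolding eq by (rule integral_mult_right_zero)
  also have "\<dots> = A * of_real (sqrt (pi / s) ^ (2 * CARD('n)) * exp (- (norm J)\<^sup>2 / (4 * s)))"
    by (simp only: gaussian_fourier(2)[OF s] DIM_complex_vec)
  also have "sqrt (pi / s) ^ (2 * CARD('n)) = (pi / s) ^ CARD('n)"
    using s by (simp add: power_mult)
  also have "A * of_real ((pi / s) ^ CARD('n) * exp (- (norm J)\<^sup>2 / (4 * s)))
    = of_real ((pi / s) ^ CARD('n)) * (complex_of_real (exp (- (\<alpha> * \<beta> / s) * (norm d)\<^sup>2) * exp (- (norm J)\<^sup>2 / (4 * s))) * cis (c * symp z u))"
    unfolding A_def of_real_mult by (simp only: mult_ac)
  also have "exp (- (\<alpha> * \<beta> / s) * (norm d)\<^sup>2) * exp (- (norm J)\<^sup>2 / (4 * s)) = exp (- ((\<alpha> * \<beta> + c\<^sup>2 / 4) / s) * (norm d)\<^sup>2)"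
    unfolding nJ exp_add[symmetric] by (rule arg_cong[of _ _ exp]) (use s in \<open>simp add: field_simps\<close>)
  finally show ?thesis by (simp only: twist_def d_def s_def)
qed

section \<open>The functions \<open>phi\<close> and their Gaussian generating function\<close>

lemma phi_lag: "phi k l (z :: complex ^ 'n::finite) = lag (CARD('n) - 1) k (\<bar>l\<bar> * (norm z)\<^sup>2 / 2) * exp (- (1/4) * \<bar>l\<bar> * (norm z)\<^sup>2)"
proof -
  have "real CARD('n) - 1 = real (CARD('n) - 1)" by (simp add: of_nat_diff Suc_leI)
  thus ?thesis by (simp only: phi_def poly_laguerre_lag) simp
qed

lemma phi_uminus: "phi k l (- z) = phi k l z"
  by (simp add: phi_def)

lemma phi_zero: "phi k l (0 :: complex ^ 'n::finite) = real ((k + CARD('n) - 1) choose k)"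
  by (simp add: phi_lag lag_0 Suc_leI)

lemma phi_meas [measurable]: "phi k l \<in> borel_measurable borel"
  unfolding phi_lag lag_def by measurable

lemma abs_phi_le_gaussian:
  fixes z :: "complex ^ 'n::finite"
  shows "\<bar>phi k l z\<bar> \<le> 2 ^ (CARD('n) - 1) * 8 ^ k * exp (- (\<bar>l\<bar> / 8) * (norm z)\<^sup>2)"
proof -
  have "\<bar>phi k l z\<bar> \<le> 2 ^ (CARD('n) - 1) * 8 ^ k * exp (\<bar>l\<bar> * (norm z)\<^sup>2 / 2 / 4) * exp (- (1/4) * \<bar>l\<bar> * (norm z)\<^sup>2)"
    unfolding phi_lag abs_mult by (intro mult_mono abs_lag_le) auto
  also have "\<dots> = 2 ^ (CARD('n) - 1) * 8 ^ k * (exp (\<bar>l\<bar> * (norm z)\<^sup>2 / 2 / 4) * exp (- (1/4) * \<bar>l\<bar> * (norm z)\<^sup>2))"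
    by (simp only: mult.assoc)
  also have "exp (\<bar>l\<bar> * (norm z)\<^sup>2 / 2 / 4) * exp (- (1/4) * \<bar>l\<bar> * (norm z)\<^sup>2) = exp (- (\<bar>l\<bar> / 8) * (norm z)\<^sup>2)"
    unfolding exp_add[symmetric] by (rule arg_cong[of _ _ exp]) simp
  finally show ?thesis .
qed

text \<open>Mehler's kernel: the generating function of the \<open>phi k l\<close> in closed form.
  The parameter r enters the width through (1 + r) / (1 - r).\<close>

definition mehler :: "real \<Rightarrow> real \<Rightarrow> complex ^ 'n::finite \<Rightarrow> real" where
  "mehler l r z = 1 / (1 - r) ^ CARD('n) * exp (- (\<bar>l\<bar> / 4 * ((1 + r) / (1 - r))) * (norm z)\<^sup>2)"

lemma mehler_meas [measurable]: "mehler l r \<in> borel_measurable borel"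
  unfolding mehler_def by measurable

lemma phi_generating_function:
  fixes z :: "complex ^ 'n::finite"
  assumes r: "\<bar>r\<bar> < 1"
  shows "(\<lambda>k. r ^ k * phi k l z) sums mehler l r z"
proof -
  define x where "x = \<bar>l\<bar> * (norm z)\<^sup>2 / 2"
  have n: "CARD('n) - 1 + 1 = CARD('n)" by (simp add: Suc_leI)
  have "(\<lambda>k. r ^ k * lag (CARD('n) - 1) k x * exp (- (1/4) * \<bar>l\<bar> * (norm z)\<^sup>2))
    sums (1 / (1 - r) ^ CARD('n) * exp (- x * r / (1 - r)) * exp (- (1/4) * \<bar>l\<bar> * (norm z)\<^sup>2))"
    using laguerre_generating_function[OF r, of "CARD('n) - 1" x] unfolding n by (rule sums_mult2)
  also have "1 / (1 - r) ^ CARD('n) * exp (- x * r / (1 - r)) * exp (- (1/4) * \<bar>l\<bar> * (norm z)\<^sup>2) = mehler l r z"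
  proof -
    have "- x * r / (1 - r) + - (1/4) * \<bar>l\<bar> * (norm z)\<^sup>2 = - (\<bar>l\<bar> / 4 * ((1 + r) / (1 - r))) * (norm z)\<^sup>2"
      using r by (simp add: x_def divide_simps) (simp add: algebra_simps)
    thus ?thesis unfolding mehler_def mult.assoc exp_add[symmetric] by simp
  qed
  finally show ?thesis by (simp add: phi_lag x_def mult.assoc)
qed

lemma abs_mehler_le: "\<bar>r\<bar> < 1 \<Longrightarrow> \<bar>mehler l r (z :: complex ^ 'n::finite)\<bar> \<le> 1 / (1 - r) ^ CARD('n)"
proof -
  assume r: "\<bar>r\<bar> < 1"
  hence "0 \<le> \<bar>l\<bar> / 4 * ((1 + r) / (1 - r)) * (norm z)\<^sup>2" by (intro mult_nonneg_nonneg) auto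
  hence "exp (- (\<bar>l\<bar> / 4 * ((1 + r) / (1 - r))) * (norm z)\<^sup>2) \<le> 1" by simp
  hence "1 / (1 - r) ^ CARD('n) * exp (- (\<bar>l\<bar> / 4 * ((1 + r) / (1 - r))) * (norm z)\<^sup>2) \<le> 1 / (1 - r) ^ CARD('n) * 1"
    using r by (intro mult_left_mono) auto
  moreover have "0 \<le> mehler l r z" using r by (simp add: mehler_def)
  ultimately show ?thesis unfolding mehler_def by simp
qed

lemma twist_phi_generating_function:
  assumes r: "\<bar>r\<bar> < 1"
  shows "(\<lambda>k. of_real (r ^ k) * twist c (phi k l) u w) sums twist c (mehler l r) u w"
proof -
  have "(\<lambda>k. complex_of_real (r ^ k * phi k l (u - w))) sums of_real (mehler l r (u - w))"
    by (intro sums_of_real phi_generating_function r)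
  from sums_mult2[OF this, of "cis (c * symp w u)"] show ?thesis
    by (simp add: twist_def mult.assoc)
qed

text \<open>Put A = (1 + s) / (1 - s) and B = (1 + r) / (1 - r). Composing Gaussians with these
  parameters gives (A B + 1) / (A + B), which is (1 + s r) / (1 - s r): the map from r to (1 + r) /
  (1 - r) turns the composition rule into multiplication. The 1 in A B + 1 is exact because c = - l
  / 2 makes c^2 / 4 the square of |l| / 4.\<close>

lemma twisted_convolution_mehler:
  fixes u z :: "complex ^ 'n::finite"
  assumes l: "l \<noteq> 0" and s: "\<bar>s\<bar> < 1" and r: "\<bar>r\<bar> < 1"
  shows "(\<integral>w. twist (- l / 2) (mehler l s) u w * twist (- l / 2) (mehler l r) w z \<partial>lborel)
    = of_real ((2 * pi / \<bar>l\<bar>) ^ CARD('n)) * twist (- l / 2) (mehler l (s * r)) u z"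
proof -
  let ?c = "- l / 2"
  define \<alpha> where "\<alpha> = \<bar>l\<bar> / 4 * ((1 + s) / (1 - s))"
  define \<beta> where "\<beta> = \<bar>l\<bar> / 4 * ((1 + r) / (1 - r))"
  have pos: "0 < \<alpha>" "0 < \<beta>" using l s r by (auto simp: \<alpha>_def \<beta>_def)
  have sr: "\<bar>s * r\<bar> < 1" using s r by (metis abs_mult abs_ge_zero mult_strict_mono' mult_1_left)
  have nz: "1 - s \<noteq> 0" "1 - r \<noteq> 0" "1 - s * r \<noteq> 0" using s r sr by auto
  have sum: "\<alpha> + \<beta> = \<bar>l\<bar> * (1 - s * r) / (2 * ((1 - s) * (1 - r)))"
    using nz by (simp add: \<alpha>_def \<beta>_def divide_simps) (simp add: algebra_simps)
  have prod: "\<alpha> * \<beta> + ?c\<^sup>2 / 4 = \<bar>l\<bar>\<^sup>2 * (1 + s * r) / (8 * ((1 - s) * (1 - r)))"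
  proof -
    have "?c\<^sup>2 = \<bar>l\<bar>\<^sup>2 / 4" by (simp add: power_divide)
    thus ?thesis using nz by (simp add: \<alpha>_def \<beta>_def divide_simps power2_eq_square) (simp add: algebra_simps)
  qed
  have quot: "(\<alpha> * \<beta> + ?c\<^sup>2 / 4) / (\<alpha> + \<beta>) = \<bar>l\<bar> / 4 * ((1 + s * r) / (1 - s * r))"
  proof -
    have "L\<^sup>2 * (1 + s * r) / (8 * D) / (L * (1 - s * r) / (2 * D)) = L / 4 * ((1 + s * r) / (1 - s * r))"
      if "L \<noteq> 0" "D \<noteq> 0" for L D :: real
      using that nz by (simp add: divide_simps power2_eq_square) (simp add: algebra_simps)
    thus ?thesis unfolding sum prod using nz l by (metis abs_eq_0 mult_eq_0_iff)
  qed
  have tw: "twist ?c (mehler l x) a b = of_real (1 / (1 - x) ^ CARD('n)) * twist ?c (\<lambda>z. exp (- (\<bar>l\<bar> / 4 * ((1 + x) / (1 - x))) * (norm z)\<^sup>2)) a b"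
    for x and a b :: "complex ^ 'n"
    by (simp add: twist_def mehler_def mult.assoc)
  have "(\<integral>w. twist ?c (mehler l s) u w * twist ?c (mehler l r) w z \<partial>lborel)
    = (\<integral>w. of_real (1 / (1 - s) ^ CARD('n) * (1 / (1 - r) ^ CARD('n))) *
        (twist ?c (\<lambda>z. exp (- \<alpha> * (norm z)\<^sup>2)) u w * twist ?c (\<lambda>z. exp (- \<beta> * (norm z)\<^sup>2)) w z) \<partial>lborel)"
    unfolding tw \<alpha>_def \<beta>_def of_real_mult by (simp only: mult_ac)
  also have "\<dots> = of_real (1 / (1 - s) ^ CARD('n) * (1 / (1 - r) ^ CARD('n))) *
      (of_real ((pi / (\<alpha> + \<beta>)) ^ CARD('n)) * twist ?c (\<lambda>z. exp (- ((\<alpha> * \<beta> + ?c\<^sup>2 / 4) / (\<alpha> + \<beta>)) * (norm z)\<^sup>2)) u z)"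
    by (simp only: integral_mult_right_zero twisted_convolution_gaussian[OF pos])
  also have "\<dots> = of_real (1 / (1 - s) ^ CARD('n) * (1 / (1 - r) ^ CARD('n)) * (pi / (\<alpha> + \<beta>)) ^ CARD('n)) *
      twist ?c (\<lambda>z. exp (- (\<bar>l\<bar> / 4 * ((1 + s * r) / (1 - s * r))) * (norm z)\<^sup>2)) u z"
    unfolding quot of_real_mult by (simp only: mult.assoc)
  also have "1 / (1 - s) ^ CARD('n) * (1 / (1 - r) ^ CARD('n)) * (pi / (\<alpha> + \<beta>)) ^ CARD('n)
    = (2 * pi / \<bar>l\<bar>) ^ CARD('n) * (1 / (1 - s * r) ^ CARD('n))"
  proof -
    have "1 / (1 - s) * (1 / (1 - r)) * (pi / (\<alpha> + \<beta>)) = (2 * pi / \<bar>l\<bar>) * (1 / (1 - s * r))"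
      unfolding sum using nz l by (simp add: divide_simps)
    hence "(1 / (1 - s) * (1 / (1 - r)) * (pi / (\<alpha> + \<beta>))) ^ CARD('n) = ((2 * pi / \<bar>l\<bar>) * (1 / (1 - s * r))) ^ CARD('n)"
      by simp
    thus ?thesis by (simp only: power_mult_distrib power_one_over)
  qed
  finally show ?thesis unfolding tw[of "s * r"] of_real_mult by (simp only: mult.assoc)
qed

section \<open>Bessel's inequality for reproducing kernels\<close>

lemma borel_measurable_cnj [measurable (raw)]:
  "f \<in> borel_measurable M \<Longrightarrow> (\<lambda>x. cnj (f x)) \<in> borel_measurable M"
  by (rule measurable_compose[OF _ borel_measurable_continuous_onI]) (auto intro: continuous_intros)

lemma (in pair_sigma_finite) integrable_tensor:
  fixes f :: "'a \<Rightarrow> complex" and g :: "'b \<Rightarrow> complex"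
  assumes f: "integrable M1 f" and g: "integrable M2 g"
  shows "integrable (M1 \<Otimes>\<^sub>M M2) (\<lambda>(x, y). f x * g y)"
proof (rule Fubini_integrable)
  have [measurable]: "f \<in> borel_measurable M1" "g \<in> borel_measurable M2" using f g by auto
  show "(\<lambda>(x, y). f x * g y) \<in> borel_measurable (M1 \<Otimes>\<^sub>M M2)" by measurable
  show "integrable M1 (\<lambda>x. \<integral>y. norm (case (x, y) of (x, y) \<Rightarrow> f x * g y) \<partial>M2)"
    using f by (simp add: norm_mult)
  show "AE x in M1. integrable M2 (\<lambda>y. case (x, y) of (x, y) \<Rightarrow> f x * g y)"
    using g by simp
qed

text \<open>The bounds B and I may depend on k in any way: they justify Fubini's theorem, while the
  constant in \<open>bessel_inequality\<close> is c alone.\<close>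

locale reproducing_kernels = sigma_finite_measure M for M :: "'a measure" +
  fixes \<kappa> :: "nat \<Rightarrow> 'a \<Rightarrow> 'a \<Rightarrow> complex" and c :: real and B I :: "nat \<Rightarrow> real"
  assumes \<kappa>_meas [measurable]: "\<And>k. (\<lambda>(w, z). \<kappa> k w z) \<in> borel_measurable (M \<Otimes>\<^sub>M M)"
    and hermitian: "\<And>k w z. cnj (\<kappa> k w z) = \<kappa> k z w"
    and \<kappa>_bound: "\<And>k w z. norm (\<kappa> k w z) \<le> B k"
    and \<kappa>_L1: "\<And>k w. w \<in> space M \<Longrightarrow> (\<integral>\<^sup>+z. ennreal (norm (\<kappa> k w z)) \<partial>M) \<le> ennreal (I k)"
    and reproducing: "\<And>j k u z. u \<in> space M \<Longrightarrow> z \<in> space M \<Longrightarrow>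
      (\<integral>w. \<kappa> j u w * \<kappa> k w z \<partial>M) = (if j = k then of_real c * \<kappa> k u z else 0)"
    and c_pos: "0 < c"
begin

sublocale MM: pair_sigma_finite M M ..

definition P :: "nat \<Rightarrow> ('a \<Rightarrow> complex) \<Rightarrow> 'a \<Rightarrow> complex" where
  "P k g w = (\<integral>z. \<kappa> k w z * g z \<partial>M)"

lemma P_meas [measurable]:
  assumes [measurable]: "g \<in> borel_measurable M"
  shows "P k g \<in> borel_measurable M"
  unfolding P_def by measurable

lemma norm_\<kappa>_sym: "norm (\<kappa> k w z) = norm (\<kappa> k z w)"
  using hermitian[of k w z] by (metis complex_mod_cnj)

lemma \<kappa>_meas_snd: "w \<in> space M \<Longrightarrow> \<kappa> k w \<in> borel_measurable M"
  using measurable_compose[OF measurable_Pair1' \<kappa>_meas] by simp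

lemma B_nonneg: "0 \<le> B k"
  using \<kappa>_bound[of k undefined undefined] norm_ge_zero order_trans by blast

lemma integrable_\<kappa>_mult:
  assumes "integrable M g" "w \<in> space M"
  shows "integrable M (\<lambda>z. \<kappa> k w z * g z)"
proof (rule Bochner_Integration.integrable_bound[of M "\<lambda>z. B k * norm (g z)"])
  show "AE z in M. norm (\<kappa> k w z * g z) \<le> norm (B k * norm (g z))"
    using \<kappa>_bound B_nonneg[of k] by (auto simp: norm_mult intro!: mult_right_mono)
  show "(\<lambda>z. \<kappa> k w z * g z) \<in> borel_measurable M"
    using \<kappa>_meas_snd[OF assms(2)] assms(1) by measurable
qed (use assms in auto)

lemma integrable_pair:
  assumes g: "integrable M g"
  shows "integrable (M \<Otimes>\<^sub>M M) (\<lambda>(w, z). \<kappa> k w z * g z)"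
proof (rule integrableI_bounded)
  have [measurable]: "g \<in> borel_measurable M" using g by auto
  show "(\<lambda>(w, z). \<kappa> k w z * g z) \<in> borel_measurable (M \<Otimes>\<^sub>M M)" by measurable
  have "(\<integral>\<^sup>+p. ennreal (norm (case p of (w, z) \<Rightarrow> \<kappa> k w z * g z)) \<partial>(M \<Otimes>\<^sub>M M))
    = (\<integral>\<^sup>+z. (\<integral>\<^sup>+w. ennreal (norm (\<kappa> k w z * g z)) \<partial>M) \<partial>M)"
    by (subst MM.nn_integral_snd[symmetric]) auto
  also have "\<dots> \<le> (\<integral>\<^sup>+z. ennreal (I k) * ennreal (norm (g z)) \<partial>M)"
  proof (rule nn_integral_mono)
    fix z assume z: "z \<in> space M"
    note [measurable] = \<kappa>_meas_snd[OF z]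
    have "(\<integral>\<^sup>+w. ennreal (norm (\<kappa> k w z * g z)) \<partial>M) = (\<integral>\<^sup>+w. ennreal (norm (\<kappa> k z w)) * ennreal (norm (g z)) \<partial>M)"
      by (intro nn_integral_cong) (simp add: norm_mult ennreal_mult norm_\<kappa>_sym[of k _ z])
    also have "\<dots> = (\<integral>\<^sup>+w. ennreal (norm (\<kappa> k z w)) \<partial>M) * ennreal (norm (g z))"
      by (intro nn_integral_multc) measurable
    also have "\<dots> \<le> ennreal (I k) * ennreal (norm (g z))"
      using \<kappa>_L1[OF z] by (rule mult_right_mono) simp
    finally show "(\<integral>\<^sup>+w. ennreal (norm (\<kappa> k w z * g z)) \<partial>M) \<le> ennreal (I k) * ennreal (norm (g z))" .
  qed
  also have "\<dots> = ennreal (I k) * (\<integral>\<^sup>+z. ennreal (norm (g z)) \<partial>M)"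
    by (rule nn_integral_cmult) measurable
  also have "\<dots> < \<infinity>" using g by (simp add: integrable_iff_bounded ennreal_mult_less_top)
  finally show "(\<integral>\<^sup>+p. ennreal (norm (case p of (w, z) \<Rightarrow> \<kappa> k w z * g z)) \<partial>(M \<Otimes>\<^sub>M M)) < \<infinity>" .
qed

lemma integrable_P:
  assumes "integrable M g"
  shows "integrable M (P k g)"
  using MM.integrable_fst[OF integrable_pair[OF assms, of k]] by (simp add: P_def[abs_def])

lemma P_bound:
  assumes "integrable M g" "w \<in> space M"
  shows "norm (P k g w) \<le> B k * (\<integral>z. norm (g z) \<partial>M)"
proof -
  have "norm (P k g w) \<le> (\<integral>z. norm (\<kappa> k w z * g z) \<partial>M)"
    unfolding P_def by (rule integral_norm_bound)
  also have "\<dots> \<le> (\<integral>z. B k * norm (g z) \<partial>M)"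
    using integrable_norm[OF integrable_\<kappa>_mult[OF assms]] assms \<kappa>_bound
    by (intro integral_mono) (auto simp: norm_mult intro!: mult_right_mono)
  finally show ?thesis by simp
qed

text \<open>A bounded kernel makes P k g bounded, so all inner products below converge absolutely
  for functions that are merely integrable.\<close>

lemma integrable_P_mult:
  assumes g: "integrable M g" and h: "integrable M h"
  shows "integrable M (\<lambda>w. P k g w * h w)"
proof (rule Bochner_Integration.integrable_bound[of M "\<lambda>w. (B k * (\<integral>z. norm (g z) \<partial>M)) * norm (h w)"])
  show "AE w in M. norm (P k g w * h w) \<le> norm ((B k * (\<integral>z. norm (g z) \<partial>M)) * norm (h w))"
  proof (rule AE_I2)
    fix w assume "w \<in> space M"
    from P_bound[OF g this, of k]
    have "norm (P k g w * h w) \<le> (B k * (\<integral>z. norm (g z) \<partial>M)) * norm (h w)"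
      unfolding norm_mult by (rule mult_right_mono) simp
    thus "norm (P k g w * h w) \<le> norm ((B k * (\<integral>z. norm (g z) \<partial>M)) * norm (h w))"
      by (simp only: real_norm_def abs_of_nonneg[OF order_trans[OF norm_ge_zero]])
  qed
  have [measurable]: "g \<in> borel_measurable M" "h \<in> borel_measurable M" using g h by auto
  show "(\<lambda>w. P k g w * h w) \<in> borel_measurable M" by measurable
qed (use h in auto)

lemma P_P:
  assumes g: "integrable M g" and u: "u \<in> space M"
  shows "P j (P k g) u = (if j = k then of_real c * P k g u else 0)"
proof -
  have [measurable]: "g \<in> borel_measurable M" using g by auto
  note [measurable] = \<kappa>_meas_snd[OF u]
  have int: "integrable (M \<Otimes>\<^sub>M M) (\<lambda>(w, z). \<kappa> j u w * (\<kappa> k w z * g z))"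
  proof (rule Bochner_Integration.integrable_bound[of _ "\<lambda>p. B j * norm (case p of (w, z) \<Rightarrow> \<kappa> k w z * g z)"])
    show "integrable (M \<Otimes>\<^sub>M M) (\<lambda>p. B j * norm (case p of (w, z) \<Rightarrow> \<kappa> k w z * g z))"
      by (intro integrable_mult_right integrable_norm integrable_pair g)
    show "AE p in M \<Otimes>\<^sub>M M. norm (case p of (w, z) \<Rightarrow> \<kappa> j u w * (\<kappa> k w z * g z)) \<le> norm (B j * norm (case p of (w, z) \<Rightarrow> \<kappa> k w z * g z))"
      using \<kappa>_bound[of j] B_nonneg[of j]
      by (auto simp: norm_mult abs_mult split: prod.split intro!: AE_I2 mult_right_mono)
  qed measurable
  have "P j (P k g) u = (\<integral>w. (\<integral>z. \<kappa> j u w * (\<kappa> k w z * g z) \<partial>M) \<partial>M)"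
    unfolding P_def by (simp only: integral_mult_right_zero)
  also have "\<dots> = (\<integral>z. (\<integral>w. \<kappa> j u w * (\<kappa> k w z * g z) \<partial>M) \<partial>M)"
    using MM.Fubini_integral[of "\<lambda>w z. \<kappa> j u w * (\<kappa> k w z * g z)"] int by simp
  also have "\<dots> = (\<integral>z. (\<integral>w. \<kappa> j u w * \<kappa> k w z \<partial>M) * g z \<partial>M)"
    unfolding mult.assoc[symmetric] by (simp only: integral_mult_left_zero)
  also have "\<dots> = (\<integral>z. (if j = k then of_real c * \<kappa> k u z else 0) * g z \<partial>M)"
    by (intro Bochner_Integration.integral_cong) (simp_all add: reproducing u)
  also have "\<dots> = (if j = k then of_real c * P k g u else 0)"
    by (simp add: P_def mult.assoc)
  finally show ?thesis .
qed

text \<open>Self-adjointness, by Fubini's theorem and the hermitian symmetry of the kernel;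
  boundedness of the kernel and integrability of f and h dominate the double integral.\<close>

lemma P_adjoint:
  assumes f: "integrable M f" and h: "integrable M h"
  shows "(\<integral>w. f w * cnj (P j h w) \<partial>M) = (\<integral>u. P j f u * cnj (h u) \<partial>M)"
proof -
  have [measurable]: "f \<in> borel_measurable M" "h \<in> borel_measurable M" using f h by auto
  have fh: "integrable (M \<Otimes>\<^sub>M M) (\<lambda>(w, u). f w * cnj (h u))"
    by (rule MM.integrable_tensor[OF f]) (use h in simp)
  have int: "integrable (M \<Otimes>\<^sub>M M) (\<lambda>(w, u). \<kappa> j u w * f w * cnj (h u))"
  proof (rule Bochner_Integration.integrable_bound[of _ "\<lambda>p. B j * norm (case p of (w, u) \<Rightarrow> f w * cnj (h u))"])
    show "integrable (M \<Otimes>\<^sub>M M) (\<lambda>p. B j * norm (case p of (w, u) \<Rightarrow> f w * cnj (h u)))"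
      by (intro integrable_mult_right integrable_norm fh)
    show "AE p in M \<Otimes>\<^sub>M M. norm (case p of (w, u) \<Rightarrow> \<kappa> j u w * f w * cnj (h u)) \<le> norm (B j * norm (case p of (w, u) \<Rightarrow> f w * cnj (h u)))"
      using \<kappa>_bound[of j] B_nonneg[of j]
      by (auto simp: norm_mult abs_mult mult.assoc split: prod.split intro!: AE_I2 mult_right_mono)
  qed measurable
  have "(\<integral>w. f w * cnj (P j h w) \<partial>M) = (\<integral>w. (\<integral>u. \<kappa> j u w * f w * cnj (h u) \<partial>M) \<partial>M)"
  proof (intro Bochner_Integration.integral_cong refl)
    fix w assume w: "w \<in> space M"
    have "f w * cnj (P j h w) = f w * (\<integral>u. cnj (\<kappa> j w u * h u) \<partial>M)"
      unfolding P_def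
      using integral_bounded_linear[OF bounded_linear_cnj integrable_\<kappa>_mult[OF h w, of j]] by simp
    also have "\<dots> = (\<integral>u. f w * cnj (\<kappa> j w u * h u) \<partial>M)" by simp
    also have "\<dots> = (\<integral>u. \<kappa> j u w * f w * cnj (h u) \<partial>M)"
      by (intro Bochner_Integration.integral_cong) (simp_all add: hermitian mult_ac)
    finally show "f w * cnj (P j h w) = (\<integral>u. \<kappa> j u w * f w * cnj (h u) \<partial>M)" .
  qed
  also have "\<dots> = (\<integral>u. (\<integral>w. \<kappa> j u w * f w * cnj (h u) \<partial>M) \<partial>M)"
    using MM.Fubini_integral[of "\<lambda>w u. \<kappa> j u w * f w * cnj (h u)"] int by simp
  also have "\<dots> = (\<integral>u. P j f u * cnj (h u) \<partial>M)"
    unfolding P_def by (simp only: integral_mult_left_zero)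
  finally show ?thesis .
qed

text \<open>
  The \<open>P k / c\<close> are orthogonal projections; with \<open>S\<close> the sum of the \<open>P k g\<close> this is
  \<open>\<bar>S - c g\<bar>\<^sup>2 \<ge> 0\<close> integrated.
\<close>
theorem bessel_inequality:
  assumes g: "integrable M g"
  shows "(\<Sum>k<N. \<integral>\<^sup>+w. ennreal (norm (P k g w) ^ 2) \<partial>M) \<le> ennreal (c\<^sup>2) * (\<integral>\<^sup>+w. ennreal (norm (g w) ^ 2) \<partial>M)"
proof (cases "(\<integral>\<^sup>+w. ennreal (norm (g w) ^ 2) \<partial>M) = \<infinity>")
  case True
  thus ?thesis using c_pos by (simp add: ennreal_mult_top)
next
  case False
  have [measurable]: "g \<in> borel_measurable M" using g by auto
  have g2: "integrable M (\<lambda>w. norm (g w) ^ 2)"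
    using False by (intro integrableI_nonneg) (auto simp: top.not_eq_extremum)
  have cPg: "integrable M (\<lambda>w. cnj (P k g w))" "integrable M (\<lambda>w. cnj (g w))" for k
    using integrable_P[OF g] g by simp_all
  have PPint: "integrable M (\<lambda>w. P k g w * cnj (P j g w))" "integrable M (\<lambda>w. P k g w * cnj (g w))" for j k
    by (intro integrable_P_mult[OF g] cPg)+
  have inner: "(\<integral>w. P k g w * cnj (P j g w) \<partial>M) = (if j = k then of_real c * (\<integral>w. P k g w * cnj (g w) \<partial>M) else 0)" for j k
  proof -
    have "(\<integral>w. P k g w * cnj (P j g w) \<partial>M) = (\<integral>u. P j (P k g) u * cnj (g u) \<partial>M)"
      by (rule P_adjoint[OF integrable_P[OF g] g])
    also have "\<dots> = (\<integral>u. (if j = k then of_real c * P k g u else 0) * cnj (g u) \<partial>M)"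
      by (intro Bochner_Integration.integral_cong) (simp_all add: P_P[OF g])
    finally show ?thesis by (simp add: mult.assoc)
  qed
  define S where "S w = (\<Sum>k<N. P k g w)" for w
  define A where "A = (\<Sum>k<N. \<integral>w. norm (P k g w) ^ 2 \<partial>M)"
  have Sg: "integrable M (\<lambda>w. S w * cnj (g w))"
    unfolding S_def sum_distrib_right by (intro Bochner_Integration.integrable_sum PPint)
  have SS: "integrable M (\<lambda>w. S w * cnj (S w))"
    unfolding S_def cnj_sum sum_product by (intro Bochner_Integration.integrable_sum PPint)
  have nsq: "of_real (norm z ^ 2) = z * cnj z" for z :: complex
    by (rule complex_norm_square)
  have Pk: "of_real (\<integral>w. norm (P k g w) ^ 2 \<partial>M) = of_real c * (\<integral>w. P k g w * cnj (g w) \<partial>M)" for k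
    unfolding integral_complex_of_real[symmetric] nsq using inner[of k k] by simp
  \<comment> \<open>By \<open>A1\<close> and \<open>A2\<close> the number A is both c times the
    inner product of S with g and the squared norm of S. Expanding the square of S - c g then gives
    A - 2 A plus c^2 times the squared norm of g.\<close>
  have A1: "of_real A = of_real c * (\<integral>w. S w * cnj (g w) \<partial>M)"
    unfolding A_def of_real_sum Pk S_def sum_distrib_right
    by (subst Bochner_Integration.integral_sum[OF PPint(2)]) (simp add: sum_distrib_left)
  have A2: "of_real A = (\<integral>w. S w * cnj (S w) \<partial>M)"
  proof -
    have "(\<integral>w. S w * cnj (S w) \<partial>M) = (\<Sum>k<N. \<Sum>j<N. \<integral>w. P k g w * cnj (P j g w) \<partial>M)"
      unfolding S_def cnj_sum sum_product
      by (simp add: Bochner_Integration.integral_sum Bochner_Integration.integrable_sum PPint)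
    also have "\<dots> = (\<Sum>k<N. of_real c * (\<integral>w. P k g w * cnj (g w) \<partial>M))"
      unfolding inner by (intro sum.cong refl) (simp add: sum.delta)
    also have "\<dots> = of_real A" unfolding A_def of_real_sum Pk ..
    finally show ?thesis ..
  qed
  have S2: "integrable M (\<lambda>w. norm (S w) ^ 2)" "(\<integral>w. norm (S w) ^ 2 \<partial>M) = A"
  proof -
    have "integrable M (\<lambda>w. complex_of_real (norm (S w) ^ 2))" unfolding nsq by (rule SS)
    thus "integrable M (\<lambda>w. norm (S w) ^ 2)" by (simp only: complex_of_real_integrable_eq)
    have "complex_of_real (\<integral>w. norm (S w) ^ 2 \<partial>M) = of_real A"
      unfolding integral_complex_of_real[symmetric] nsq A2 ..
    thus "(\<integral>w. norm (S w) ^ 2 \<partial>M) = A" by (simp only: of_real_eq_iff)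
  qed
  have "2 * A = (\<integral>w. 2 * c * Re (S w * cnj (g w)) \<partial>M)"
  proof -
    have "A = Re (of_real c * (\<integral>w. S w * cnj (g w) \<partial>M))" using A1 by (metis Re_complex_of_real)
    also have "\<dots> = c * (\<integral>w. Re (S w * cnj (g w)) \<partial>M)"
      using integral_Re[OF Sg] by simp
    finally show ?thesis by simp
  qed
  also have "\<dots> \<le> (\<integral>w. norm (S w) ^ 2 + c\<^sup>2 * norm (g w) ^ 2 \<partial>M)"
  proof (rule integral_mono)
    show "integrable M (\<lambda>w. 2 * c * Re (S w * cnj (g w)))"
      by (intro integrable_mult_right integrable_Re Sg)
    show "integrable M (\<lambda>w. norm (S w) ^ 2 + c\<^sup>2 * norm (g w) ^ 2)"
      using S2 g2 by simp
    fix w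
    have "Re (S w * cnj (g w)) \<le> norm (S w) * norm (g w)"
      using complex_Re_le_cmod[of "S w * cnj (g w)"] by (simp add: norm_mult)
    hence "2 * c * Re (S w * cnj (g w)) \<le> 2 * c * (norm (S w) * norm (g w))"
      using c_pos by (intro mult_left_mono) auto
    also have "\<dots> \<le> norm (S w) ^ 2 + c\<^sup>2 * norm (g w) ^ 2"
      using sum_squares_bound[of "norm (S w)" "c * norm (g w)"] by (simp add: power_mult_distrib mult_ac)
    finally show "2 * c * Re (S w * cnj (g w)) \<le> norm (S w) ^ 2 + c\<^sup>2 * norm (g w) ^ 2" .
  qed
  also have "\<dots> = A + c\<^sup>2 * (\<integral>w. norm (g w) ^ 2 \<partial>M)"
    using S2 g2 by simp
  finally have "A \<le> c\<^sup>2 * (\<integral>w. norm (g w) ^ 2 \<partial>M)" by simp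
  hence "ennreal A \<le> ennreal (c\<^sup>2) * ennreal (\<integral>w. norm (g w) ^ 2 \<partial>M)"
    by (subst ennreal_mult[symmetric]) (auto intro: ennreal_leI)
  moreover have "ennreal A = (\<Sum>k<N. \<integral>\<^sup>+w. ennreal (norm (P k g w) ^ 2) \<partial>M)"
  proof -
    have int: "integrable M (\<lambda>w. norm (P k g w) ^ 2)" for k
    proof -
      have "integrable M (\<lambda>w. complex_of_real (norm (P k g w) ^ 2))" unfolding nsq by (rule PPint)
      thus ?thesis by (simp only: complex_of_real_integrable_eq)
    qed
    have "(\<Sum>k<N. \<integral>\<^sup>+w. ennreal (norm (P k g w) ^ 2) \<partial>M) = (\<Sum>k<N. ennreal (\<integral>w. norm (P k g w) ^ 2 \<partial>M))"
      by (intro sum.cong refl nn_integral_eq_integral int) auto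
    also have "\<dots> = ennreal A" unfolding A_def by (rule sum_ennreal) simp
    finally show ?thesis ..
  qed
  moreover have "ennreal (\<integral>w. norm (g w) ^ 2 \<partial>M) = (\<integral>\<^sup>+w. ennreal (norm (g w) ^ 2) \<partial>M)"
    by (rule nn_integral_eq_integral[symmetric, OF g2]) auto
  ultimately show ?thesis by simp
qed

end

section \<open>Orthogonality and size of the \<open>phi k l\<close>\<close>

text \<open>The coefficient of s^j in \<open>twisted_convolution_mehler\<close>: on the right,
  \<open>mehler l (s * r)\<close> expands in powers of s * r.\<close>

lemma twisted_convolution_phi_mehler:
  fixes u z :: "complex ^ 'n::finite"
  assumes l: "l \<noteq> 0" and r: "\<bar>r\<bar> < 1 / 16"
  shows "(\<integral>w. twist (- l / 2) (phi j l) u w * twist (- l / 2) (mehler l r) w z \<partial>lborel)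
    = of_real ((2 * pi / \<bar>l\<bar>) ^ CARD('n) * r ^ j) * twist (- l / 2) (phi j l) u z"
proof (rule power_series_unique[where \<rho> = "1 / 16"])
  let ?c = "- l / 2"
  fix s :: real assume s: "\<bar>s\<bar> < 1 / 16"
  have s1: "\<bar>s\<bar> < 1" and r1: "\<bar>r\<bar> < 1" using s r by auto
  have sr: "\<bar>s * r\<bar> < 1" using s1 r1 by (metis abs_mult abs_ge_zero mult_strict_mono' mult_1_left)
  define b where "b = 1 / (1 - r) ^ CARD('n)"
  have b: "0 \<le> b" using r by (simp add: b_def)
  show "(\<lambda>k. of_real (s ^ k) * (\<integral>w. twist ?c (phi k l) u w * twist ?c (mehler l r) w z \<partial>lborel))
    sums (\<integral>w. twist ?c (mehler l s) u w * twist ?c (mehler l r) w z \<partial>lborel)"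
  proof (rule power_series_integral[OF _ _ _ s])
    show "integrable lborel (\<lambda>w. 2 ^ (CARD('n) - 1) * exp (- (\<bar>l\<bar> / 8) * (norm (w - u))\<^sup>2) * b)"
      by (intro integrable_mult_left integrable_mult_right integrable_gaussian) (use l in simp)
    show "norm (twist ?c (phi k l) u w * twist ?c (mehler l r) w z)
      \<le> 8 ^ k * (2 ^ (CARD('n) - 1) * exp (- (\<bar>l\<bar> / 8) * (norm (w - u))\<^sup>2) * b)" for k w
    proof -
      have "norm (twist ?c (phi k l) u w * twist ?c (mehler l r) w z)
        \<le> (2 ^ (CARD('n) - 1) * 8 ^ k * exp (- (\<bar>l\<bar> / 8) * (norm (u - w))\<^sup>2)) * b"
        unfolding norm_mult norm_twist b_def
        by (intro mult_mono abs_phi_le_gaussian abs_mehler_le r1) auto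
      thus ?thesis unfolding norm_minus_commute[of w u] by (simp only: mult_ac)
    qed
    show "(\<lambda>k. of_real (s ^ k) * (twist ?c (phi k l) u w * twist ?c (mehler l r) w z))
      sums (twist ?c (mehler l s) u w * twist ?c (mehler l r) w z)" for w
      using sums_mult2[OF twist_phi_generating_function[OF s1], of ?c l u w] by (simp add: mult.assoc)
  qed measurable
  have "(\<lambda>k. of_real ((2 * pi / \<bar>l\<bar>) ^ CARD('n)) * (of_real ((s * r) ^ k) * twist ?c (phi k l) u z))
    sums (of_real ((2 * pi / \<bar>l\<bar>) ^ CARD('n)) * twist ?c (mehler l (s * r)) u z)"
    by (intro sums_mult twist_phi_generating_function sr)
  also have "of_real ((2 * pi / \<bar>l\<bar>) ^ CARD('n)) * twist ?c (mehler l (s * r)) u z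
    = (\<integral>w. twist ?c (mehler l s) u w * twist ?c (mehler l r) w z \<partial>lborel)"
    by (rule twisted_convolution_mehler[OF l s1 r1, symmetric])
  finally show "(\<lambda>k. of_real (s ^ k) * (of_real ((2 * pi / \<bar>l\<bar>) ^ CARD('n) * r ^ k) * twist ?c (phi k l) u z))
    sums (\<integral>w. twist ?c (mehler l s) u w * twist ?c (mehler l r) w z \<partial>lborel)"
    unfolding of_real_mult power_mult_distrib by (simp only: mult_ac)
qed simp

text \<open>The coefficient of r^k in \<open>twisted_convolution_phi_mehler\<close>. As a power
  series in r the right side is a single monomial of degree j, so every coefficient with k \<noteq>
  j vanishes; this is the orthogonality.\<close>

lemma phi_reproducing:
  fixes u z :: "complex ^ 'n::finite"
  assumes l: "l \<noteq> 0"
  shows "(\<integral>w. twist (- l / 2) (phi j l) u w * twist (- l / 2) (phi k l) w z \<partial>lborel)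
    = (if j = k then of_real ((2 * pi / \<bar>l\<bar>) ^ CARD('n)) * twist (- l / 2) (phi k l) u z else 0)"
proof (rule power_series_unique[where \<rho> = "1 / 16" and n = k])
  let ?c = "- l / 2"
  fix r :: real assume r: "\<bar>r\<bar> < 1 / 16"
  have r1: "\<bar>r\<bar> < 1" using r by auto
  define b where "b = 2 ^ (CARD('n) - 1) * (8::real) ^ j"
  have j_le: "norm (twist ?c (phi j l) u w) \<le> b" for w
  proof -
    have "norm (twist ?c (phi j l) u w) \<le> b * exp (- (\<bar>l\<bar> / 8) * (norm (u - w))\<^sup>2)"
      unfolding norm_twist b_def by (rule abs_phi_le_gaussian)
    also have "\<dots> \<le> b * 1" by (intro mult_left_mono) (auto simp: b_def)
    finally show ?thesis by simp
  qed
  show "(\<lambda>k. of_real (r ^ k) * (\<integral>w. twist ?c (phi j l) u w * twist ?c (phi k l) w z \<partial>lborel))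
    sums (\<integral>w. twist ?c (phi j l) u w * twist ?c (mehler l r) w z \<partial>lborel)"
  proof (rule power_series_integral[OF _ _ _ r])
    show "integrable lborel (\<lambda>w. b * (2 ^ (CARD('n) - 1) * exp (- (\<bar>l\<bar> / 8) * (norm (w - z))\<^sup>2)))"
      by (intro integrable_mult_right integrable_gaussian) (use l in simp)
    show "norm (twist ?c (phi j l) u w * twist ?c (phi k l) w z)
      \<le> 8 ^ k * (b * (2 ^ (CARD('n) - 1) * exp (- (\<bar>l\<bar> / 8) * (norm (w - z))\<^sup>2)))" for k w
    proof -
      have "norm (twist ?c (phi j l) u w * twist ?c (phi k l) w z)
        \<le> b * (2 ^ (CARD('n) - 1) * 8 ^ k * exp (- (\<bar>l\<bar> / 8) * (norm (w - z))\<^sup>2))"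
        unfolding norm_mult
        by (intro mult_mono j_le) (auto simp: norm_twist b_def intro: abs_phi_le_gaussian[simplified])
      thus ?thesis by (simp only: mult_ac)
    qed
    show "(\<lambda>k. of_real (r ^ k) * (twist ?c (phi j l) u w * twist ?c (phi k l) w z))
      sums (twist ?c (phi j l) u w * twist ?c (mehler l r) w z)" for w
      using sums_mult[OF twist_phi_generating_function[OF r1, of ?c l w z], of "twist ?c (phi j l) u w"]
      by (simp only: mult_ac)
  qed measurable
  have "(\<lambda>k. if k = j then of_real (r ^ j) * (of_real ((2 * pi / \<bar>l\<bar>) ^ CARD('n)) * twist ?c (phi j l) u z) else 0)
    sums (of_real (r ^ j) * (of_real ((2 * pi / \<bar>l\<bar>) ^ CARD('n)) * twist ?c (phi j l) u z))"
    by (rule sums_single)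
  moreover have "of_real (r ^ j) * (of_real ((2 * pi / \<bar>l\<bar>) ^ CARD('n)) * twist ?c (phi j l) u z)
    = (\<integral>w. twist ?c (phi j l) u w * twist ?c (mehler l r) w z \<partial>lborel)"
    unfolding twisted_convolution_phi_mehler[OF l r] of_real_mult by (simp only: mult_ac)
  moreover have "(\<lambda>k. if k = j then of_real (r ^ j) * (of_real ((2 * pi / \<bar>l\<bar>) ^ CARD('n)) * twist ?c (phi j l) u z) else 0)
    = (\<lambda>k. of_real (r ^ k) * (if j = k then of_real ((2 * pi / \<bar>l\<bar>) ^ CARD('n)) * twist ?c (phi k l) u z else 0))"
    by (auto simp: fun_eq_iff)
  ultimately show "(\<lambda>k. of_real (r ^ k) * (if j = k then of_real ((2 * pi / \<bar>l\<bar>) ^ CARD('n)) * twist ?c (phi k l) u z else 0))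
    sums (\<integral>w. twist ?c (phi j l) u w * twist ?c (mehler l r) w z \<partial>lborel)" by (simp only:)
qed simp

lemma integrable_phi:
  fixes z :: "complex ^ 'n::finite"
  assumes l: "l \<noteq> 0"
  shows "integrable lborel (\<lambda>w. phi k l (w - z))" "integrable lborel (\<lambda>w. (phi k l (w - z))\<^sup>2)"
proof -
  define b where "b = 2 ^ (CARD('n) - 1) * (8::real) ^ k"
  have b: "0 \<le> b" by (simp add: b_def)
  let ?e = "\<lambda>w. exp (- (\<bar>l\<bar> / 8) * (norm (w - z))\<^sup>2)"
  have le: "\<bar>phi k l (w - z)\<bar> \<le> b * ?e w" for w
    unfolding b_def by (rule abs_phi_le_gaussian)
  have e: "integrable lborel ?e" by (rule integrable_gaussian) (use l in simp)
  show i: "integrable lborel (\<lambda>w. phi k l (w - z))"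
  proof (rule Bochner_Integration.integrable_bound[of _ "\<lambda>w. b * ?e w"])
    show "AE w in lborel. norm (phi k l (w - z)) \<le> norm (b * ?e w)"
      using le b by (auto simp: abs_mult)
  qed (use e in simp_all)
  show "integrable lborel (\<lambda>w. (phi k l (w - z))\<^sup>2)"
  proof (rule Bochner_Integration.integrable_bound[of _ "\<lambda>w. b * \<bar>phi k l (w - z)\<bar>"])
    show "AE w in lborel. norm ((phi k l (w - z))\<^sup>2) \<le> norm (b * \<bar>phi k l (w - z)\<bar>)"
    proof (rule AE_I2)
      fix w
      have "\<bar>phi k l (w - z)\<bar> \<le> b * ?e w" by (rule le)
      also have "\<dots> \<le> b * 1" using b by (intro mult_left_mono) auto
      finally have "\<bar>phi k l (w - z)\<bar> * \<bar>phi k l (w - z)\<bar> \<le> b * \<bar>phi k l (w - z)\<bar>"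
        by (intro mult_right_mono) auto
      thus "norm ((phi k l (w - z))\<^sup>2) \<le> norm (b * \<bar>phi k l (w - z)\<bar>)"
        using b by (simp add: power2_eq_square abs_mult)
    qed
  qed (use i in simp_all)
qed

text \<open>
  The Cauchy--Schwarz bound for a reproducing kernel: it is largest on the diagonal.
\<close>
lemma abs_phi_le_nonzero:
  fixes z :: "complex ^ 'n::finite"
  assumes l: "l \<noteq> 0"
  shows "\<bar>phi k l z\<bar> \<le> phi k l (0 :: complex ^ 'n)"
proof -
  let ?c = "- l / 2"
  define C where "C = (2 * pi / \<bar>l\<bar>) ^ CARD('n)"
  have C: "0 < C" using l by (simp add: C_def)
  have sq: "(\<integral>w. (phi k l (w - v))\<^sup>2 \<partial>lborel) = (\<integral>w. (phi k l (w :: complex ^ 'n))\<^sup>2 \<partial>lborel)" for v :: "complex ^ 'n"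
    using lborel_integral_translate[of "\<lambda>w. (phi k l (w :: complex ^ 'n))\<^sup>2" "- v"] by simp
  have "complex_of_real (C * phi k l (0 :: complex ^ 'n)) = (\<integral>w. twist ?c (phi k l) 0 w * twist ?c (phi k l) w (0 :: complex ^ 'n) \<partial>lborel)"
    unfolding phi_reproducing[OF l] by (simp add: C_def twist_def)
  also have "\<dots> = (\<integral>w. complex_of_real ((phi k l (w :: complex ^ 'n))\<^sup>2) \<partial>lborel)"
    by (intro Bochner_Integration.integral_cong) (simp_all add: twist_def phi_uminus power2_eq_square)
  finally have diag: "C * phi k l (0 :: complex ^ 'n) = (\<integral>w. (phi k l (w :: complex ^ 'n))\<^sup>2 \<partial>lborel)"
    unfolding integral_complex_of_real of_real_eq_iff .
  have "C * \<bar>phi k l z\<bar> = norm (of_real C * twist ?c (phi k l) z 0)"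
    using C by (simp add: norm_mult norm_twist)
  also have "of_real C * twist ?c (phi k l) z 0 = (\<integral>w. twist ?c (phi k l) z w * twist ?c (phi k l) w 0 \<partial>lborel)"
    unfolding phi_reproducing[OF l] by (simp add: C_def)
  also have "norm \<dots> \<le> (\<integral>w. norm (twist ?c (phi k l) z w * twist ?c (phi k l) w 0) \<partial>lborel)"
    by (rule integral_norm_bound)
  \<comment> \<open>The mean of the squares does the work of the Cauchy--Schwarz inequality, without
    loss, since by translation both squares have the same integral.\<close>
  also have "\<dots> \<le> (\<integral>w. ((phi k l (w - z))\<^sup>2 + (phi k l (w - 0))\<^sup>2) / 2 \<partial>lborel)"
  proof (rule integral_mono')
    show "integrable lborel (\<lambda>w. ((phi k l (w - z))\<^sup>2 + (phi k l (w - 0))\<^sup>2) / 2)"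
      by (intro integrable_divide Bochner_Integration.integrable_add integrable_phi l)
    fix w
    have "\<bar>phi k l (z - w)\<bar> = \<bar>phi k l (w - z)\<bar>" using phi_uminus[of k l "w - z"] by simp
    thus "norm (twist ?c (phi k l) z w * twist ?c (phi k l) w 0) \<le> ((phi k l (w - z))\<^sup>2 + (phi k l (w - 0))\<^sup>2) / 2"
      using sum_squares_bound[of "\<bar>phi k l (w - z)\<bar>" "\<bar>phi k l (w - 0)\<bar>"]
      by (simp add: norm_mult norm_twist)
    show "0 \<le> ((phi k l (w - z))\<^sup>2 + (phi k l (w - 0))\<^sup>2) / 2" by simp
  qed
  also have "\<dots> = (\<integral>w. (phi k l (w :: complex ^ 'n))\<^sup>2 \<partial>lborel)"
    by (subst integral_divide_zero, subst Bochner_Integration.integral_add) (simp_all only: integrable_phi[OF l] sq, simp)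
  also have "\<dots> = C * phi k l (0 :: complex ^ 'n)" by (rule diag[symmetric])
  finally show ?thesis using C by simp
qed

text \<open>At l = 0 the function is constant. With this case included the kernel bound holds at
  every parameter, not only almost everywhere, as \<open>kernel_op\<close> asks.\<close>

lemma abs_phi_le:
  fixes z :: "complex ^ 'n::finite"
  shows "\<bar>phi k l z\<bar> \<le> real ((k + CARD('n) - 1) choose k)"
proof (cases "l = 0")
  case True
  hence "phi k l z = real ((k + CARD('n) - 1) choose k)"
    by (simp add: phi_lag lag_0 Suc_leI)
  thus ?thesis by simp
next
  case False
  from abs_phi_le_nonzero[OF this, of k z] show ?thesis by (simp only: phi_zero)
qed

lemma reproducing_kernels_phi:
  assumes l: "l \<noteq> 0"
  shows "reproducing_kernels (lborel :: (complex ^ 'n::finite) measure) (\<lambda>k. twist (- l / 2) (phi k l)) ((2 * pi / \<bar>l\<bar>) ^ CARD('n))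
    (\<lambda>k. real ((k + CARD('n) - 1) choose k)) (\<lambda>k. \<integral>w. \<bar>phi k l (w :: complex ^ 'n)\<bar> \<partial>lborel)"
proof (unfold_locales)
  show "(\<lambda>(w, z :: complex ^ 'n). twist (- l / 2) (phi k l) w z) \<in> borel_measurable (lborel \<Otimes>\<^sub>M lborel)" for k
    by measurable
  show "cnj (twist (- l / 2) (phi k l) w z) = twist (- l / 2) (phi k l) z w" for k and w z :: "complex ^ 'n"
    by (rule cnj_twist) (rule phi_uminus)
  show "norm (twist (- l / 2) (phi k l) w z) \<le> real ((k + CARD('n) - 1) choose k)" for k and w z :: "complex ^ 'n"
    unfolding norm_twist by (rule abs_phi_le)
  show "(\<integral>\<^sup>+z. ennreal (norm (twist (- l / 2) (phi k l) w z)) \<partial>lborel) \<le> ennreal (\<integral>w. \<bar>phi k l (w :: complex ^ 'n)\<bar> \<partial>lborel)"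
    for k and w :: "complex ^ 'n"
  proof -
    have "(\<integral>\<^sup>+z. ennreal (norm (twist (- l / 2) (phi k l) w z)) \<partial>lborel) = (\<integral>\<^sup>+z. ennreal \<bar>phi k l (z :: complex ^ 'n)\<bar> \<partial>lborel)"
      unfolding norm_twist by (rule lborel_nn_integral_reflect) measurable
    also have "\<dots> = ennreal (\<integral>w. \<bar>phi k l (w :: complex ^ 'n)\<bar> \<partial>lborel)"
      using integrable_phi(1)[OF l, of k "0 :: complex ^ 'n"] by (intro nn_integral_eq_integral) simp_all
    finally show ?thesis by simp
  qed
  show "(\<integral>w. twist (- l / 2) (phi j l) u w * twist (- l / 2) (phi k l) w z \<partial>lborel)
    = (if j = k then of_real ((2 * pi / \<bar>l\<bar>) ^ CARD('n)) * twist (- l / 2) (phi k l) u z else 0)"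
    for j k and u z :: "complex ^ 'n" by (rule phi_reproducing[OF l])
  show "0 < (2 * pi / \<bar>l\<bar>) ^ CARD('n)" using l by simp
qed

section \<open>Plancherel inequality on the real line\<close>

lemma nn_integral_gaussian_real:
  fixes a :: real
  assumes a: "0 < a"
  shows "(\<integral>\<^sup>+s. ennreal (exp (- a * (t - s)\<^sup>2)) \<partial>lborel) = ennreal (sqrt (pi / a))"
proof -
  have "complex_of_real (\<integral>s. exp (- a * s\<^sup>2) \<partial>lborel) = of_real (sqrt (pi / a))"
    using gaussian_fourier_real(2)[OF a, of 0] by (simp flip: integral_complex_of_real)
  hence I: "(\<integral>s. exp (- a * s\<^sup>2) \<partial>lborel) = sqrt (pi / a)"
    by (simp only: of_real_eq_iff)
  have "(\<integral>\<^sup>+s. ennreal (exp (- a * (t - s)\<^sup>2)) \<partial>lborel) = (\<integral>\<^sup>+s. ennreal (exp (- a * s\<^sup>2)) \<partial>lborel)"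
    by (rule lborel_nn_integral_reflect[of "\<lambda>s. ennreal (exp (- a * s\<^sup>2))"]) measurable
  also have "\<dots> = ennreal (\<integral>s. exp (- a * s\<^sup>2) \<partial>lborel)"
    using integrable_gaussian[OF a, of "0::real"] by (intro nn_integral_eq_integral) simp_all
  finally show ?thesis by (simp only: I)
qed

text \<open>
  With a Gaussian damping factor Fubini's theorem applies, and the Gaussian kernel that
  results has total mass \<open>2 * pi\<close> whatever the damping \<open>a\<close>.
\<close>
lemma plancherel_damped:
  fixes h :: "real \<Rightarrow> complex"
  assumes h: "integrable lborel h" and a: "0 < a"
  shows "(\<integral>\<^sup>+l. ennreal ((norm (\<integral>t. h t * cis (- l * t) \<partial>lborel))\<^sup>2 * exp (- a * l\<^sup>2)) \<partial>lborel)
    \<le> ennreal (2 * pi) * (\<integral>\<^sup>+t. ennreal ((norm (h t))\<^sup>2) \<partial>lborel)"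
proof -
  have [measurable]: "h \<in> borel_measurable borel" using h by auto
  define F where "F l = (\<integral>t. h t * cis (- l * t) \<partial>lborel)" for l
  have F_meas [measurable]: "F \<in> borel_measurable borel"
    unfolding F_def by measurable
  define G where "G x = sqrt (pi / a) * exp (- x\<^sup>2 / (4 * a))" for x
  have G0: "0 \<le> G x" for x using a by (simp add: G_def)
  let ?g = "\<lambda>t s x. ennreal ((norm (h x))\<^sup>2 / 2) * ennreal (G (t - s))"
  let ?N = "(\<integral>\<^sup>+t. ennreal ((norm (h t))\<^sup>2) \<partial>lborel)"
  have [measurable]: "G \<in> borel_measurable borel" unfolding G_def by measurable
  interpret R12: pair_sigma_finite "lborel :: real measure" "lborel \<Otimes>\<^sub>M lborel :: (real \<times> real) measure"
    by (intro pair_sigma_finite.intro sigma_finite_pair_measure lborel.sigma_finite_measure_axioms)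
  define H where "H = (\<lambda>(t, s). h t * cnj (h s))"
  have H_int: "integrable (lborel \<Otimes>\<^sub>M lborel) H"
    unfolding H_def by (rule lborel_pair.integrable_tensor[OF h]) (use h in simp)
  have [measurable]: "H \<in> borel_measurable (lborel \<Otimes>\<^sub>M lborel)" using H_int by auto
  \<comment> \<open>The square of F written as a double integral. Integrating (t, s) first returns
    the damped square, in \<open>inner1\<close>; integrating l first produces the Gaussian kernel G,
    in \<open>inner2\<close>.\<close>
  define Q where "Q = (\<lambda>l (t, s). of_real (exp (- a * l\<^sup>2)) * H (t, s) * cis ((s - t) * l))"
  have Q_int: "integrable (lborel \<Otimes>\<^sub>M (lborel \<Otimes>\<^sub>M lborel)) (case_prod Q)"
  proof (rule Bochner_Integration.integrable_bound)
    have "integrable lborel (\<lambda>l. complex_of_real (exp (- a * l\<^sup>2)))"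
      using gaussian_fourier_real(1)[OF a, of 0] by simp
    from R12.integrable_tensor[OF this H_int]
    show "integrable (lborel \<Otimes>\<^sub>M (lborel \<Otimes>\<^sub>M lborel)) (\<lambda>(l, p). of_real (exp (- a * l\<^sup>2)) * H p)" .
    show "case_prod Q \<in> borel_measurable (lborel \<Otimes>\<^sub>M (lborel \<Otimes>\<^sub>M lborel))"
      unfolding Q_def by measurable
    show "AE x in lborel \<Otimes>\<^sub>M (lborel \<Otimes>\<^sub>M lborel). norm (case_prod Q x) \<le> norm (case x of (l, p) \<Rightarrow> of_real (exp (- a * l\<^sup>2)) * H p)"
      by (rule AE_I2) (auto simp: Q_def norm_mult)
  qed
  have inner1: "(\<integral>p. Q l p \<partial>(lborel \<Otimes>\<^sub>M lborel)) = of_real ((norm (F l))\<^sup>2 * exp (- a * l\<^sup>2))" for l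
  proof -
    let ?k = "\<lambda>t. h t * cis (- l * t)"
    have k: "integrable lborel ?k"
      by (rule Bochner_Integration.integrable_bound[OF h]) (auto simp: norm_mult)
    have kk: "integrable (lborel \<Otimes>\<^sub>M lborel) (\<lambda>(t, s). ?k t * cnj (?k s))"
      by (rule lborel_pair.integrable_tensor[OF k integrable_cnj[OF k]])
    have "(\<integral>p. Q l p \<partial>(lborel \<Otimes>\<^sub>M lborel)) = (\<integral>p. of_real (exp (- a * l\<^sup>2)) * (case p of (t, s) \<Rightarrow> ?k t * cnj (?k s)) \<partial>(lborel \<Otimes>\<^sub>M lborel))"
    proof (intro Bochner_Integration.integral_cong refl)
      fix p :: "real \<times> real"
      obtain t s where p: "p = (t, s)" by (cases p)
      have "cis ((s - t) * l) = cis (- l * t) * cis (l * s)" by (simp add: cis_mult algebra_simps)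
      thus "Q l p = of_real (exp (- a * l\<^sup>2)) * (case p of (t, s) \<Rightarrow> ?k t * cnj (?k s))"
        unfolding p Q_def H_def by (simp add: cis_cnj mult_ac)
    qed
    also have "\<dots> = of_real (exp (- a * l\<^sup>2)) * (\<integral>p. (case p of (t, s) \<Rightarrow> ?k t * cnj (?k s)) \<partial>(lborel \<Otimes>\<^sub>M lborel))"
      by (rule integral_mult_right_zero)
    also have "(\<integral>p. (case p of (t, s) \<Rightarrow> ?k t * cnj (?k s)) \<partial>(lborel \<Otimes>\<^sub>M lborel)) = (\<integral>t. (\<integral>s. ?k t * cnj (?k s) \<partial>lborel) \<partial>lborel)"
      by (rule lborel_pair.integral_fst[OF kk, symmetric])
    also have "\<dots> = F l * cnj (F l)"
      unfolding integral_mult_right_zero integral_mult_left_zero integral_bounded_linear[OF bounded_linear_cnj k] F_def ..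
    also have "\<dots> = of_real ((norm (F l))\<^sup>2)" by (rule complex_norm_square[symmetric])
    finally show ?thesis by (simp add: mult.commute)
  qed
  have inner2: "(\<integral>l. Q l p \<partial>lborel) = (case p of (t, s) \<Rightarrow> H (t, s) * of_real (G (t - s)))" for p
  proof -
    obtain t s where p: "p = (t, s)" by (cases p)
    have "(\<integral>l. Q l p \<partial>lborel) = (\<integral>l. H (t, s) * (of_real (exp (- a * l\<^sup>2)) * cis ((s - t) * l)) \<partial>lborel)"
      unfolding p Q_def by (intro Bochner_Integration.integral_cong) (simp_all add: mult_ac)
    also have "\<dots> = H (t, s) * of_real (sqrt (pi / a) * exp (- (s - t)\<^sup>2 / (4 * a)))"
      by (simp only: integral_mult_right_zero gaussian_fourier_real(2)[OF a])
    finally show ?thesis unfolding p G_def by (simp add: power2_commute)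
  qed
  have fub: "(\<integral>l. (\<integral>p. Q l p \<partial>(lborel \<Otimes>\<^sub>M lborel)) \<partial>lborel) = (\<integral>p. (\<integral>l. Q l p \<partial>lborel) \<partial>(lborel \<Otimes>\<^sub>M lborel))"
    by (rule R12.Fubini_integral[OF Q_int, symmetric])
  have int1: "integrable lborel (\<lambda>l. (norm (F l))\<^sup>2 * exp (- a * l\<^sup>2))"
  proof -
    have "integrable lborel (\<lambda>l. \<integral>p. Q l p \<partial>(lborel \<Otimes>\<^sub>M lborel))"
      using R12.integrable_fst'[OF Q_int] by simp
    thus ?thesis unfolding inner1 by (simp only: complex_of_real_integrable_eq)
  qed
  define A where "A = (\<integral>l. (norm (F l))\<^sup>2 * exp (- a * l\<^sup>2) \<partial>lborel)"
  have A0: "0 \<le> A" unfolding A_def by (intro integral_nonneg_AE) auto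
  have A: "complex_of_real A = (\<integral>p. (case p of (t, s) \<Rightarrow> H (t, s) * of_real (G (t - s))) \<partial>(lborel \<Otimes>\<^sub>M lborel))"
    using fub unfolding inner1 inner2 A_def integral_complex_of_real .
  have mass: "(\<integral>\<^sup>+s. ennreal (G (t - s)) \<partial>lborel) = ennreal (2 * pi)" for t
  proof -
    have "(\<integral>\<^sup>+s. ennreal (G (t - s)) \<partial>lborel) = (\<integral>\<^sup>+s. ennreal (sqrt (pi / a)) * ennreal (exp (- (1 / (4 * a)) * (t - s)\<^sup>2)) \<partial>lborel)"
      using a by (intro nn_integral_cong) (simp add: G_def ennreal_mult')
    also have "\<dots> = ennreal (sqrt (pi / a)) * ennreal (sqrt (pi / (1 / (4 * a))))"
      using nn_integral_gaussian_real[of "1 / (4 * a)" t] a by (subst nn_integral_cmult) auto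
    also have "\<dots> = ennreal (sqrt (pi / a) * sqrt (pi / (1 / (4 * a))))"
      using a by (intro ennreal_mult[symmetric]) auto
    also have "sqrt (pi / a) * sqrt (pi / (1 / (4 * a))) = sqrt ((2 * pi)\<^sup>2)"
      unfolding real_sqrt_mult[symmetric] using a by (intro arg_cong[of _ _ sqrt]) (simp add: power2_eq_square)
    also have "\<dots> = 2 * pi" by (rule real_sqrt_unique) simp_all
    finally show ?thesis .
  qed
  have mass': "(\<integral>\<^sup>+t. ennreal (G (t - s)) \<partial>lborel) = ennreal (2 * pi)" for s
    using mass[of s] by (simp add: G_def power2_commute)
  have "(\<integral>\<^sup>+l. ennreal ((norm (F l))\<^sup>2 * exp (- a * l\<^sup>2)) \<partial>lborel) = ennreal A"
    unfolding A_def by (rule nn_integral_eq_integral[OF int1]) auto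
  also have "\<dots> = ennreal (norm (complex_of_real A))" using A0 by simp
  also have "\<dots> \<le> (\<integral>\<^sup>+p. ennreal (norm (case p of (t, s) \<Rightarrow> H (t, s) * of_real (G (t - s)))) \<partial>(lborel \<Otimes>\<^sub>M lborel))"
  proof -
    have int2: "integrable (lborel \<Otimes>\<^sub>M lborel) (\<lambda>p. case p of (t, s) \<Rightarrow> H (t, s) * of_real (G (t - s)))"
      using R12.integrable_snd[OF Q_int] unfolding inner2 .
    show ?thesis unfolding A by (rule integral_norm_bound_ennreal[OF int2])
  qed
  \<comment> \<open>Schur's test: the product of |h t| and |h s| is at most the mean of their
    squares, and in each of the two terms the free variable integrates G to 2 * pi.\<close>
  also have "\<dots> \<le> (\<integral>\<^sup>+p. (case p of (t, s) \<Rightarrow> ?g t s t) +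
      (case p of (t, s) \<Rightarrow> ?g t s s) \<partial>(lborel \<Otimes>\<^sub>M lborel))"
  proof (rule nn_integral_mono)
    fix p :: "real \<times> real"
    obtain t s where p: "p = (t, s)" by (cases p)
    have "norm (h t) * norm (h s) \<le> (norm (h t))\<^sup>2 / 2 + (norm (h s))\<^sup>2 / 2"
      using sum_squares_bound[of "norm (h t)" "norm (h s)"] by simp
    hence "norm (h t) * norm (h s) * G (t - s) \<le> ((norm (h t))\<^sup>2 / 2 + (norm (h s))\<^sup>2 / 2) * G (t - s)"
      by (rule mult_right_mono[OF _ G0])
    hence "ennreal (norm (h t) * norm (h s) * G (t - s)) \<le> ennreal ((norm (h t))\<^sup>2 / 2 * G (t - s) + (norm (h s))\<^sup>2 / 2 * G (t - s))"
      by (intro ennreal_leI) (simp only: distrib_right)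
    also have "\<dots> = ?g t s t + ?g t s s"
    proof -
      have "ennreal (x / 2 * G (t - s)) = ennreal (x / 2) * ennreal (G (t - s))" if "0 \<le> x" for x
        by (rule ennreal_mult) (use that G0[of "t - s"] in simp_all)
      moreover have "0 \<le> x / 2 * G (t - s)" if "0 \<le> x" for x
        using that G0[of "t - s"] by simp
      ultimately show ?thesis by (simp only: ennreal_plus zero_le_power2)
    qed
    finally show "ennreal (norm (case p of (t, s) \<Rightarrow> H (t, s) * of_real (G (t - s))))
      \<le> (case p of (t, s) \<Rightarrow> ?g t s t) +
      (case p of (t, s) \<Rightarrow> ?g t s s)"
      unfolding p H_def using G0[of "t - s"] by (simp add: norm_mult)
  qed
  also have "\<dots> = (\<integral>\<^sup>+p. (case p of (t, s) \<Rightarrow> ?g t s t) \<partial>(lborel \<Otimes>\<^sub>M lborel))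
    + (\<integral>\<^sup>+p. (case p of (t, s) \<Rightarrow> ?g t s s) \<partial>(lborel \<Otimes>\<^sub>M lborel))"
    by (rule nn_integral_add) measurable
  also have "(\<integral>\<^sup>+p. (case p of (t, s) \<Rightarrow> ?g t s t) \<partial>(lborel \<Otimes>\<^sub>M lborel))
    = (\<integral>\<^sup>+t. (\<integral>\<^sup>+s. ?g t s t \<partial>lborel) \<partial>lborel)"
    by (subst lborel.nn_integral_fst[symmetric]) auto
  also have "\<dots> = (\<integral>\<^sup>+t. ennreal pi * ennreal ((norm (h t))\<^sup>2) \<partial>lborel)"
  proof (rule nn_integral_cong)
    fix t
    have "(\<integral>\<^sup>+s. ?g t s t \<partial>lborel) = ennreal ((norm (h t))\<^sup>2 / 2) * ennreal (2 * pi)"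
      unfolding mass[of t, symmetric] by (rule nn_integral_cmult) measurable
    also have "\<dots> = ennreal pi * ennreal ((norm (h t))\<^sup>2)"
      by (simp flip: ennreal_mult)
    finally show "(\<integral>\<^sup>+s. ?g t s t \<partial>lborel) = ennreal pi * ennreal ((norm (h t))\<^sup>2)" .
  qed
  also have "(\<integral>\<^sup>+p. (case p of (t, s) \<Rightarrow> ?g t s s) \<partial>(lborel \<Otimes>\<^sub>M lborel))
    = (\<integral>\<^sup>+s. (\<integral>\<^sup>+t. ?g t s s \<partial>lborel) \<partial>lborel)"
    by (subst lborel_pair.nn_integral_snd[symmetric]) auto
  also have "\<dots> = (\<integral>\<^sup>+t. ennreal pi * ennreal ((norm (h t))\<^sup>2) \<partial>lborel)"
  proof (rule nn_integral_cong)
    fix s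
    have "(\<integral>\<^sup>+t. ?g t s s \<partial>lborel) = ennreal ((norm (h s))\<^sup>2 / 2) * ennreal (2 * pi)"
      unfolding mass'[of s, symmetric] by (rule nn_integral_cmult) measurable
    also have "\<dots> = ennreal pi * ennreal ((norm (h s))\<^sup>2)"
      by (simp flip: ennreal_mult)
    finally show "(\<integral>\<^sup>+t. ?g t s s \<partial>lborel) = ennreal pi * ennreal ((norm (h s))\<^sup>2)" .
  qed
  also have "(\<integral>\<^sup>+t. ennreal pi * ennreal ((norm (h t))\<^sup>2) \<partial>lborel) = ennreal pi * ?N"
    by (rule nn_integral_cmult) measurable
  also have "ennreal pi * ?N + ennreal pi * ?N
    = ennreal (2 * pi) * ?N"
  proof -
    have "ennreal (2 * pi) = ennreal pi + ennreal pi" by (simp flip: ennreal_plus)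
    thus ?thesis by (simp only: distrib_right)
  qed
  finally show ?thesis by (simp only: F_def)
qed

text \<open>The damping is removed by Fatou's lemma. For h not integrable the Bochner integrals on
  the left are 0; covering this case lets the inequality be used on every slice of f in t, though
  only almost all slices are integrable.\<close>

lemma plancherel_le:
  fixes h :: "real \<Rightarrow> complex"
  assumes [measurable]: "h \<in> borel_measurable borel"
  shows "(\<integral>\<^sup>+l. ennreal ((norm (\<integral>t. h t * cis (- l * t) \<partial>lborel))\<^sup>2) \<partial>lborel)
    \<le> ennreal (2 * pi) * (\<integral>\<^sup>+t. ennreal ((norm (h t))\<^sup>2) \<partial>lborel)"
proof (cases "integrable lborel h")
  case False
  have "(\<integral>t. h t * cis (- l * t) \<partial>lborel) = 0" for l
  proof (rule not_integrable_integral_eq, rule notI)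
    assume "integrable lborel (\<lambda>t. h t * cis (- l * t))"
    hence "integrable lborel h"
      by (rule Bochner_Integration.integrable_bound) (auto simp: norm_mult)
    with False show False ..
  qed
  thus ?thesis by simp
next
  case True
  define F where "F l = (\<integral>t. h t * cis (- l * t) \<partial>lborel)" for l
  have [measurable]: "F \<in> borel_measurable borel" unfolding F_def by measurable
  define g where "g m l = ennreal ((norm (F l))\<^sup>2 * exp (- inverse (real (Suc m)) * l\<^sup>2))" for m l
  have lim: "(\<lambda>m. g m l) \<longlonglongrightarrow> ennreal ((norm (F l))\<^sup>2)" for l
  proof -
    have "(\<lambda>m. - inverse (real (Suc m)) * l\<^sup>2) \<longlonglongrightarrow> - 0 * l\<^sup>2"
      by (intro tendsto_intros LIMSEQ_inverse_real_of_nat)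
    hence "(\<lambda>m. (norm (F l))\<^sup>2 * exp (- inverse (real (Suc m)) * l\<^sup>2)) \<longlonglongrightarrow> (norm (F l))\<^sup>2 * exp (- 0 * l\<^sup>2)"
      by (rule tendsto_mult[OF tendsto_const tendsto_exp])
    thus ?thesis unfolding g_def by (intro tendsto_ennrealI) simp
  qed
  have "(\<integral>\<^sup>+l. ennreal ((norm (F l))\<^sup>2) \<partial>lborel) = (\<integral>\<^sup>+l. liminf (\<lambda>m. g m l) \<partial>lborel)"
    by (intro nn_integral_cong lim_imp_Liminf[symmetric] lim) simp
  also have "\<dots> \<le> liminf (\<lambda>m. \<integral>\<^sup>+l. g m l \<partial>lborel)"
    by (rule nn_integral_liminf) (unfold g_def, measurable)
  also have "\<dots> \<le> ennreal (2 * pi) * (\<integral>\<^sup>+t. ennreal ((norm (h t))\<^sup>2) \<partial>lborel)"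
    unfolding g_def F_def by (intro Liminf_le always_eventually allI plancherel_damped True) (simp_all del: of_nat_Suc)
  finally show ?thesis by (simp only: F_def)
qed

section \<open>The transform as an integral operator\<close>

lemma phi_measurable [measurable (raw)]:
  fixes g :: "'a \<Rightarrow> complex ^ 'n::finite"
  assumes [measurable]: "f \<in> borel_measurable M" "g \<in> borel_measurable M"
  shows "(\<lambda>x. phi k (f x) (g x)) \<in> borel_measurable M"
  unfolding phi_lag lag_def by measurable

text \<open>The origin of the parameter - l / 2: the central coordinate of the inverse of (z, t)
  times (w, 0) is - t minus half of \<open>symp z w\<close>.\<close>

lemma efun_kernel:
  fixes z w :: "complex ^ 'n::finite"
  shows "efun k l (hmult (hinv (z, t)) (w, 0)) = cis (- l * t) * twist (- l / 2) (phi k l) w z"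
proof -
  have s: "l * snd (hmult (hinv (z, t)) (w, 0)) = - l * t + (- l / 2) * symp z w"
    by (simp add: hmult_def hinv_def symp_def sum_negf algebra_simps)
  have f: "fst (hmult (hinv (z, t)) (w, 0)) = w - z"
    by (simp add: hmult_def hinv_def)
  show ?thesis unfolding efun_def s f twist_def cis_conv_exp[symmetric] cis_mult[symmetric] by (simp only: mult_ac)
qed

text \<open>The value of \<open>phi k l\<close> at 0, by \<open>bcoef_binomial\<close> and
  \<open>phi_zero\<close>. Dividing by it normalizes the kernel to absolute value at most 1, and its
  square in \<open>plancherel_weight\<close> compensates that division in the
  \<open>L\<^sup>2\<close> estimate.\<close>

definition bcoef :: "nat \<Rightarrow> nat \<Rightarrow> real" where
  "bcoef n k = fact (k + n - 1) / (fact k * fact (n - 1))"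

lemma bcoef_pos: "0 < bcoef n k"
  by (simp add: bcoef_def)

lemma bcoef_binomial: "0 < n \<Longrightarrow> bcoef n k = real ((k + n - 1) choose k)"
  by (subst binomial_fact) (auto simp: bcoef_def)

definition plancherel_weight :: "nat \<Rightarrow> nat \<times> real \<Rightarrow> real" where
  "plancherel_weight n = (\<lambda>(k, l). (bcoef n k)\<^sup>2 * \<bar>l\<bar> ^ (2 * n) / (2 * pi) ^ (2 * n + 1))"

lemma plancherel_weight_nonneg: "0 \<le> plancherel_weight n x"
  by (auto simp: plancherel_weight_def split: prod.split)

lemma plancherel_weight_meas [measurable]:
  "plancherel_weight n \<in> borel_measurable (count_space UNIV \<Otimes>\<^sub>M lborel)"
  unfolding plancherel_weight_def
  by (rule measurable_pair_measure_countable1) (simp_all, measurable)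

text \<open>
  The fan is parametrised by the pairs (k, lambda); since lambda = 0 is a null set this is
  the measure \<open>nu2\<close> times Lebesgue measure.
\<close>
definition fan_measure :: "((nat \<times> real) \<times> (complex ^ 'n::finite)) measure" where
  "fan_measure = density ((count_space UNIV \<Otimes>\<^sub>M lborel) \<Otimes>\<^sub>M lborel)
     (\<lambda>y. ennreal (plancherel_weight CARD('n) (fst y)))"

lemma sigma_finite_params:
  "sigma_finite_measure ((count_space (UNIV :: nat set) \<Otimes>\<^sub>M (lborel :: real measure)) \<Otimes>\<^sub>M (lborel :: (complex ^ 'n::finite) measure))"
  by (intro sigma_finite_pair_measure sigma_finite_measure_count_space lborel.sigma_finite_measure_axioms)

lemma sigma_finite_fan_measure: "sigma_finite_measure (fan_measure :: ((nat \<times> real) \<times> (complex ^ 'n::finite)) measure)"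
  unfolding fan_measure_def
  by (subst sigma_finite_measure.sigma_finite_iff_density_finite[OF sigma_finite_params]) auto

lemma sets_fan_measure [measurable_cong]:
  "sets fan_measure = sets ((count_space UNIV \<Otimes>\<^sub>M lborel) \<Otimes>\<^sub>M lborel)"
  by (simp add: fan_measure_def)

lemma space_fan_measure [simp]: "space fan_measure = UNIV"
  by (simp add: fan_measure_def space_pair_measure)

lemma nn_integral_fan_measure:
  fixes g :: "(nat \<times> real) \<times> (complex ^ 'n::finite) \<Rightarrow> ennreal"
  assumes [measurable]: "g \<in> borel_measurable ((count_space UNIV \<Otimes>\<^sub>M lborel) \<Otimes>\<^sub>M lborel)"
  shows "(\<integral>\<^sup>+y. g y \<partial>fan_measure) = (\<integral>\<^sup>+x. ennreal (plancherel_weight CARD('n) x) * (\<integral>\<^sup>+w. g (x, w) \<partial>lborel) \<partial>(count_space UNIV \<Otimes>\<^sub>M lborel))"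
proof -
  have "(\<integral>\<^sup>+y. g y \<partial>fan_measure) = (\<integral>\<^sup>+y. ennreal (plancherel_weight CARD('n) (fst y)) * g y \<partial>((count_space UNIV \<Otimes>\<^sub>M lborel) \<Otimes>\<^sub>M lborel))"
    unfolding fan_measure_def by (rule nn_integral_density) measurable
  also have "\<dots> = (\<integral>\<^sup>+x. (\<integral>\<^sup>+w. ennreal (plancherel_weight CARD('n) (fst (x, w))) * g (x, w) \<partial>lborel) \<partial>(count_space UNIV \<Otimes>\<^sub>M lborel))"
    by (rule lborel.nn_integral_fst[symmetric]) measurable
  also have "\<dots> = (\<integral>\<^sup>+x. ennreal (plancherel_weight CARD('n) x) * (\<integral>\<^sup>+w. g (x, w) \<partial>lborel) \<partial>(count_space UNIV \<Otimes>\<^sub>M lborel))"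
    by (intro nn_integral_cong) (simp add: nn_integral_cmult measurable_compose[OF measurable_Pair1' assms] space_pair_measure)
  finally show ?thesis .
qed

lemma nn_integral_params:
  fixes g :: "nat \<times> real \<Rightarrow> ennreal"
  assumes "g \<in> borel_measurable (count_space UNIV \<Otimes>\<^sub>M lborel)"
  shows "(\<integral>\<^sup>+x. g x \<partial>(count_space UNIV \<Otimes>\<^sub>M lborel)) = (\<integral>\<^sup>+l. (\<Sum>k. g (k, l)) \<partial>lborel)"
proof -
  interpret P: pair_sigma_finite "count_space (UNIV :: nat set)" "lborel :: real measure"
    by (intro pair_sigma_finite.intro sigma_finite_measure_count_space lborel.sigma_finite_measure_axioms)
  show ?thesis by (subst P.nn_integral_snd[OF assms, symmetric]) (simp add: nn_integral_count_space_nat)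
qed

definition fan_kernel :: "(nat \<times> real) \<times> (complex ^ 'n::finite) \<Rightarrow> 'n heis \<Rightarrow> complex" where
  "fan_kernel = (\<lambda>((k, l), w) x. of_real (1 / bcoef CARD('n) k) * efun k l (hmult (hinv x) (w, 0)))"

lemma fan_kernel_eq:
  "fan_kernel ((k, l), w) (z, t) = of_real (1 / bcoef CARD('n) k) * (cis (- l * t) * twist (- l / 2) (phi k l) w (z :: complex ^ 'n::finite))"
  by (simp add: fan_kernel_def efun_kernel)

lemma norm_fan_kernel_le: "norm (fan_kernel y (x :: 'n::finite heis)) \<le> 1"
proof -
  obtain k l w z t where e: "y = ((k, l), w)" "x = (z, t)" by (metis prod.exhaust)
  have "\<bar>phi k l (w - z)\<bar> \<le> bcoef CARD('n) k"
    using abs_phi_le[of k l "w - z"] by (simp add: bcoef_binomial)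
  thus ?thesis unfolding e fan_kernel_eq using bcoef_pos[of "CARD('n)" k]
    by (simp add: norm_mult norm_divide norm_twist)
qed

lemma fan_kernel_meas:
  "(\<lambda>(y, x). fan_kernel y (x :: 'n::finite heis)) \<in> borel_measurable (fan_measure \<Otimes>\<^sub>M lborel)"
proof -
  define Q :: "nat \<Rightarrow> ((nat \<times> real) \<times> (complex ^ 'n)) \<times> 'n heis \<Rightarrow> complex" where
    "Q = (\<lambda>k p. of_real (1 / bcoef CARD('n) k) * (cis (- snd (fst (fst p)) * snd (snd p)) *
        twist (- snd (fst (fst p)) / 2) (phi k (snd (fst (fst p)))) (snd (fst p)) (fst (snd p))))"
  have [measurable]: "fst \<in> lborel \<rightarrow>\<^sub>M (borel :: (complex ^ 'n) measure)" "snd \<in> lborel \<rightarrow>\<^sub>M (borel :: real measure)"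
    unfolding lborel_prod[symmetric] by measurable
  have Q: "Q k \<in> borel_measurable (fan_measure \<Otimes>\<^sub>M lborel)" for k
    unfolding Q_def twist_def by measurable
  have "(\<lambda>p. Q (fst (fst (fst p))) p) \<in> borel_measurable (fan_measure \<Otimes>\<^sub>M lborel)"
    by (rule measurable_compose_countable[OF Q]) measurable
  moreover have "(\<lambda>(y, x). fan_kernel y (x :: 'n heis)) = (\<lambda>p. Q (fst (fst (fst p))) p)"
    by (auto simp: fun_eq_iff Q_def fan_kernel_eq)
  ultimately show ?thesis by simp
qed

text \<open>For fixed l \<noteq> 0 the transform at (k, l) is, up to \<open>bcoef\<close>, the
  operator \<open>R.P k\<close> applied to the partial Fourier transform \<open>F l\<close>. The
  constants match exactly: the Bessel constant (2 pi / |l|)^(2n) cancels the density up to 1 / (2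
  pi), and the Plancherel inequality returns 2 pi.\<close>

lemma fan_L2_bound:
  fixes f :: "'n::finite heis \<Rightarrow> complex"
  assumes f: "integrable lborel f"
  shows "(\<integral>\<^sup>+y. ennreal (norm (\<integral>x. f x * fan_kernel y x \<partial>lborel) ^ 2) \<partial>fan_measure)
    \<le> (\<integral>\<^sup>+x. ennreal (norm (f x) ^ 2) \<partial>lborel)"
proof -
  let ?n = "CARD('n)"
  have f2: "integrable (lborel \<Otimes>\<^sub>M lborel) f" using f by (simp add: lborel_prod)
  hence [measurable]: "f \<in> borel_measurable (lborel \<Otimes>\<^sub>M lborel)" by auto
  define F where "F l z = (\<integral>t. f (z, t) * cis (- l * t) \<partial>lborel)" for l z
  define S where "S y = (\<integral>x. f x * fan_kernel y x \<partial>lborel)" for y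
  interpret N: sigma_finite_measure "fan_measure :: ((nat \<times> real) \<times> (complex ^ 'n)) measure"
    by (rule sigma_finite_fan_measure)
  have S_meas': "S \<in> borel_measurable fan_measure"
  proof -
    have [measurable]: "f \<in> borel_measurable lborel" using f by auto
    note [measurable] = fan_kernel_meas[where 'n = 'n]
    show ?thesis unfolding S_def by measurable
  qed
  hence S_meas [measurable]: "S \<in> borel_measurable ((count_space UNIV \<Otimes>\<^sub>M lborel) \<Otimes>\<^sub>M lborel)"
    by (simp cong: measurable_cong_sets add: fan_measure_def)
  have F_meas [measurable]: "(\<lambda>(l, z). F l z) \<in> borel_measurable (lborel \<Otimes>\<^sub>M lborel)"
    unfolding F_def by measurable
  have tw_int: "integrable (lborel \<Otimes>\<^sub>M lborel) (\<lambda>(z, t). f (z, t) * cis (- l * t))" for l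
  proof (rule Bochner_Integration.integrable_bound[OF f2])
    show "AE x in lborel \<Otimes>\<^sub>M lborel. norm (case x of (z, t) \<Rightarrow> f (z, t) * cis (- l * t)) \<le> norm (f x)"
      by (rule AE_I2) (auto simp: norm_mult)
  qed measurable
  have F_int: "integrable lborel (F l)" for l
    using lborel_pair.integrable_fst[OF tw_int[of l]] by (simp add: F_def[abs_def])
  have slice: "(\<Sum>k. ennreal (plancherel_weight ?n (k, l)) * (\<integral>\<^sup>+w. ennreal (norm (S ((k, l), w)) ^ 2) \<partial>lborel))
    \<le> ennreal (1 / (2 * pi)) * (\<integral>\<^sup>+z. ennreal (norm (F l z) ^ 2) \<partial>lborel)" if l: "l \<noteq> 0" for l
  proof -
    interpret R: reproducing_kernels "lborel :: (complex ^ 'n) measure" "\<lambda>k. twist (- l / 2) (phi k l)"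
      "(2 * pi / \<bar>l\<bar>) ^ ?n" "\<lambda>k. real ((k + ?n - 1) choose k)" "\<lambda>k. \<integral>w. \<bar>phi k l (w :: complex ^ 'n)\<bar> \<partial>lborel"
      by (rule reproducing_kernels_phi[OF l])
    have S_eq: "S ((k, l), w) = of_real (1 / bcoef ?n k) * R.P k (F l) w" for k w
    proof -
      define c where "c = complex_of_real (1 / bcoef ?n k)"
      let ?K = "\<lambda>z t. c * (cis (- l * t) * twist (- l / 2) (phi k l) w z)"
      have int: "integrable (lborel \<Otimes>\<^sub>M lborel) (\<lambda>(z, t). f (z, t) * ?K z t)"
      proof (rule Bochner_Integration.integrable_bound[OF f2])
        show "AE x in lborel \<Otimes>\<^sub>M lborel. norm (case x of (z, t) \<Rightarrow> f (z, t) * ?K z t) \<le> norm (f x)"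
        proof (rule AE_I2)
          fix x :: "'n heis"
          obtain z t where x: "x = (z, t)" by (cases x)
          have "norm (?K z t) \<le> 1"
            using norm_fan_kernel_le[of "((k, l), w)" "(z, t)"] unfolding fan_kernel_eq c_def .
          thus "norm (case x of (z, t) \<Rightarrow> f (z, t) * ?K z t) \<le> norm (f x)"
            unfolding x prod.case norm_mult[of "f (z, t)"] by (rule mult_left_le) simp
        qed
      qed measurable
      have "S ((k, l), w) = (\<integral>x. (case x of (z, t) \<Rightarrow> f (z, t) * ?K z t) \<partial>(lborel \<Otimes>\<^sub>M lborel))"
        unfolding S_def lborel_prod by (intro Bochner_Integration.integral_cong) (auto simp: fan_kernel_eq c_def)
      also have "\<dots> = (\<integral>z. (\<integral>t. f (z, t) * ?K z t \<partial>lborel) \<partial>lborel)"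
        by (rule lborel_pair.integral_fst[OF int, symmetric])
      also have "\<dots> = (\<integral>z. c * (twist (- l / 2) (phi k l) w z * F l z) \<partial>lborel)"
      proof (intro Bochner_Integration.integral_cong refl)
        fix z
        have "(\<integral>t. f (z, t) * ?K z t \<partial>lborel)
          = (\<integral>t. (c * twist (- l / 2) (phi k l) w z) * (f (z, t) * cis (- l * t)) \<partial>lborel)"
          by (intro Bochner_Integration.integral_cong refl) (simp only: mult_ac)
        thus "(\<integral>t. f (z, t) * ?K z t \<partial>lborel)
          = c * (twist (- l / 2) (phi k l) w z * F l z)"
          unfolding F_def integral_mult_right_zero by (simp only: mult.assoc)
      qed
      also have "\<dots> = c * R.P k (F l) w" unfolding R.P_def by (rule integral_mult_right_zero)
      finally show ?thesis by (simp only: c_def)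
    qed
    define D where "D = \<bar>l\<bar> ^ (2 * ?n) / (2 * pi) ^ (2 * ?n + 1)"
    have D: "0 \<le> D" by (simp add: D_def)
    let ?S = "\<lambda>k. (\<integral>\<^sup>+w. ennreal (norm (S ((k, l), w)) ^ 2) \<partial>lborel)"
    let ?P = "\<lambda>k. (\<integral>\<^sup>+w. ennreal (norm (R.P k (F l) w) ^ 2) \<partial>lborel)"
    have weighted: "ennreal (plancherel_weight ?n (k, l)) * ?S k
      = ennreal D * ?P k" for k
    proof -
      have [measurable]: "F l \<in> borel_measurable lborel" using F_int by auto
      have b: "0 < bcoef ?n k" by (rule bcoef_pos)
      have "?S k = (\<integral>\<^sup>+w. ennreal ((1 / bcoef ?n k)\<^sup>2) * ennreal (norm (R.P k (F l) w) ^ 2) \<partial>lborel)"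
        using b by (intro nn_integral_cong) (simp add: S_eq norm_mult norm_divide power_mult_distrib power_divide flip: ennreal_mult)
      also have "\<dots> = ennreal ((1 / bcoef ?n k)\<^sup>2) * ?P k"
        by (rule nn_integral_cmult) measurable
      finally have "ennreal (plancherel_weight ?n (k, l)) * ?S k
        = (ennreal (plancherel_weight ?n (k, l)) * ennreal ((1 / bcoef ?n k)\<^sup>2)) * ?P k"
        by (simp only: mult.assoc)
      also have "ennreal (plancherel_weight ?n (k, l)) * ennreal ((1 / bcoef ?n k)\<^sup>2) = ennreal (plancherel_weight ?n (k, l) * (1 / bcoef ?n k)\<^sup>2)"
        by (rule ennreal_mult[symmetric]) (simp_all add: plancherel_weight_nonneg)
      also have "plancherel_weight ?n (k, l) * (1 / bcoef ?n k)\<^sup>2 = D"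
        using b by (simp add: plancherel_weight_def D_def power_divide)
      finally show ?thesis .
    qed
    \<comment> \<open>Bessel's inequality holds with the same constant for every finite number of
      terms, so it passes to the supremum.\<close>
    have "(\<Sum>k. ennreal D * ?P k) = (SUP m. \<Sum>k<m. ennreal D * ?P k)"
      by (rule suminf_eq_SUP)
    also have "\<dots> \<le> ennreal D * (ennreal (((2 * pi / \<bar>l\<bar>) ^ ?n)\<^sup>2) * (\<integral>\<^sup>+z. ennreal (norm (F l z) ^ 2) \<partial>lborel))"
      unfolding sum_distrib_left[symmetric] by (intro SUP_least mult_left_mono R.bessel_inequality F_int) simp
    also have "\<dots> = ennreal (D * ((2 * pi / \<bar>l\<bar>) ^ ?n)\<^sup>2) * (\<integral>\<^sup>+z. ennreal (norm (F l z) ^ 2) \<partial>lborel)"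
      using D by (simp add: ennreal_mult mult.assoc)
    also have "D * ((2 * pi / \<bar>l\<bar>) ^ ?n)\<^sup>2 = 1 / (2 * pi)"
    proof -
      have "((2 * pi / \<bar>l\<bar>) ^ ?n)\<^sup>2 = (2 * pi) ^ (2 * ?n) / \<bar>l\<bar> ^ (2 * ?n)"
        by (simp only: power_divide power_mult[symmetric] mult.commute)
      thus ?thesis using l by (simp add: D_def)
    qed
    finally show ?thesis unfolding weighted .
  qed
  have "(\<integral>\<^sup>+y. ennreal (norm (S y) ^ 2) \<partial>fan_measure)
    = (\<integral>\<^sup>+x. ennreal (plancherel_weight ?n x) * (\<integral>\<^sup>+w. ennreal (norm (S (x, w)) ^ 2) \<partial>lborel) \<partial>(count_space UNIV \<Otimes>\<^sub>M lborel))"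
    by (rule nn_integral_fan_measure) measurable
  also have "\<dots> = (\<integral>\<^sup>+l. (\<Sum>k. ennreal (plancherel_weight ?n (k, l)) * (\<integral>\<^sup>+w. ennreal (norm (S ((k, l), w)) ^ 2) \<partial>lborel)) \<partial>lborel)"
    by (rule nn_integral_params) measurable
  also have "\<dots> \<le> (\<integral>\<^sup>+l. ennreal (1 / (2 * pi)) * (\<integral>\<^sup>+z. ennreal (norm (F l z) ^ 2) \<partial>lborel) \<partial>lborel)"
    using AE_lborel_singleton[of "0::real"] by (intro nn_integral_mono_AE) (auto intro: slice elim: eventually_mono)
  also have "\<dots> = ennreal (1 / (2 * pi)) * (\<integral>\<^sup>+l. (\<integral>\<^sup>+z. ennreal (norm (F l z) ^ 2) \<partial>lborel) \<partial>lborel)"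
    by (rule nn_integral_cmult) measurable
  also have "(\<integral>\<^sup>+l. (\<integral>\<^sup>+z. ennreal (norm (F l z) ^ 2) \<partial>lborel) \<partial>lborel) = (\<integral>\<^sup>+z. (\<integral>\<^sup>+l. ennreal (norm (F l z) ^ 2) \<partial>lborel) \<partial>lborel)"
    by (rule lborel_pair.Fubini'[symmetric]) measurable
  also have "\<dots> \<le> (\<integral>\<^sup>+z. ennreal (2 * pi) * (\<integral>\<^sup>+t. ennreal (norm (f (z, t)) ^ 2) \<partial>lborel) \<partial>lborel)"
    unfolding F_def
  proof (intro nn_integral_mono plancherel_le)
    fix z
    show "(\<lambda>t. f (z, t)) \<in> borel_measurable borel"
      using measurable_compose[OF measurable_Pair1'[of z lborel lborel] \<open>f \<in> borel_measurable (lborel \<Otimes>\<^sub>M lborel)\<close>] by simp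
  qed
  also have "\<dots> = ennreal (2 * pi) * (\<integral>\<^sup>+z. (\<integral>\<^sup>+t. ennreal (norm (f (z, t)) ^ 2) \<partial>lborel) \<partial>lborel)"
    by (rule nn_integral_cmult) measurable
  also have "(\<integral>\<^sup>+z. (\<integral>\<^sup>+t. ennreal (norm (f (z, t)) ^ 2) \<partial>lborel) \<partial>lborel) = (\<integral>\<^sup>+x. ennreal (norm (f x) ^ 2) \<partial>(lborel \<Otimes>\<^sub>M lborel))"
    by (rule lborel.nn_integral_fst) measurable
  also have "ennreal (1 / (2 * pi)) * (ennreal (2 * pi) * (\<integral>\<^sup>+x. ennreal (norm (f x) ^ 2) \<partial>(lborel \<Otimes>\<^sub>M lborel)))
    = (\<integral>\<^sup>+x. ennreal (norm (f x) ^ 2) \<partial>lborel)"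
    unfolding mult.assoc[symmetric] lborel_prod by (simp flip: ennreal_mult)
  finally show ?thesis unfolding S_def by (rule order_trans[rotated]) (auto intro: mult_left_mono)
qed

lemma kernel_op_fan:
  "kernel_op (lborel :: 'n::finite heis measure) fan_measure fan_kernel 1"
proof (intro kernel_op.intro kernel_op_axioms.intro)
  show "sigma_finite_measure (fan_measure :: ((nat \<times> real) \<times> (complex ^ 'n)) measure)"
    by (rule sigma_finite_fan_measure)
  show "sigma_finite_measure (lborel :: 'n heis measure)" ..
  show "(\<lambda>(y, x). fan_kernel y (x :: 'n heis)) \<in> borel_measurable (fan_measure \<Otimes>\<^sub>M lborel)"
    by (rule fan_kernel_meas)
  show "norm (fan_kernel y x) \<le> 1" for y and x :: "'n heis" by (rule norm_fan_kernel_le)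
  show "(\<integral>\<^sup>+y. ennreal (norm (\<integral>x. f x * fan_kernel y x \<partial>lborel) ^ 2) \<partial>fan_measure)
    \<le> ennreal 1 * (\<integral>\<^sup>+x. ennreal (norm (f x) ^ 2) \<partial>lborel)" if "integrable lborel f" for f :: "'n heis \<Rightarrow> complex"
    using fan_L2_bound[OF that] by simp
qed simp

section \<open>Volume growth of the two weights\<close>

lemma emeasure_lborel_ball_le:
  assumes "0 \<le> s"
  shows "emeasure lborel {w :: 'a::euclidean_space. norm w < s} \<le> ennreal ((2 * s) ^ DIM('a))"
proof -
  have "emeasure lborel {w :: 'a. norm w < s} \<le> emeasure lborel (cbox (- (s *\<^sub>R One)) (s *\<^sub>R One :: 'a))"
  proof (rule emeasure_mono)
    show "{w :: 'a. norm w < s} \<subseteq> cbox (- (s *\<^sub>R One)) (s *\<^sub>R One)"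
    proof
      fix w :: 'a assume "w \<in> {w. norm w < s}"
      hence "\<bar>w \<bullet> b\<bar> \<le> s" if "b \<in> Basis" for b using Basis_le_norm[OF that, of w] by simp
      thus "w \<in> cbox (- (s *\<^sub>R One)) (s *\<^sub>R One)" by (force simp: mem_box abs_le_iff)
    qed
  qed simp
  also have "\<dots> = ennreal (\<Prod>b\<in>(Basis :: 'a set). (s *\<^sub>R One - - (s *\<^sub>R One)) \<bullet> b)"
    by (rule emeasure_lborel_cbox) (use assms in simp)
  also have "(\<Prod>b\<in>(Basis :: 'a set). (s *\<^sub>R One - - (s *\<^sub>R One)) \<bullet> b) = (2 * s) ^ DIM('a)"
  proof -
    have "(s *\<^sub>R One - - (s *\<^sub>R One)) \<bullet> b = 2 * s" if "b \<in> Basis" for b :: 'a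
      using that by (simp add: inner_add_left)
    hence "(\<Prod>b\<in>(Basis :: 'a set). (s *\<^sub>R One - - (s *\<^sub>R One)) \<bullet> b) = (\<Prod>b\<in>(Basis :: 'a set). 2 * s)"
      by (rule prod.cong[OF refl])
    thus ?thesis by simp
  qed
  finally show ?thesis .
qed

lemma emeasure_complex_ball_le:
  assumes "0 \<le> s"
  shows "emeasure lborel {w :: complex ^ 'n::finite. norm w < s} \<le> ennreal ((2 * s) ^ (2 * CARD('n)))"
  using emeasure_lborel_ball_le[OF assms, where 'a = "complex ^ 'n"] by (simp only: DIM_complex_vec)

text \<open>The homogeneous norm to the power 2n + 2, the homogeneous dimension of the group; this
  makes the volume of sublevel sets linear in the level.\<close>

definition heis_size :: "'n::finite heis \<Rightarrow> real" where
  "heis_size x = (norm (fst x) ^ 4 + 16 * (snd x)\<^sup>2) powr ((real CARD('n) + 1) / 2)"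

lemma fst_snd_borel [measurable]:
  "fst \<in> borel_measurable (borel :: ('a::euclidean_space \<times> 'b::euclidean_space) measure)"
  "snd \<in> borel_measurable (borel :: ('a::euclidean_space \<times> 'b::euclidean_space) measure)"
  unfolding borel_prod[symmetric] by measurable

lemma heis_size_meas [measurable]: "heis_size \<in> borel_measurable lborel"
  unfolding heis_size_def by measurable

text \<open>With s the radius belonging to R, the sublevel set lies in the product of the ball of
  radius s and the interval of t with 4|t| \<le> s^2; the volumes contribute s^(2n) and s^2, whose
  product is R.\<close>

lemma emeasure_heis_size:
  assumes R: "0 < R"
  shows "emeasure lborel {x :: 'n::finite heis. heis_size x < R} \<le> ennreal (2 ^ (2 * CARD('n)) * R)"
proof -
  let ?n = "CARD('n)"
  define s where "s = R powr (1 / (2 * (real ?n + 1)))"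
  have s: "0 < s" using R by (simp add: s_def)
  have s4: "s ^ 4 = R powr (2 / (real ?n + 1))"
  proof -
    have "s ^ 4 = s powr 4" using s by (simp add: powr_numeral)
    moreover have "1 / (2 * x) * 4 = 2 / x" for x :: real by simp
    ultimately show ?thesis by (simp only: s_def powr_powr)
  qed
  have sR: "s ^ (2 * ?n) * s\<^sup>2 = R"
  proof -
    have "s ^ (2 * ?n) * s\<^sup>2 = s powr (real (2 * ?n + 2))"
      using s by (simp only: powr_realpow power_add)
    also have "\<dots> = R powr (1 / (2 * (real ?n + 1)) * (2 * (real ?n + 1)))"
      unfolding s_def powr_powr by (intro arg_cong[of _ _ "\<lambda>e. R powr e"]) simp
    also have "1 / (2 * (real ?n + 1)) * (2 * (real ?n + 1)) = 1" by simp
    finally show ?thesis using R by simp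
  qed
  have sub: "{x :: 'n heis. heis_size x < R} \<subseteq> {z. norm z < s} \<times> {- (s\<^sup>2 / 4) .. s\<^sup>2 / 4}"
  proof
    fix x :: "'n heis" assume "x \<in> {x. heis_size x < R}"
    hence x: "heis_size x < R" by simp
    obtain z t where zt: "x = (z, t)" by (cases x)
    define X where "X = norm z ^ 4 + 16 * t\<^sup>2"
    have X0: "0 \<le> X" by (simp add: X_def)
    have "X < s ^ 4"
    proof (rule ccontr)
      assume "\<not> X < s ^ 4"
      hence "(s ^ 4) powr ((real ?n + 1) / 2) \<le> X powr ((real ?n + 1) / 2)"
        by (intro powr_mono2) (use s in auto)
      also have "(s ^ 4) powr ((real ?n + 1) / 2) = R powr (2 / (real ?n + 1) * ((real ?n + 1) / 2))"
        unfolding s4 powr_powr ..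
      also have "2 / (real ?n + 1) * ((real ?n + 1) / 2) = 1" by simp
      finally show False using x R by (simp add: heis_size_def zt X_def)
    qed
    hence "norm z ^ 4 < s ^ 4" "16 * t\<^sup>2 < s ^ 4"
      unfolding X_def by (smt (verit) zero_le_power2 zero_le_power norm_ge_zero)+
    hence "norm z < s" "(4 * \<bar>t\<bar>)\<^sup>2 < (s\<^sup>2)\<^sup>2"
      using s by (auto simp: power_mult_distrib power_mult[symmetric] dest: power_less_imp_less_base)
    moreover have "4 * \<bar>t\<bar> < s\<^sup>2"
      using \<open>(4 * \<bar>t\<bar>)\<^sup>2 < (s\<^sup>2)\<^sup>2\<close> by (rule power_less_imp_less_base) simp
    ultimately show "x \<in> {z. norm z < s} \<times> {- (s\<^sup>2 / 4) .. s\<^sup>2 / 4}"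
      by (auto simp: zt abs_if split: if_splits)
  qed
  have "emeasure lborel {x :: 'n heis. heis_size x < R} \<le> emeasure (lborel \<Otimes>\<^sub>M lborel) ({z :: complex ^ 'n. norm z < s} \<times> {- (s\<^sup>2 / 4) .. s\<^sup>2 / 4})"
    unfolding lborel_prod
  proof (rule emeasure_mono[OF sub])
    have "{z :: complex ^ 'n. norm z < s} \<times> {- (s\<^sup>2 / 4) .. s\<^sup>2 / 4} \<in> sets (lborel \<Otimes>\<^sub>M lborel)"
      by (intro pair_measureI) simp_all
    thus "{z :: complex ^ 'n. norm z < s} \<times> {- (s\<^sup>2 / 4) .. s\<^sup>2 / 4} \<in> sets lborel"
      unfolding lborel_prod .
  qed
  also have "\<dots> = emeasure lborel {z :: complex ^ 'n. norm z < s} * emeasure lborel {- (s\<^sup>2 / 4) .. s\<^sup>2 / 4}"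
    by (rule lborel.emeasure_pair_measure_Times) simp_all
  also have "\<dots> \<le> ennreal ((2 * s) ^ (2 * ?n)) * ennreal (s\<^sup>2)"
  proof (rule mult_mono)
    show "emeasure lborel {z :: complex ^ 'n. norm z < s} \<le> ennreal ((2 * s) ^ (2 * ?n))"
      using s by (intro emeasure_complex_ball_le) simp
    show "emeasure lborel {- (s\<^sup>2 / 4) .. s\<^sup>2 / 4} \<le> ennreal (s\<^sup>2)"
      by (subst emeasure_lborel_Icc) (auto intro: ennreal_leI)
  qed simp_all
  also have "\<dots> = ennreal (2 ^ (2 * ?n) * (s ^ (2 * ?n) * s\<^sup>2))"
    using s by (simp add: power_mult_distrib mult.assoc flip: ennreal_mult)
  finally show ?thesis unfolding sR .
qed

text \<open>The exponent 4n + 1 is a dimension count: 2n for w, and 2n + 1 for lambda, whose density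
  is |lambda|^(2n).\<close>

definition fan_size :: "(nat \<times> real) \<times> (complex ^ 'n::finite) \<Rightarrow> real" where
  "fan_size = (\<lambda>((k, l), w). ((2 * real k + real CARD('n) + 1) * \<bar>l\<bar> + norm w) powr (4 * real CARD('n) + 1))"

lemma fan_size_meas [measurable]:
  "fan_size \<in> borel_measurable ((count_space UNIV \<Otimes>\<^sub>M lborel) \<Otimes>\<^sub>M (lborel :: (complex ^ 'n::finite) measure))"
  unfolding fan_size_def case_prod_unfold by measurable

text \<open>As a function of k, \<open>bcoef n k\<close> grows like the power n - 1, so the quotient
  is of order k^(-3). Any summable bound does; it makes the rays together contribute no more than a
  constant multiple of one of them.\<close>

lemma bcoef_quotient_le:
  assumes n: "0 < n"
  shows "(bcoef n k)\<^sup>2 / (2 * real k + real n + 1) ^ (2 * n + 1) \<le> 1 / real (Suc k) ^ 2"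
proof -
  define x where "x = real (k + n)"
  have x: "real (Suc k) \<le> x" "1 \<le> x" using n by (auto simp: x_def)
  have "bcoef n k = real ((k + n - 1) choose (n - 1))"
    using n binomial_symmetric[of k "k + n - 1"] by (simp add: bcoef_binomial)
  also have "\<dots> \<le> real ((k + n - 1) ^ (n - 1))"
    by (intro of_nat_mono binomial_le_pow) simp
  also have "\<dots> \<le> x ^ (n - 1)" unfolding x_def of_nat_power by (intro power_mono) auto
  finally have "(bcoef n k)\<^sup>2 \<le> (x ^ (n - 1))\<^sup>2"
    using bcoef_pos[of n k] by (intro power_mono) auto
  moreover have "x ^ (2 * n + 1) \<le> (2 * real k + real n + 1) ^ (2 * n + 1)"
    using x by (intro power_mono) (auto simp: x_def)
  ultimately have "(bcoef n k)\<^sup>2 / (2 * real k + real n + 1) ^ (2 * n + 1) \<le> (x ^ (n - 1))\<^sup>2 / x ^ (2 * n + 1)"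
    using x by (intro frac_le) auto
  also have "(x ^ (n - 1))\<^sup>2 / x ^ (2 * n + 1) = 1 / x ^ 3"
  proof -
    have "2 * n + 1 = (n - 1) * 2 + 3" using n by simp
    hence "x ^ (2 * n + 1) = (x ^ (n - 1))\<^sup>2 * x ^ 3" by (simp only: power_add power_mult)
    thus ?thesis using x by simp
  qed
  also have "\<dots> \<le> 1 / real (Suc k) ^ 2"
  proof -
    have "real (Suc k) ^ 2 \<le> x ^ 2" using x by (intro power_mono) auto
    also have "\<dots> \<le> x ^ 3" using x by (intro power_increasing) auto
    finally show ?thesis by (intro divide_left_mono) (use x in auto)
  qed
  finally show ?thesis .
qed

lemma nn_integral_abs_power_le:
  assumes "0 \<le> \<rho>"
  shows "(\<integral>\<^sup>+l. ennreal (\<bar>l\<bar> ^ m) * indicator {l. \<bar>l\<bar> \<le> \<rho>} l \<partial>lborel) \<le> ennreal (2 * \<rho> ^ (m + 1))"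
proof -
  have "(\<integral>\<^sup>+l. ennreal (\<bar>l\<bar> ^ m) * indicator {l. \<bar>l\<bar> \<le> \<rho>} l \<partial>lborel) \<le> (\<integral>\<^sup>+l. ennreal (\<rho> ^ m) * indicator {- \<rho>..\<rho>} l \<partial>lborel)"
    by (intro nn_integral_mono) (auto simp: indicator_def intro!: ennreal_leI power_mono)
  also have "\<dots> = ennreal (\<rho> ^ m) * emeasure lborel {- \<rho>..\<rho>}"
    by (rule nn_integral_cmult_indicator) simp
  also have "\<dots> = ennreal (2 * \<rho> ^ (m + 1))"
    using assms by (simp add: mult_ac flip: ennreal_mult)
  finally show ?thesis .
qed

lemma summable_inverse_squares: "summable (\<lambda>k. 1 / real (Suc k) ^ 2)"
  using inverse_power_summable[of 2, where 'a = real] summable_Suc_iff[of "\<lambda>k. inverse (real k ^ 2)"] by (simp add: divide_inverse)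

text \<open>On the ray k, a size below R confines |l| to s / \<mu> k and w to the ball of radius s.
  Integrating the density |l|^(2n) gives the power 2n + 1 of s / \<mu> k, and the resulting powers
  of \<mu> k make the sum over k converge.\<close>

lemma emeasure_fan_size:
  assumes R: "0 < R"
  shows "emeasure fan_measure {y :: (nat \<times> real) \<times> (complex ^ 'n::finite). fan_size y < R}
    \<le> ennreal (2 ^ (2 * CARD('n) + 1) * (\<Sum>k. 1 / real (Suc k) ^ 2) * R)"
proof -
  let ?n = "CARD('n)"
  define s where "s = R powr (1 / (4 * real ?n + 1))"
  have s: "0 < s" using R by (simp add: s_def)
  have sR: "s ^ (2 * ?n + 1) * s ^ (2 * ?n) = R"
  proof -
    have "s ^ (2 * ?n + 1) * s ^ (2 * ?n) = s powr (real (2 * ?n + 1 + 2 * ?n))"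
      using s by (simp only: powr_realpow power_add)
    also have "\<dots> = R powr (1 / (4 * real ?n + 1) * (4 * real ?n + 1))"
      unfolding s_def powr_powr by (intro arg_cong[of _ _ "\<lambda>e. R powr e"]) simp
    also have "1 / (4 * real ?n + 1) * (4 * real ?n + 1) = 1" by (simp add: add_nonneg_eq_0_iff)
    finally show ?thesis using R by simp
  qed
  define \<mu> where "\<mu> k = 2 * real k + real ?n + 1" for k
  have \<mu>: "0 < \<mu> k" for k by (simp add: \<mu>_def add_nonneg_pos)
  have lt: "\<bar>l\<bar> \<le> s / \<mu> k \<and> norm w < s" if "fan_size ((k, l), w :: complex ^ 'n) < R" for k l w
  proof -
    define X where "X = \<mu> k * \<bar>l\<bar> + norm w"
    have X0: "0 \<le> X" using \<mu>[of k] by (simp add: X_def)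
    have "X < s"
    proof (rule ccontr)
      assume "\<not> X < s"
      hence "s powr (4 * real ?n + 1) \<le> X powr (4 * real ?n + 1)" by (intro powr_mono2) (use s in auto)
      also have "s powr (4 * real ?n + 1) = R powr (1 / (4 * real ?n + 1) * (4 * real ?n + 1))"
        unfolding s_def powr_powr ..
      also have "1 / (4 * real ?n + 1) * (4 * real ?n + 1) = 1" by (simp add: add_nonneg_eq_0_iff)
      finally show False using that R by (simp add: fan_size_def X_def \<mu>_def)
    qed
    hence "\<mu> k * \<bar>l\<bar> \<le> s" "norm w < s"
      using \<mu>[of k] unfolding X_def by (smt (verit) norm_ge_zero mult_nonneg_nonneg abs_ge_zero)+
    thus ?thesis using \<mu>[of k] by (simp add: pos_le_divide_eq mult.commute)
  qed
  let ?A = "{y :: (nat \<times> real) \<times> (complex ^ 'n). fan_size y < R}"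
  have A_meas: "?A \<in> sets ((count_space UNIV \<Otimes>\<^sub>M lborel) \<Otimes>\<^sub>M lborel)"
    using borel_measurable_less[OF fan_size_meas borel_measurable_const[of R]]
    unfolding space_pair_measure by (simp only: space_count_space space_lborel space_borel UNIV_Times_UNIV UNIV_I simp_thms)
  note [measurable] = A_meas
  let ?a = "\<lambda>k l. (\<integral>\<^sup>+w. indicator ?A ((k, l), w) \<partial>lborel)"
  let ?b = "\<lambda>k. ennreal ((bcoef ?n k)\<^sup>2 * (2 * s) ^ (2 * ?n))"
  let ?d = "\<lambda>k l. ennreal (\<bar>l\<bar> ^ (2 * ?n)) * indicator {l. \<bar>l\<bar> \<le> s / \<mu> k} l"
  have "emeasure fan_measure ?A = (\<integral>\<^sup>+y. indicator ?A y \<partial>fan_measure)"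
    by (rule nn_integral_indicator[symmetric]) (simp only: sets_fan_measure A_meas)
  also have "\<dots> = (\<integral>\<^sup>+x. ennreal (plancherel_weight ?n x) * (\<integral>\<^sup>+w. indicator ?A (x, w) \<partial>lborel) \<partial>(count_space UNIV \<Otimes>\<^sub>M lborel))"
    by (rule nn_integral_fan_measure) measurable
  also have "\<dots> = (\<integral>\<^sup>+l. (\<Sum>k. ennreal (plancherel_weight ?n (k, l)) * ?a k l) \<partial>lborel)"
    by (rule nn_integral_params) measurable
  also have "\<dots> \<le> (\<integral>\<^sup>+l. (\<Sum>k. ?b k * (?d k l)) \<partial>lborel)"
  proof (intro nn_integral_mono suminf_le summableI)
    fix l k
    have "?a k l \<le> (\<integral>\<^sup>+w. indicator {l. \<bar>l\<bar> \<le> s / \<mu> k} l * indicator {w :: complex ^ 'n. norm w < s} w \<partial>lborel)"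
      using lt by (intro nn_integral_mono) (auto simp: indicator_def)
    also have "\<dots> = indicator {l. \<bar>l\<bar> \<le> s / \<mu> k} l * emeasure lborel {w :: complex ^ 'n. norm w < s}"
      by (rule nn_integral_cmult_indicator) simp
    also have "\<dots> \<le> indicator {l. \<bar>l\<bar> \<le> s / \<mu> k} l * ennreal ((2 * s) ^ (2 * ?n))"
      using s by (intro mult_left_mono emeasure_complex_ball_le) simp_all
    finally have 1: "?a k l \<le> indicator {l. \<bar>l\<bar> \<le> s / \<mu> k} l * ennreal ((2 * s) ^ (2 * ?n))" .
    have "plancherel_weight ?n (k, l) \<le> (bcoef ?n k)\<^sup>2 * \<bar>l\<bar> ^ (2 * ?n)"
    proof -
      have "1 \<le> (2 * pi) ^ (2 * ?n + 1)" using pi_ge_two by (intro one_le_power) simp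
      hence "(bcoef ?n k)\<^sup>2 * \<bar>l\<bar> ^ (2 * ?n) / (2 * pi) ^ (2 * ?n + 1) \<le> (bcoef ?n k)\<^sup>2 * \<bar>l\<bar> ^ (2 * ?n) / 1"
        by (intro divide_left_mono) auto
      thus ?thesis by (simp add: plancherel_weight_def)
    qed
    hence "ennreal (plancherel_weight ?n (k, l)) * ?a k l
      \<le> ennreal ((bcoef ?n k)\<^sup>2 * \<bar>l\<bar> ^ (2 * ?n)) * (indicator {l. \<bar>l\<bar> \<le> s / \<mu> k} l * ennreal ((2 * s) ^ (2 * ?n)))"
      by (intro mult_mono 1 ennreal_leI) simp_all
    also have "\<dots> = ?b k * (?d k l)"
      using s by (simp add: ennreal_mult mult_ac)
    finally show "ennreal (plancherel_weight ?n (k, l)) * ?a k l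
      \<le> ?b k * (?d k l)" .
  qed
  also have "\<dots> = (\<Sum>k. \<integral>\<^sup>+l. ?b k * (?d k l) \<partial>lborel)"
    by (rule nn_integral_suminf) measurable
  also have "\<dots> \<le> (\<Sum>k. ennreal (2 ^ (2 * ?n + 1) * R * (1 / real (Suc k) ^ 2)))"
  proof (intro suminf_le summableI)
    fix k
    have "(\<integral>\<^sup>+l. ?b k * (?d k l) \<partial>lborel)
      = ?b k * (\<integral>\<^sup>+l. ?d k l \<partial>lborel)"
      by (rule nn_integral_cmult) measurable
    also have "\<dots> \<le> ?b k * ennreal (2 * (s / \<mu> k) ^ (2 * ?n + 1))"
      using s \<mu>[of k] by (intro mult_left_mono nn_integral_abs_power_le) simp_all
    also have "\<dots> = ennreal ((bcoef ?n k)\<^sup>2 * (2 * s) ^ (2 * ?n) * (2 * (s / \<mu> k) ^ (2 * ?n + 1)))"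
      using s \<mu>[of k] by (intro ennreal_mult[symmetric]) simp_all
    also have "(bcoef ?n k)\<^sup>2 * (2 * s) ^ (2 * ?n) * (2 * (s / \<mu> k) ^ (2 * ?n + 1))
      = 2 ^ (2 * ?n + 1) * (s ^ (2 * ?n + 1) * s ^ (2 * ?n)) * ((bcoef ?n k)\<^sup>2 / \<mu> k ^ (2 * ?n + 1))"
      unfolding power_mult_distrib power_divide power_add[of 2 "2 * ?n" 1] power_one_right by (simp only: divide_inverse mult_ac)
    also have "\<dots> = 2 ^ (2 * ?n + 1) * R * ((bcoef ?n k)\<^sup>2 / \<mu> k ^ (2 * ?n + 1))" unfolding sR ..
    also have "ennreal \<dots> \<le> ennreal (2 ^ (2 * ?n + 1) * R * (1 / real (Suc k) ^ 2))"
      using R bcoef_quotient_le[of ?n k] unfolding \<mu>_def by (intro ennreal_leI mult_left_mono) simp_all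
    finally show "(\<integral>\<^sup>+l. ?b k * (?d k l) \<partial>lborel)
      \<le> ennreal (2 ^ (2 * ?n + 1) * R * (1 / real (Suc k) ^ 2))" .
  qed
  also have "\<dots> = ennreal (\<Sum>k. 2 ^ (2 * ?n + 1) * R * (1 / real (Suc k) ^ 2))"
  proof (rule suminf_ennreal2)
    show "summable (\<lambda>k. 2 ^ (2 * ?n + 1) * R * (1 / real (Suc k) ^ 2))"
      by (intro summable_mult summable_inverse_squares)
  qed (use R in simp)
  also have "(\<Sum>k. 2 ^ (2 * ?n + 1) * R * (1 / real (Suc k) ^ 2)) = 2 ^ (2 * ?n + 1) * R * (\<Sum>k. 1 / real (Suc k) ^ 2)"
    by (intro suminf_mult summable_inverse_squares)
  finally show ?thesis by (simp only: mult_ac)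
qed

section \<open>The Strichartz transform\<close>

lemma integrable_inverse_one_plus_square:
  "integrable lborel (\<lambda>t :: real. complex_of_real (1 / (1 + t\<^sup>2)))"
proof -
  have "einterval (-\<infinity>) \<infinity> = (UNIV :: real set)" by auto
  hence "integrable lborel (\<lambda>t :: real. inverse (1 + t\<^sup>2))"
    using integrable_inverse_1_plus_square by (simp add: set_integrable_def)
  thus ?thesis by (simp only: complex_of_real_integrable_eq inverse_eq_divide)
qed

text \<open>Decay of order twice the dimension suffices: (1 + |x|)^2 dominates 1 + x_b^2 for every
  coordinate, so f is bounded by a multiple of a product of integrable functions of one variable.
  Only the empty list of derivatives is used.\<close>

lemma integrable_schwartz:
  fixes f :: "'a::euclidean_space \<Rightarrow> complex"
  assumes "f \<in> schwartz"
  shows "integrable lborel f"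
proof -
  have f: "f differentiable (at x)" "bounded (range (\<lambda>x. (1 + norm x) ^ N *\<^sub>R f x))" for x and N :: nat
    using assms unfolding schwartz_def by (auto dest!: spec[of _ "[]"])
  have "continuous_on UNIV f"
    using f(1) by (simp add: continuous_on_eq_continuous_within differentiable_imp_continuous_within)
  hence [measurable]: "f \<in> borel_measurable borel" by (rule borel_measurable_continuous_onI)
  obtain C where C: "\<And>x. norm ((1 + norm x) ^ (2 * DIM('a)) *\<^sub>R f x) \<le> C"
    using f(2)[of "2 * DIM('a)"] unfolding bounded_iff by auto
  define g where "g x = (\<Prod>b\<in>Basis. complex_of_real (1 / (1 + (x \<bullet> b)\<^sup>2)))" for x :: 'a
  have "integrable lborel g"
    unfolding g_def by (intro lborel_prod_Basis integrable_inverse_one_plus_square)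
  hence gi: "integrable lborel (\<lambda>x. C * norm (g x))" by simp
  show ?thesis
  proof (rule Bochner_Integration.integrable_bound[OF gi])
    show "AE x in lborel. norm (f x) \<le> norm (C * norm (g x))"
    proof (rule AE_I2)
      fix x :: 'a
      have C0: "0 \<le> C" using C[of x] norm_ge_zero order_trans by blast
      have ng: "norm (g x) = (\<Prod>b\<in>Basis. 1 / (1 + (x \<bullet> b)\<^sup>2))"
        unfolding g_def prod_norm[symmetric] by (intro prod.cong refl) (simp add: norm_divide del: of_real_add)
      have "(\<Prod>b\<in>(Basis :: 'a set). 1 / (1 + norm x)\<^sup>2) \<le> (\<Prod>b\<in>Basis. 1 / (1 + (x \<bullet> b)\<^sup>2))"
      proof (rule prod_mono, intro conjI)
        fix b :: 'a assume b: "b \<in> Basis"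
        have "(x \<bullet> b)\<^sup>2 \<le> (norm x)\<^sup>2" using Basis_le_norm[OF b, of x] by (intro abs_le_square_iff[THEN iffD1]) simp
        hence "1 + (x \<bullet> b)\<^sup>2 \<le> (1 + norm x)\<^sup>2" using norm_ge_zero[of x] by (simp add: power2_sum add_increasing2 del: norm_ge_zero)
        thus "1 / (1 + norm x)\<^sup>2 \<le> 1 / (1 + (x \<bullet> b)\<^sup>2)"
          by (intro divide_left_mono mult_pos_pos) (auto simp: add_pos_nonneg zero_less_power2 add_nonneg_eq_0_iff)
      qed simp
      also have "(\<Prod>b\<in>(Basis :: 'a set). 1 / (1 + norm x)\<^sup>2) = 1 / (1 + norm x) ^ (2 * DIM('a))"
        by (simp add: power_mult power_one_over)
      finally have le: "1 / (1 + norm x) ^ (2 * DIM('a)) \<le> norm (g x)" unfolding ng .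
      have pos: "0 < (1 + norm x) ^ (2 * DIM('a))" by (simp add: add_pos_nonneg)
      have "norm (f x) = norm ((1 + norm x) ^ (2 * DIM('a)) *\<^sub>R f x) * (1 / (1 + norm x) ^ (2 * DIM('a)))"
      proof -
        have "norm (c *\<^sub>R v) * (1 / c) = norm v" if "0 < c" for c :: real and v :: complex
          using that by simp
        from this[OF pos] show ?thesis ..
      qed
      also have "\<dots> \<le> C * norm (g x)" by (intro mult_mono C le C0) (use pos in simp)
      finally show "norm (f x) \<le> norm (C * norm (g x))" using C0 by simp
    qed
  qed measurable
qed

section \<open>The transform in the coordinates (k, lambda, w)\<close>

text \<open>An explicit counterpart on the rays of \<open>ray_index\<close>, whose definite
  description gives no direct access to measurability.\<close>

definition fan_index :: "nat \<Rightarrow> real \<times> real \<Rightarrow> nat" where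
  "fan_index n a = nat \<lfloor>(snd a / \<bar>fst a\<bar> - real n) / 2\<rfloor>"

lemma fan_index_fan_point: "l \<noteq> 0 \<Longrightarrow> fan_index n (fan_point n k l) = k"
  by (simp add: fan_index_def fan_point_def)

lemma fan_index_meas [measurable]: "fan_index n \<in> borel \<rightarrow>\<^sub>M count_space UNIV"
  unfolding fan_index_def by measurable

lemma normalized_strichartz_fan_point:
  fixes w :: "complex ^ 'n::finite"
  assumes "l \<noteq> 0"
  shows "normalized_strichartz f (fan_point CARD('n) k l) w = (\<integral>x. f x * fan_kernel ((k, l), w) x \<partial>lborel)"
proof -
  have l: "fst (fan_point CARD('n) k l) = l" by (simp add: fan_point_def)
  have "normalized_strichartz f (fan_point CARD('n) k l) w
    = of_real (fact k * fact (CARD('n) - 1) / fact (k + CARD('n) - 1)) * (\<integral>x. f x * efun k l (hmult (hinv x) (w, 0)) \<partial>lborel)"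
    using assms unfolding normalized_strichartz_def strichartz_def l ray_index_fan_point[OF assms] Let_def by simp
  also have "\<dots> = (\<integral>x. of_real (1 / bcoef CARD('n) k) * (f x * efun k l (hmult (hinv x) (w, 0))) \<partial>lborel)"
    unfolding integral_mult_right_zero by (simp add: bcoef_def)
  also have "\<dots> = (\<integral>x. f x * fan_kernel ((k, l), w) x \<partial>lborel)"
    unfolding fan_kernel_def prod.case by (intro Bochner_Integration.integral_cong refl) (simp only: mult_ac)
  finally show ?thesis .
qed

text \<open>
  Only points of the rays with w nonzero contribute, as \<open>u_weight\<close> vanishes elsewhere; there
  the integrand is a function of the parameters (k, lambda, w), and \<open>fan_index\<close> expresses k
  measurably.
\<close>
lemma nn_integral_strichartz_le:
  fixes f :: "'n::finite heis \<Rightarrow> complex"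
  assumes f: "integrable lborel f" and q: "0 < q"
  shows "(\<integral>\<^sup>+(a, w). ennreal (norm (normalized_strichartz f a w) powr q * u_weight \<rho> a w powr q)
         \<partial>(nu2 CARD('n) \<Otimes>\<^sub>M lborel))
    \<le> (\<integral>\<^sup>+y. ennreal (norm (\<integral>x. f x * fan_kernel y x \<partial>lborel) powr q *
          fan_size y powr (- (\<rho> / (4 * real CARD('n) + 1)) * q)) \<partial>fan_measure)"
proof -
  let ?n = "CARD('n)"
  define S where "S y = (\<integral>x. f x * fan_kernel y x \<partial>lborel)" for y
  interpret N: sigma_finite_measure "fan_measure :: ((nat \<times> real) \<times> (complex ^ 'n)) measure"
    by (rule sigma_finite_fan_measure)
  have [measurable]: "f \<in> borel_measurable lborel" using f by auto
  note [measurable] = fan_kernel_meas[where 'n = 'n]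
  have S_meas': "S \<in> borel_measurable fan_measure"
    unfolding S_def by measurable
  hence S_meas [measurable]: "S \<in> borel_measurable ((count_space UNIV \<Otimes>\<^sub>M lborel) \<Otimes>\<^sub>M lborel)"
    by (simp cong: measurable_cong_sets add: fan_measure_def)
  define \<Theta> where "\<Theta> a = (fan_index ?n a, fst a)" for a :: "real \<times> real"
  have \<Theta>_meas [measurable]: "\<Theta> \<in> borel \<rightarrow>\<^sub>M count_space UNIV \<Otimes>\<^sub>M lborel"
    unfolding \<Theta>_def by (intro measurable_Pair fan_index_meas) (simp add: fst_snd_borel)
  define E where "E y = ennreal (norm (S y) powr q * fan_size y powr (- (\<rho> / (4 * real ?n + 1)) * q))" for y
  have E_meas [measurable]: "E \<in> borel_measurable ((count_space UNIV \<Otimes>\<^sub>M lborel) \<Otimes>\<^sub>M lborel)"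
    unfolding E_def by measurable
  \<comment> \<open>Agrees with the integrand on the fan but is defined and Borel measurable on the
    whole space, so it can be integrated first in w and then transported along
    \<open>fan_point\<close>.\<close>
  define \<Psi> where "\<Psi> = (\<lambda>(a, w). if fst a \<noteq> 0 \<and> w \<noteq> 0 then E (\<Theta> a, w) else 0)"
  have \<Psi>_borel: "\<Psi> \<in> borel_measurable (borel \<Otimes>\<^sub>M (borel :: (complex ^ 'n) measure))"
  proof -
    have "open {p :: (real \<times> real) \<times> (complex ^ 'n). fst (fst p) \<noteq> 0 \<and> snd p \<noteq> 0}"
      by (intro open_Collect_conj open_Collect_neq continuous_intros)
    hence A: "{p \<in> space ((borel :: (real \<times> real) measure) \<Otimes>\<^sub>M (borel :: (complex ^ 'n) measure)). fst (fst p) \<noteq> 0 \<and> snd p \<noteq> 0} \<in> sets (borel \<Otimes>\<^sub>M borel)"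
      unfolding borel_prod by simp
    have "(\<lambda>p. (\<Theta> (fst p), snd p)) \<in> borel \<Otimes>\<^sub>M (borel :: (complex ^ 'n) measure) \<rightarrow>\<^sub>M (count_space UNIV \<Otimes>\<^sub>M lborel) \<Otimes>\<^sub>M lborel"
      by (intro measurable_Pair measurable_compose[OF measurable_fst \<Theta>_meas]) simp
    from measurable_If[OF measurable_compose[OF this E_meas] measurable_const[of 0] A]
    show ?thesis unfolding \<Psi>_def case_prod_unfold by simp
  qed
  have id_meas: "(\<lambda>a. a) \<in> nu2 ?n \<rightarrow>\<^sub>M borel"
    by (rule measurable_cong_sets[OF sets_nu2 refl, THEN equalityD2, THEN subsetD]) (rule measurable_restrict_space1, simp)
  have \<Psi>_meas: "\<Psi> \<in> borel_measurable (nu2 ?n \<Otimes>\<^sub>M lborel)"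
  proof -
    have "(\<lambda>p. (fst p, snd p)) \<in> nu2 ?n \<Otimes>\<^sub>M lborel \<rightarrow>\<^sub>M borel \<Otimes>\<^sub>M (borel :: (complex ^ 'n) measure)"
      by (intro measurable_Pair measurable_compose[OF measurable_fst id_meas]) measurable
    from measurable_compose[OF this \<Psi>_borel] show ?thesis by simp
  qed
  have int_meas: "(\<lambda>a. \<integral>\<^sup>+w. \<Psi> (a, w) \<partial>lborel) \<in> borel_measurable (restrict_space borel (fan ?n))"
    using lborel.borel_measurable_nn_integral_fst[OF \<Psi>_meas] by (simp cong: measurable_cong_sets add: sets_nu2)
  have point: "ennreal (norm (normalized_strichartz f a w) powr q * u_weight \<rho> a w powr q) = \<Psi> (a, w)"
    if a: "a \<in> fan ?n" for a and w :: "complex ^ 'n"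
  proof (cases "fst a \<noteq> 0 \<and> w \<noteq> 0")
    case False
    thus ?thesis using q by (auto simp: \<Psi>_def u_weight_def)
  next
    case True
    then obtain k l where al: "a = fan_point ?n k l" and l: "l \<noteq> 0"
      using a by (auto simp: fan_def ray_def ray_infinity_def)
    have pos: "0 < (2 * real k + real ?n + 1) * \<bar>l\<bar> + norm w"
      using True by (intro add_nonneg_pos) auto
    have "u_weight \<rho> a w = ((2 * real k + real ?n + 1) * \<bar>l\<bar> + norm w) powr (- \<rho>)"
      using True l unfolding al u_weight_def fan_norm_def ray_index_fan_point[OF l] by (simp add: fan_point_def)
    hence "u_weight \<rho> a w powr q = fan_size ((k, l), w) powr (- (\<rho> / (4 * real ?n + 1)) * q)"
    proof -
      assume u: "u_weight \<rho> a w = ((2 * real k + real ?n + 1) * \<bar>l\<bar> + norm w) powr (- \<rho>)"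
      have "4 * real ?n + 1 \<noteq> 0" by (simp add: add_nonneg_eq_0_iff)
      hence "(4 * real ?n + 1) * (- (\<rho> / (4 * real ?n + 1)) * q) = - \<rho> * q" by simp
      thus ?thesis unfolding u fan_size_def prod.case powr_powr by simp
    qed
    moreover have "\<Theta> a = (k, l)" unfolding \<Theta>_def al fan_index_fan_point[OF l] by (simp add: fan_point_def)
    ultimately show ?thesis using True unfolding \<Psi>_def E_def S_def al normalized_strichartz_fan_point[OF l] by simp
  qed
  have "(\<integral>\<^sup>+(a, w). ennreal (norm (normalized_strichartz f a w) powr q * u_weight \<rho> a w powr q) \<partial>(nu2 ?n \<Otimes>\<^sub>M lborel))
    = (\<integral>\<^sup>+p. \<Psi> p \<partial>(nu2 ?n \<Otimes>\<^sub>M lborel))"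
    by (rule nn_integral_cong) (auto simp: space_pair_measure point)
  also have "\<dots> = (\<integral>\<^sup>+a. (\<integral>\<^sup>+w. \<Psi> (a, w) \<partial>lborel) \<partial>nu2 ?n)"
    by (rule lborel.nn_integral_fst[OF \<Psi>_meas, symmetric])
  also have "\<dots> = (\<integral>\<^sup>+x. (\<integral>\<^sup>+w. \<Psi> ((\<lambda>(k, l). fan_point ?n k l) x, w) \<partial>lborel)
      \<partial>density (count_space UNIV \<Otimes>\<^sub>M lborel) (\<lambda>x. ennreal (plancherel_weight ?n x)))"
  proof -
    have "nu2 ?n = distr (density (count_space UNIV \<Otimes>\<^sub>M lborel) (\<lambda>x. ennreal (plancherel_weight ?n x))) (restrict_space borel (fan ?n)) (\<lambda>(k, l). fan_point ?n k l)"
      unfolding nu2_def plancherel_weight_def bcoef_def by (simp add: case_prod_unfold)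
    thus ?thesis using int_meas measurable_fan_point[of ?n] by (simp add: nn_integral_distr)
  qed
  also have "\<dots> = (\<integral>\<^sup>+x. ennreal (plancherel_weight ?n x) * (\<integral>\<^sup>+w. \<Psi> ((\<lambda>(k, l). fan_point ?n k l) x, w) \<partial>lborel) \<partial>(count_space UNIV \<Otimes>\<^sub>M lborel))"
    by (rule nn_integral_density[OF _ measurable_compose[OF measurable_fan_point int_meas]]) measurable
  also have "\<dots> \<le> (\<integral>\<^sup>+x. ennreal (plancherel_weight ?n x) * (\<integral>\<^sup>+w. E (x, w) \<partial>lborel) \<partial>(count_space UNIV \<Otimes>\<^sub>M lborel))"
  proof (intro nn_integral_mono mult_left_mono)
    fix x :: "nat \<times> real" and w :: "complex ^ 'n"
    obtain k l where x: "x = (k, l)" by (cases x)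
    show "\<Psi> ((\<lambda>(k, l). fan_point ?n k l) x, w) \<le> E (x, w)"
    proof (cases "l = 0")
      case True
      thus ?thesis by (simp add: x \<Psi>_def fan_point_def)
    next
      case False
      hence "\<Theta> (fan_point ?n k l) = (k, l)" unfolding \<Theta>_def fan_index_fan_point[OF False] by (simp add: fan_point_def)
      thus ?thesis by (simp add: x \<Psi>_def)
    qed
  qed simp
  also have "\<dots> = (\<integral>\<^sup>+y. E y \<partial>fan_measure)"
    by (rule nn_integral_fan_measure[symmetric]) measurable
  finally show ?thesis unfolding E_def S_def .
qed

lemma ennreal_rpow_mono:
  assumes "X \<le> ennreal c" "0 \<le> c" "0 \<le> r"
  shows "ennreal_rpow X r \<le> ennreal (c powr r)"
proof -
  obtain x where x: "X = ennreal x" "0 \<le> x" using assms(1) by (cases X rule: ennreal_cases) (auto simp: top_unique)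
  with assms have "x \<le> c" by simp
  thus ?thesis unfolding x(1) ennreal_rpow_ennreal[OF x(2)] using x assms by (intro ennreal_leI powr_mono2) auto
qed

theorem theorem5p3p1:
  fixes p q p' \<alpha> \<rho> :: real
  assumes "1 < p" "p \<le> q"
    and "1 / p + 1 / p' = 1"
    and "0 < \<alpha>" "0 < \<rho>"
    and "\<alpha> * p' < 2 * (real CARD('n::finite) + 1)"
    and "q * \<rho> < 4 * real CARD('n) + 1"
    and "- \<alpha> / (2 * (real CARD('n) + 1)) + 1 / p' + \<rho> / (4 * real CARD('n) + 1) - 1 / q = 0"
  shows "\<exists>C::real. 0 \<le> C \<and> (\<forall>f \<in> (schwartz :: ('n heis \<Rightarrow> complex) set).
    ennreal_rpow
      (\<integral>\<^sup>+(a, w). ennreal (norm (normalized_strichartz f a w) powr q * u_weight \<rho> a w powr q)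
         \<partial>(nu2 CARD('n) \<Otimes>\<^sub>M lborel)) (1 / q)
    \<le> ennreal C *
    ennreal_rpow
      (\<integral>\<^sup>+x. ennreal (norm (f x) powr p * v_weight \<alpha> x powr p) \<partial>lborel) (1 / p))"
proof -
  let ?n = "CARD('n)"
  \<comment> \<open>These exponents make \<open>v_weight\<close> the power a of
    \<open>heis_size\<close> and, where it is nonzero, \<open>u_weight\<close> the power -b of
    \<open>fan_size\<close>; the last hypothesis becomes \<open>balance\<close>.\<close>
  define a where "a = \<alpha> / (2 * (real ?n + 1))"
  define b where "b = \<rho> / (4 * real ?n + 1)"
  have q: "0 < q" "1 < q" using assms(1,2) by auto
  have p'0: "0 < p'"
  proof -
    have "1 / p' = 1 - 1 / p" using assms(3) by simp
    also have "\<dots> > 0" using assms(1) by simp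
    finally show ?thesis by simp
  qed
  have ab: "0 < a" "0 < b" using assms(4,5) by (auto simp: a_def b_def add_nonneg_pos)
  have balance: "1 / p' - a = 1 / q - b"
    using assms(8) unfolding a_def b_def by simp
  have sub: "0 < 1 / p' - a"
  proof -
    have "\<alpha> / (2 * (real ?n + 1)) < 1 / p'" using assms(6) p'0 by (simp add: divide_less_eq less_divide_eq field_simps)
    thus ?thesis by (simp add: a_def)
  qed
  have sizes: "0 < (\<Sum>k. 1 / real (Suc k) ^ 2)"
    by (rule suminf_pos[OF summable_inverse_squares]) simp
  interpret W: weighted_kernel_op "lborel :: 'n heis measure" fan_measure fan_kernel 1 heis_size fan_size
    "2 ^ (2 * ?n)" "2 ^ (2 * ?n + 1) * (\<Sum>k. 1 / real (Suc k) ^ 2)" p q p' a b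
  proof (intro weighted_kernel_op.intro kernel_op_fan weighted_kernel_op_axioms.intro)
    show "fan_size \<in> borel_measurable (fan_measure :: ((nat \<times> real) \<times> (complex ^ 'n)) measure)"
      using fan_size_meas by (simp cong: measurable_cong_sets add: fan_measure_def)
    show "emeasure lborel {x \<in> space lborel. heis_size (x :: 'n heis) < R} \<le> ennreal (2 ^ (2 * ?n) * R)" if "0 < R" for R
      using emeasure_heis_size[OF that, where 'n = 'n] by simp
    show "emeasure fan_measure {y \<in> space fan_measure. fan_size (y :: (nat \<times> real) \<times> (complex ^ 'n)) < R}
      \<le> ennreal (2 ^ (2 * ?n + 1) * (\<Sum>k. 1 / real (Suc k) ^ 2) * R)" if "0 < R" for R
      using emeasure_fan_size[OF that, where 'n = 'n] by simp
  qed (use assms(1-3) ab balance sub sizes in \<open>simp_all add: heis_size_def fan_size_def split: prod.split\<close>)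
  obtain C where C: "0 < C" and bound: "\<And>f J. integrable lborel f \<Longrightarrow> 0 \<le> J \<Longrightarrow>
      (\<integral>\<^sup>+x. ennreal (norm (f x) powr p * heis_size (x :: 'n heis) powr (a * p)) \<partial>lborel) \<le> ennreal J \<Longrightarrow>
      (\<integral>\<^sup>+y. ennreal (norm (W.T f y) powr q * fan_size y powr (- b * q)) \<partial>fan_measure) \<le> ennreal (C * J powr (q / p))"
    using W.weighted_inequality by blast
  have "ennreal_rpow
      (\<integral>\<^sup>+(a, w). ennreal (norm (normalized_strichartz f a w) powr q * u_weight \<rho> a w powr q)
         \<partial>(nu2 ?n \<Otimes>\<^sub>M lborel)) (1 / q)
    \<le> ennreal (C powr (1 / q)) *
    ennreal_rpow (\<integral>\<^sup>+x. ennreal (norm (f x) powr p * v_weight \<alpha> x powr p) \<partial>lborel) (1 / p)"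
    if fs: "f \<in> schwartz" for f :: "'n heis \<Rightarrow> complex"
  proof -
    have f: "integrable lborel f" by (rule integrable_schwartz[OF fs])
    define Y where "Y = (\<integral>\<^sup>+x. ennreal (norm (f x) powr p * v_weight \<alpha> x powr p) \<partial>lborel)"
    show ?thesis
    proof (cases "Y = \<infinity>")
      case True
      \<comment> \<open>Positivity of C matters here: it keeps the right side infinite, as 0 times
        infinity is 0 in \<open>ennreal\<close>.\<close>
      thus ?thesis using C unfolding Y_def[symmetric] by (simp add: ennreal_rpow_def ennreal_mult_top)
    next
      case False
      then obtain J where J: "Y = ennreal J" "0 \<le> J" by (cases Y rule: ennreal_cases) auto
      have v: "v_weight \<alpha> x powr p = heis_size x powr (a * p)" for x :: "'n heis"
      proof -
        have "(real ?n + 1) / 2 * (a * p) = \<alpha> / 4 * p" by (simp add: a_def divide_simps)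
        thus ?thesis unfolding v_weight_def heis_size_def powr_powr by (simp only:)
      qed
      have "(\<integral>\<^sup>+(a, w). ennreal (norm (normalized_strichartz f a w) powr q * u_weight \<rho> a w powr q) \<partial>(nu2 ?n \<Otimes>\<^sub>M lborel))
        \<le> ennreal (C * J powr (q / p))"
        using nn_integral_strichartz_le[OF f q(1), of \<rho>] bound[OF f J(2)] J(1)
        unfolding Y_def v W.T_def b_def by (auto intro: order_trans)
      hence "ennreal_rpow (\<integral>\<^sup>+(a, w). ennreal (norm (normalized_strichartz f a w) powr q * u_weight \<rho> a w powr q) \<partial>(nu2 ?n \<Otimes>\<^sub>M lborel)) (1 / q)
        \<le> ennreal ((C * J powr (q / p)) powr (1 / q))"
        by (rule ennreal_rpow_mono) (use C q in auto)
      also have "(C * J powr (q / p)) powr (1 / q) = C powr (1 / q) * J powr (1 / p)"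
        using C q by (simp add: powr_mult powr_powr)
      also have "ennreal \<dots> = ennreal (C powr (1 / q)) * ennreal_rpow Y (1 / p)"
        unfolding J(1) ennreal_rpow_ennreal[OF J(2)] by (rule ennreal_mult) auto
      finally show ?thesis unfolding Y_def .
    qed
  qed
  thus ?thesis by (intro exI[of _ "C powr (1 / q)"]) auto
qed

end
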